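(* Let $n\ge1$ and $1\le i\le n$, let $\mathbf{k}_i=(l_1,\ldots,l_{i-1})$ and $\mathbf{l}_i=(l_{i+1},\ldots,l_n)$ be ordered tuples of positive integers (with $\mathbf{k}_1$ and $\mathbf{l}_n$ empty), and let $l=l_1+\cdots+l_{i-1}+1+l_{i+1}+\cdots+l_n$ be the weight of the length-$n$ tuple $(\mathbf{k}_i,1,\mathbf{l}_i)=(l_1,\ldots,l_{i-1},1,l_{i+1},\ldots,l_n)$. For a tuple $\mathbf{a}$ let $\mathbf{a}^\vee$ denote $\mathbf{a}$ written in reverse order. For each of the two types $\ddagger\in\{*,\mathrm{sh}\}$ of regularized multiple zeta values, $$\zeta^{\ddagger}(\mathbf{k}_i,1,\mathbf{l}_i)\equiv\zeta^{\ddagger}(\mathbf{l}_i,1,\mathbf{k}_i)\pmod{\mathcal{Z}_l^{(n-1)}+\mathcal{P}_l},$$ $$\zeta^{\ddagger}(\mathbf{k}_i,1,\mathbf{l}_i)\equiv(-1)^{l-1}\,\zeta^{\ddagger}(\mathbf{k}_i^\vee,1,\mathbf{l}_i^\vee)\pmod{\mathcal{Z}_l^{(n-1)}+\mathcal{P}_l}.$$ (The displayed entry $1$ is in position $i$ in $(\mathbf{k}_i,1,\mathbf{l}_i)$ and $(\mathbf{k}_i^\vee,1,\mathbf{l}_i^\vee)$, and in position $n+1-i$ in $(\mathbf{l}_i,1,\mathbf{k}_i)$.)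
   Context: Multiple zeta values (MZVs): for positive integers $l_1,\ldots,l_n$ with $n\ge1$, $l_1\ge2$, $\zeta(l_1,\ldots,l_n)=\sum_{m_1>\cdots>m_n>0}\frac{1}{m_1^{l_1}\cdots m_n^{l_n}}$; its weight is $l_1+\cdots+l_n$ and its depth is $n$. Vector spaces (all $\mathbb{Q}$-subspaces of $\mathbb{R}$): $\mathcal{Z}_l^{(d)}$ is the $\mathbb{Q}$-span of all MZVs of weight $l$ and depth $d$ (the zero space if there are none, e.g. $d=0$); $\mathcal{P}_l$ is the $\mathbb{Q}$-span of all products of two or more MZVs of total weight $l$ together with the single zeta value $\zeta(l)$ (when $l\ge2$). For a subspace $V$, $a\equiv b \pmod V$ means $a-b\in V$. Regularized multiple zeta values (RMZVs): Let $\mathfrak{H}=\mathbb{Q}\langle x,y\rangle$ be the non-commutative polynomial algebra, $\mathfrak{H}^1=\mathbb{Q}+\mathfrak{H}y$, $\mathfrak{H}^0=\mathbb{Q}+x\mathfrak{H}y$, and $z_k=x^{k-1}y$ for $k\ge1$; $\mathfrak{H}^1$ is freely generated by the $z_k$. The harmonic product $*$ on $\mathfrak{H}^1$ is the $\mathbb{Q}$-bilinear product with $1*w=w*1=w$ and $z_kw_1*z_lw_2=z_k(w_1*z_lw_2)+z_l(z_kw_1*w_2)+z_{k+l}(w_1*w_2)$ for words $w,w_1,w_2\in\mathfrak{H}^1$. The shuffle product $\mathrm{sh}$ is the $\mathbb{Q}$-bilinear product with $1\,\mathrm{sh}\,w=w\,\mathrm{sh}\,1=w$ and $uw_1\,\mathrm{sh}\,vw_2=u(w_1\,\mathrm{sh}\,vw_2)+v(uw_1\,\mathrm{sh}\,w_2)$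 for letters $u,v\in\{x,y\}$ and words $w,w_1,w_2$. Both make $\mathfrak{H}^1$ a commutative $\mathbb{Q}$-algebra with subalgebra $\mathfrak{H}^0$, denoted $\mathfrak{H}^1_*\supset\mathfrak{H}^0_*$ and $\mathfrak{H}^1_{\mathrm{sh}}\supset\mathfrak{H}^0_{\mathrm{sh}}$, and $\mathfrak{H}^1_*\simeq\mathfrak{H}^0_*[y]$, $\mathfrak{H}^1_{\mathrm{sh}}\simeq\mathfrak{H}^0_{\mathrm{sh}}[y]$. The $\mathbb{Q}$-linear evaluation map $Z:\mathfrak{H}^0\to\mathbb{R}$, $Z(1)=1$, $Z(z_{l_1}\cdots z_{l_n})=\zeta(l_1,\ldots,l_n)$, is a homomorphism for both products. Let $Z^*:\mathfrak{H}^1_*\to\mathbb{R}[T]$ and $Z^{\mathrm{sh}}:\mathfrak{H}^1_{\mathrm{sh}}\to\mathbb{R}[T]$ be the unique algebra homomorphisms extending $Z$ and sending $y$ to $T$. For any positive integers $l_1,\ldots,l_n$, the harmonic-type value $\zeta^*(l_1,\ldots,l_n)$ and the shuffle-type value $\zeta^{\mathrm{sh}}(l_1,\ldots,l_n)$ are the values at $T=0$ of $Z^*(z_{l_1}\cdots z_{l_n})$ and $Z^{\mathrm{sh}}(z_{l_1}\cdots z_{l_n})$ respectively. *)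

theory Defs
  imports
    "HOL-Analysis.Analysis"
    "HOL-Library.Poly_Mapping"
    "HOL-Library.Set_Algebras"
    "HOL-Computational_Algebra.Polynomial"
begin

text \<open>The empty index is allowed and gives the value 1 (the sum then ranges over the empty tuple
  only), which is the convention \<open>Z(1) = 1\<close> of the evaluation map below.\<close>

definition mzv :: "nat list \<Rightarrow> real" where
  "mzv ls = (\<Sum>\<^sub>\<infinity>ms\<in>{ms :: nat list. length ms = length ls \<and> sorted_wrt (>) ms \<and> (\<forall>m\<in>set ms. 0 < m)}.
               1 / (\<Prod>i<length ls. real (ms ! i) ^ (ls ! i)))"

definition admissible :: "nat list \<Rightarrow> bool" where
  "admissible ls \<longleftrightarrow> ls \<noteq> [] \<and> (\<forall>l\<in>set ls. 1 \<le> l) \<and> 2 \<le> hd ls"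

text \<open>The span of a set of real numbers over the rationals.\<close>

definition rat_span :: "real set \<Rightarrow> real set" where
  "rat_span = module.span (\<lambda>(q :: rat) (r :: real). of_rat q * r)"

lemma vector_space_rat_real: "vector_space (\<lambda>(q :: rat) (r :: real). of_rat q * r)"
  by unfold_locales (simp_all add: algebra_simps of_rat_add of_rat_mult)

definition mzv_space :: "nat \<Rightarrow> nat \<Rightarrow> real set" where
  "mzv_space l d = rat_span {mzv ls | ls. admissible ls \<and> sum_list ls = l \<and> length ls = d}"

definition mzv_prod_space :: "nat \<Rightarrow> real set" where
  "mzv_prod_space l = rat_span
     ({prod_list (map mzv lss) | lss :: nat list list.
         2 \<le> length lss \<and> (\<forall>ls\<in>set lss. admissible ls) \<and> sum_list (map sum_list lss) = l}
      \<union> (if 2 \<le> l then {mzv [l]} else {}))"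

definition cong_modulo :: "real set \<Rightarrow> real \<Rightarrow> real \<Rightarrow> bool" where
  "cong_modulo V a b \<longleftrightarrow> a - b \<in> V"

datatype letter = LX | LY

text \<open>Finitely supported functions on an additively written monoid carry the convolution product.
  Reading concatenation of lists as addition, \<open>letter list \<Rightarrow>\<^sub>0 rat\<close> is the algebra of the free monoid
  on \<open>LX, LY\<close> over the rationals, and its ring multiplication is concatenation of words.\<close>

instantiation list :: (type) monoid_add
begin

definition zero_list :: "'a list" where "zero_list = []"
definition plus_list :: "'a list \<Rightarrow> 'a list \<Rightarrow> 'a list" where "plus_list = (@)"

instance by standard (simp_all add: zero_list_def plus_list_def)

end

type_synonym ncpoly = "letter list \<Rightarrow>\<^sub>0 rat"

abbreviation nc_word :: "letter list \<Rightarrow> ncpoly" where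
  "nc_word w \<equiv> Poly_Mapping.single w 1"

abbreviation nc_const :: "rat \<Rightarrow> ncpoly" where
  "nc_const c \<equiv> Poly_Mapping.single 0 c"

definition nc_x :: ncpoly where "nc_x = nc_word [LX]"
definition nc_y :: ncpoly where "nc_y = nc_word [LY]"

definition H1 :: "ncpoly set" where
  "H1 = {nc_const c + p * nc_y | c p. True}"

definition H0 :: "ncpoly set" where
  "H0 = {nc_const c + nc_x * p * nc_y | c p. True}"

definition nc_z :: "nat \<Rightarrow> ncpoly" where
  "nc_z k = nc_x ^ (k - 1) * nc_y"

definition nc_zs :: "nat list \<Rightarrow> ncpoly" where
  "nc_zs ks = prod_list (map nc_z ks)"

text \<open>The index of a word: a word of \<open>H1\<close> is uniquely a product of the \<open>nc_z k\<close> with \<open>k \<ge> 1\<close>, and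
  \<open>z_index\<close> returns the list of these \<open>k\<close> (lemma \<open>nc_zs_index\<close>). The first argument of \<open>z_index_aux\<close> counts
  the letters \<open>LX\<close> read since the last \<open>LY\<close>. Outside \<open>H1\<close> the value is irrelevant.\<close>

fun z_index_aux :: "nat \<Rightarrow> letter list \<Rightarrow> nat list" where
  "z_index_aux n [] = []"
| "z_index_aux n (LX # w) = z_index_aux (Suc n) w"
| "z_index_aux n (LY # w) = Suc n # z_index_aux 0 w"

definition z_index :: "letter list \<Rightarrow> nat list" where
  "z_index = z_index_aux 0"

definition bilinear_ext :: "(letter list \<Rightarrow> letter list \<Rightarrow> ncpoly) \<Rightarrow> ncpoly \<Rightarrow> ncpoly \<Rightarrow> ncpoly" where
  "bilinear_ext f p q =
     (\<Sum>u\<in>Poly_Mapping.keys p. \<Sum>v\<in>Poly_Mapping.keys q.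
        nc_const (Poly_Mapping.lookup p u * Poly_Mapping.lookup q v) * f u v)"

fun harmonic_index :: "nat list \<Rightarrow> nat list \<Rightarrow> ncpoly" where
  "harmonic_index [] v = nc_zs v"
| "harmonic_index u [] = nc_zs u"
| "harmonic_index (k # u) (l # v) =
     nc_z k * harmonic_index u (l # v) + nc_z l * harmonic_index (k # u) v + nc_z (k + l) * harmonic_index u v"

text \<open>Meaningful on \<open>H1\<close> only; see \<open>harmonic_z\<close> for the defining recursion.\<close>

definition harmonic :: "ncpoly \<Rightarrow> ncpoly \<Rightarrow> ncpoly" where
  "harmonic = bilinear_ext (\<lambda>u v. harmonic_index (z_index u) (z_index v))"

fun shuffle_word :: "letter list \<Rightarrow> letter list \<Rightarrow> ncpoly" where
  "shuffle_word [] w = nc_word w"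
| "shuffle_word w [] = nc_word w"
| "shuffle_word (a # u) (b # v) =
     nc_word [a] * shuffle_word u (b # v) + nc_word [b] * shuffle_word (a # u) v"

definition shuffle :: "ncpoly \<Rightarrow> ncpoly \<Rightarrow> ncpoly" where
  "shuffle = bilinear_ext shuffle_word"

definition Z_eval :: "ncpoly \<Rightarrow> real" where
  "Z_eval p = (\<Sum>w\<in>Poly_Mapping.keys p. of_rat (Poly_Mapping.lookup p w) * mzv (z_index w))"

text \<open>Homomorphisms of rational algebras from \<open>H1\<close>, equipped with the given product, to the real
  polynomials in one variable \<open>T\<close>. They are made extensional (value \<open>undefined\<close> outside \<open>H1\<close>), so
  that uniqueness on \<open>H1\<close> is uniqueness as a function.\<close>

definition alg_hom_H1 :: "(ncpoly \<Rightarrow> ncpoly \<Rightarrow> ncpoly) \<Rightarrow> (ncpoly \<Rightarrow> real poly) \<Rightarrow> bool" where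
  "alg_hom_H1 prd \<phi> \<longleftrightarrow>
     \<phi> \<in> extensional H1 \<and>
     \<phi> 1 = 1 \<and>
     (\<forall>c. \<forall>p\<in>H1. \<phi> (nc_const c * p) = smult (of_rat c) (\<phi> p)) \<and>
     (\<forall>p\<in>H1. \<forall>q\<in>H1. \<phi> (p + q) = \<phi> p + \<phi> q) \<and>
     (\<forall>p\<in>H1. \<forall>q\<in>H1. \<phi> (prd p q) = \<phi> p * \<phi> q)"

definition reg_hom :: "(ncpoly \<Rightarrow> ncpoly \<Rightarrow> ncpoly) \<Rightarrow> ncpoly \<Rightarrow> real poly" where
  "reg_hom prd = (THE \<phi>. alg_hom_H1 prd \<phi> \<and> (\<forall>p\<in>H0. \<phi> p = [:Z_eval p:]) \<and> \<phi> nc_y = [:0, 1:])"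

definition zeta_harmonic :: "nat list \<Rightarrow> real" where
  "zeta_harmonic ls = poly (reg_hom harmonic (nc_zs ls)) 0"

definition zeta_shuffle :: "nat list \<Rightarrow> real" where
  "zeta_shuffle ls = poly (reg_hom shuffle (nc_zs ls)) 0"

lemma nc_word_mult: "nc_word u * nc_word v = nc_word (u @ v)"
  by (simp add: mult_single plus_list_def)

lemma one_eq_nc_word: "(1 :: ncpoly) = nc_word []"
  by (metis single_one zero_list_def)

lemma nc_x_power: "nc_x ^ n = nc_word (replicate n LX)"
  by (induction n) (simp_all add: nc_x_def one_eq_nc_word nc_word_mult)

lemma nc_z_eq_word: "nc_z k = nc_word (replicate (k - 1) LX @ [LY])"
  by (simp add: nc_z_def nc_x_power nc_y_def nc_word_mult)

lemma nc_zs_eq_word: "nc_zs ks = nc_word (concat (map (\<lambda>k. replicate (k - 1) LX @ [LY]) ks))"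
  by (induction ks) (simp_all add: nc_zs_def one_eq_nc_word nc_z_eq_word nc_word_mult)

lemma nc_zs_Cons: "nc_zs (k # ks) = nc_z k * nc_zs ks"
  by (simp add: nc_zs_def)

lemma z_index_aux_replicate: "z_index_aux m (replicate n LX @ w) = z_index_aux (m + n) w"
  by (induction n arbitrary: m) simp_all

lemma z_index_concat:
  assumes "\<forall>k\<in>set ks. 1 \<le> k"
  shows "z_index (concat (map (\<lambda>k. replicate (k - 1) LX @ [LY]) ks)) = ks"
  using assms by (induction ks) (simp_all add: z_index_def z_index_aux_replicate)

lemma concat_z_index_aux:
  assumes "w \<noteq> []" "last w = LY"
  shows "concat (map (\<lambda>k. replicate (k - 1) LX @ [LY]) (z_index_aux n w)) = replicate n LX @ w"
  using assms
proof (induction n w rule: z_index_aux.induct)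
  case (2 n w)
  then show ?case by (cases w) (auto simp: replicate_append_same)
next
  case (3 n w)
  then show ?case by (cases "w = []") auto
qed simp

lemma nc_zs_index:
  assumes "w = [] \<or> last w = LY"
  shows "nc_zs (z_index w) = nc_word w"
  using assms concat_z_index_aux[of w 0] by (cases "w = []") (auto simp: nc_zs_eq_word z_index_def)

lemma z_index_pos: "\<forall>k\<in>set (z_index w). 1 \<le> k"
proof -
  have "\<forall>k\<in>set (z_index_aux n w). 1 \<le> k" for n
    by (induction n w rule: z_index_aux.induct) auto
  then show ?thesis by (simp add: z_index_def)
qed

lemma harmonic_zs:
  assumes "\<forall>k\<in>set u. 1 \<le> k" "\<forall>k\<in>set v. 1 \<le> k"
  shows "harmonic (nc_zs u) (nc_zs v) = harmonic_index u v"
  using assms by (simp add: harmonic_def bilinear_ext_def nc_zs_eq_word z_index_concat[simplified])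

lemma harmonic_one:
  assumes "\<forall>k\<in>set v. 1 \<le> k"
  shows "harmonic 1 (nc_zs v) = nc_zs v" "harmonic (nc_zs v) 1 = nc_zs v"
proof -
  have "harmonic_index v [] = nc_zs v" by (cases v) simp_all
  then show "harmonic 1 (nc_zs v) = nc_zs v" "harmonic (nc_zs v) 1 = nc_zs v"
    using harmonic_zs[of "[]" v] harmonic_zs[of v "[]"] assms by (simp_all add: nc_zs_def)
qed

lemma harmonic_z:
  assumes "1 \<le> k" "1 \<le> l" "\<forall>j\<in>set u. 1 \<le> j" "\<forall>j\<in>set v. 1 \<le> j"
  shows "harmonic (nc_z k * nc_zs u) (nc_z l * nc_zs v) =
    nc_z k * harmonic (nc_zs u) (nc_z l * nc_zs v) + nc_z l * harmonic (nc_z k * nc_zs u) (nc_zs v)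
      + nc_z (k + l) * harmonic (nc_zs u) (nc_zs v)"
  using assms by (simp add: harmonic_zs flip: nc_zs_Cons)

lemma shuffle_words: "shuffle (nc_word u) (nc_word v) = shuffle_word u v"
  by (simp add: shuffle_def bilinear_ext_def)

lemma Z_eval_nc_zs:
  assumes "\<forall>k\<in>set ks. 1 \<le> k"
  shows "Z_eval (nc_zs ks) = mzv ks"
  using assms by (simp add: Z_eval_def nc_zs_eq_word z_index_concat[simplified])

end

theory Submission
  imports Defs
begin

text \<open>
Fix the weight \<open>l\<close> and the depth \<open>n\<close> and work modulo the subspace \<open>M = mzv_space l (n - 1) + mzv_prod_space l\<close>.
An element lies in \<open>M\<close> as soon as every additive functional \<open>\<phi>\<close> that kills \<open>M\<close> kills it, so the congruences
become equations between values of \<open>w \<mapsto> \<phi> (\<zeta>\<^sup>s\<^sup>h w)\<close>, a function \<open>f\<close> on the words ending in \<open>LY\<close>. Two properties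
of \<open>f\<close> are enough. Its sum over the shuffles of two nonempty words is zero, because a product of two
regularized values is a combination of products of multiple zeta values. And its sum over all ways of inserting an entry \<open>k\<close> into an index
is zero: the harmonic product of \<open>[k]\<close> with an index of depth \<open>n - 1\<close> consists of these insertions and of indices
of depth \<open>n - 1\<close>, whose regularized values lie in \<open>mzv_space l (n - 1)\<close>. This restriction to products with a
single entry is what keeps the error in depth exactly \<open>n - 1\<close>.

These properties force a cyclic symmetry. First \<open>f\<close> extends uniquely to all words so that shuffles are still
killed and \<open>LX\<close> goes to zero (\<open>x_regularize_shuffle_list\<close>). The insertion relation extends to words \<open>W\<close> with
trailing letters \<open>LX\<close>: the sum over insertions of a block \<open>x\<^sup>c y\<close> in front of \<open>W\<close> or directly after some \<open>y\<close>
in \<open>W\<close> is zero (\<open>insert_block_zero\<close>). A function that kills shuffles changes only by a sign under reversal of words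
(\<open>antipode\<close>), and reversal turns this relation into the one with insertions of \<open>y x\<^sup>c\<close> behind \<open>W\<close> or directly
before some \<open>y\<close>. The two sums share all terms but one, hence \<open>f (x\<^sup>c y W) = f (W y x\<^sup>c)\<close> (\<open>rotate_block\<close>):
if a word is written as \<open>x\<^sup>b\<^sup>0 y x\<^sup>b\<^sup>1 y \<dots> y x\<^sup>b\<^sup>n\<close>, the value depends only on the cyclic order of the blocks. The index
\<open>(k, 1, l)\<close> has the blocks \<open>(k - 1, 0, l - 1, 0)\<close>, with 1 subtracted from every entry. They rotate to those of
\<open>(l, 1, k)\<close>, and after reversal, which costs the sign, to those of \<open>(rev k, 1, rev l)\<close>.

To evaluate the regularizations, both are realized by asymptotic expansions. Truncated sums multiply by the
harmonic product and are polynomials in the harmonic number up to a small error; multiple polylogarithms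
multiply by the shuffle product and are polynomials in \<open>Li [LY] t = - ln (1 - t)\<close> up to a small error as \<open>t\<close> tends
to 1. The polynomials are unique, hence multiplicative, and they are the two homomorphisms
(\<open>zeta_harmonic_eq\<close>, \<open>zeta_shuffle_eq\<close>). Since \<open>Li\<close> is \<open>1 - t\<close> times the generating function of the truncated
sums, the shuffle polynomial arises from the harmonic one by a fixed substitution for the powers of \<open>T\<close>
(\<open>shuffle_poly_eq_harmonic_poly\<close>). By Newton's identity its constants are products modulo \<open>\<zeta>(l)\<close>, so the two kinds
of regularized values agree modulo products (\<open>harmonic_shuffle_congruent\<close>). This gives the insertion relation
for \<open>\<zeta>\<^sup>s\<^sup>h\<close> and carries the congruences over to \<open>\<zeta>\<^sup>*\<close>.
\<close>

section \<open>Shuffles of words\<close>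

text \<open>The words are listed with multiplicity, so that the sum of a function over this list is its linear extension
evaluated at the shuffle product.\<close>

fun shuffle_list :: "'a list \<Rightarrow> 'a list \<Rightarrow> 'a list list" where
  "shuffle_list [] v = [v]"
| "shuffle_list u [] = [u]"
| "shuffle_list (a # u) (b # v) = map ((#) a) (shuffle_list u (b # v)) @ map ((#) b) (shuffle_list (a # u) v)"

lemma shuffle_list_Nil_right [simp]: "shuffle_list u [] = [u]"
  by (cases u) simp_all

lemma shuffle_list_comm:
  fixes f :: "'a list \<Rightarrow> 'b::comm_monoid_add"
  shows "(\<Sum>w\<leftarrow>shuffle_list u v. f w) = (\<Sum>w\<leftarrow>shuffle_list v u. f w)"
  by (induction u v arbitrary: f rule: shuffle_list.induct) (simp_all add: o_def add.commute)

text \<open>Both sides sum over the shuffles of three words: the three possible first letters give the three induction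
hypotheses.\<close>

lemma shuffle_list_assoc:
  fixes f :: "'a list \<Rightarrow> 'b::comm_monoid_add"
  shows "(\<Sum>w\<leftarrow>shuffle_list u v. \<Sum>z\<leftarrow>shuffle_list w t. f z) = (\<Sum>w\<leftarrow>shuffle_list v t. \<Sum>z\<leftarrow>shuffle_list u w. f z)"
proof (induction "length u + length v + length t" arbitrary: u v t f rule: less_induct)
  case less
  show ?case
  proof (cases "u = [] \<or> v = [] \<or> t = []")
    case True
    then show ?thesis by auto
  next
    case False
    then obtain a u' b v' c t' where eq: "u = a # u'" "v = b # v'" "t = c # t'"
      by (meson neq_Nil_conv)
    have 1: "(\<Sum>w\<leftarrow>shuffle_list u' v. \<Sum>z\<leftarrow>shuffle_list w t. f (a # z)) = (\<Sum>w\<leftarrow>shuffle_list v t. \<Sum>z\<leftarrow>shuffle_list u' w. f (a # z))"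
      by (rule less) (simp add: eq)
    have 2: "(\<Sum>w\<leftarrow>shuffle_list u v'. \<Sum>z\<leftarrow>shuffle_list w t. f (b # z)) = (\<Sum>w\<leftarrow>shuffle_list v' t. \<Sum>z\<leftarrow>shuffle_list u w. f (b # z))"
      by (rule less) (simp add: eq)
    have 3: "(\<Sum>w\<leftarrow>shuffle_list u v. \<Sum>z\<leftarrow>shuffle_list w t'. f (c # z)) = (\<Sum>w\<leftarrow>shuffle_list v t'. \<Sum>z\<leftarrow>shuffle_list u w. f (c # z))"
      by (rule less) (simp add: eq)
    show ?thesis using 1 2 3
      by (simp add: eq o_def sum_list_addf add_ac)
  qed
qed

lemma shuffle_list_single_append:
  fixes f :: "'a list \<Rightarrow> 'b::comm_monoid_add"
  shows "(\<Sum>w\<leftarrow>shuffle_list [a] (u @ b # v). f w)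
     = (\<Sum>q\<leftarrow>shuffle_list [a] u. f (q @ b # v)) + (\<Sum>q\<leftarrow>shuffle_list [a] v. f (u @ b # q))"
  by (induction u arbitrary: f) (simp_all add: o_def add_ac)

lemma shuffle_list_single_replicate:
  fixes f :: "'a list \<Rightarrow> real"
  shows "(\<Sum>w\<leftarrow>shuffle_list [a] (replicate m a). f w) = (real m + 1) * f (replicate (Suc m) a)"
  by (induction m arbitrary: f) (simp_all add: o_def algebra_simps)

lemma in_shuffle_list_length: "w \<in> set (shuffle_list u v) \<Longrightarrow> length w = length u + length v"
  by (induction u v arbitrary: w rule: shuffle_list.induct) auto

lemma in_shuffle_list_mset: "w \<in> set (shuffle_list u v) \<Longrightarrow> mset w = mset u + mset v"
  by (induction u v arbitrary: w rule: shuffle_list.induct) auto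

lemma in_shuffle_list_last:
  "w \<in> set (shuffle_list u v) \<Longrightarrow> u = [] \<or> last u = a \<Longrightarrow> v = [] \<or> last v = a \<Longrightarrow> w = [] \<or> last w = a"
proof (induction u v arbitrary: w rule: shuffle_list.induct)
  case (3 b u c v)
  then show ?case using in_shuffle_list_length[of _ "b # u" v] in_shuffle_list_length[of _ u "c # v"]
    by (fastforce split: if_splits)
qed auto

section \<open>Extending functions that kill shuffles to words with trailing letters x\<close>

lemma word_cases:
  obtains (X) m where "w = replicate m LX" | (Y) p m where "w = p @ LY # replicate m LX"
proof (cases "LY \<in> set w")
  case True
  then obtain p q where "w = p @ LY # q" "LY \<notin> set q" by (meson split_list_last)
  moreover have "q = replicate (length q) LX"
    using \<open>LY \<notin> set q\<close> by (metis (full_types) letter.exhaust replicate_length_same)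
  ultimately show ?thesis using that by blast
next
  case False
  then have "w = replicate (length w) LX" by (metis (full_types) letter.exhaust replicate_length_same)
  then show ?thesis using that by blast
qed

definition trailing_x :: "letter list \<Rightarrow> nat" where
  "trailing_x w = length (takeWhile (\<lambda>a. a = LX) (rev w))"

lemma trailing_x_simps [simp]:
  "trailing_x (replicate m LX) = m" "trailing_x (p @ LY # replicate m LX) = m"
  by (simp_all add: trailing_x_def takeWhile_append)

text \<open>The value on \<open>p y x\<^sup>m\<close> is the one that the relations \<open>x sh w = 0\<close> force: modulo shuffles with \<open>x\<close>, a trailing
letter \<open>x\<close> can be moved in front of the last \<open>y\<close> at the price of a sign.\<close>

definition x_regularize :: "(letter list \<Rightarrow> real) \<Rightarrow> letter list \<Rightarrow> real" where
  "x_regularize f w = (if LY \<in> set w then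
      (-1) ^ trailing_x w * (\<Sum>v\<leftarrow>shuffle_list (take (length w - trailing_x w - 1) w) (replicate (trailing_x w) LX). f (v @ [LY]))
    else 0)"

lemma x_regularize_X [simp]: "x_regularize f (replicate m LX) = 0"
  by (simp add: x_regularize_def)

lemma x_regularize_Y: "x_regularize f (p @ LY # replicate m LX) = (-1) ^ m * (\<Sum>v\<leftarrow>shuffle_list p (replicate m LX). f (v @ [LY]))"
  by (simp add: x_regularize_def)

lemma x_regularize_H1: "x_regularize f (p @ [LY]) = f (p @ [LY])"
  using x_regularize_Y[of f p 0] by simp

text \<open>The letter \<open>x\<close> is shuffled either into \<open>p\<close> or into the trailing block. Associativity and \<open>x sh x\<^sup>m = (m + 1) x\<^sup>m\<^sup>+\<^sup>1\<close>
show that the two contributions are opposite.\<close>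

lemma x_regularize_shuffle_list_x: "(\<Sum>w\<leftarrow>shuffle_list [LX] v. x_regularize f w) = 0"
proof (cases v rule: word_cases)
  case (X m)
  then show ?thesis by (simp add: shuffle_list_single_replicate del: replicate_Suc)
next
  case (Y p m)
  have "(\<Sum>q\<leftarrow>shuffle_list [LX] p. \<Sum>v\<leftarrow>shuffle_list q (replicate m LX). f (v @ [LY]))
      = (\<Sum>q\<leftarrow>shuffle_list p [LX]. \<Sum>v\<leftarrow>shuffle_list q (replicate m LX). f (v @ [LY]))"
    by (rule shuffle_list_comm)
  also have "\<dots> = (\<Sum>q\<leftarrow>shuffle_list [LX] (replicate m LX). \<Sum>v\<leftarrow>shuffle_list p q. f (v @ [LY]))"
    by (rule shuffle_list_assoc)
  also have "\<dots> = (real m + 1) * (\<Sum>v\<leftarrow>shuffle_list p (replicate (Suc m) LX). f (v @ [LY]))"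
    by (rule shuffle_list_single_replicate)
  finally have 1: "(\<Sum>q\<leftarrow>shuffle_list [LX] p. \<Sum>v\<leftarrow>shuffle_list q (replicate m LX). f (v @ [LY])) = \<dots>" .
  have "(\<Sum>w\<leftarrow>shuffle_list [LX] v. x_regularize f w) = (\<Sum>q\<leftarrow>shuffle_list [LX] p. x_regularize f (q @ LY # replicate m LX))
     + (real m + 1) * x_regularize f (p @ LY # replicate (Suc m) LX)"
    unfolding Y shuffle_list_single_append shuffle_list_single_replicate by simp
  also have "\<dots> = (-1) ^ m * (\<Sum>q\<leftarrow>shuffle_list [LX] p. \<Sum>v\<leftarrow>shuffle_list q (replicate m LX). f (v @ [LY]))
     + (real m + 1) * ((-1) ^ Suc m * (\<Sum>v\<leftarrow>shuffle_list p (replicate (Suc m) LX). f (v @ [LY])))"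
    unfolding x_regularize_Y by (simp add: sum_list_const_mult)
  also have "\<dots> = 0" unfolding 1 by simp
  finally show ?thesis .
qed

text \<open>Modulo shuffles with \<open>x\<close>, a word with \<open>m + 1\<close> trailing letters \<open>x\<close> is a combination of words of the same length with
\<open>m\<close> of them, since shuffling \<open>x\<close> into \<open>p y x\<^sup>m\<close> produces \<open>m + 1\<close> copies of \<open>p y x\<^sup>m\<^sup>+\<^sup>1\<close>.\<close>

lemma shuffle_list_reduce:
  fixes G :: "letter list \<Rightarrow> real"
  assumes x: "\<And>v. (\<Sum>w\<leftarrow>shuffle_list [LX] v. G w) = 0"
    and t: "trailing_x u = Suc m"
    and IH: "\<And>u'. trailing_x u' = m \<Longrightarrow> u' \<noteq> [] \<Longrightarrow> length u' = length u \<Longrightarrow> G u' = 0"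
  shows "G u = 0"
proof (cases u rule: word_cases)
  case (X k)
  then show ?thesis using t x[of "replicate m LX"] by (simp add: shuffle_list_single_replicate)
next
  case (Y p k)
  then have k: "k = Suc m" using t by simp
  have "0 = (\<Sum>w\<leftarrow>shuffle_list [LX] (p @ LY # replicate m LX). G w)" by (simp add: x)
  also have "\<dots> = (\<Sum>q\<leftarrow>shuffle_list [LX] p. G (q @ LY # replicate m LX)) + (real m + 1) * G u"
    unfolding shuffle_list_single_append shuffle_list_single_replicate by (simp add: Y k)
  also have "(\<Sum>q\<leftarrow>shuffle_list [LX] p. G (q @ LY # replicate m LX)) = (\<Sum>q\<leftarrow>shuffle_list [LX] p. 0)"
    by (intro arg_cong[where f = sum_list] map_cong refl IH) (auto simp: Y k dest: in_shuffle_list_length)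
  finally show ?thesis by simp
qed

text \<open>Trailing letters \<open>x\<close> are removed from both factors in turn. For fixed second factor, the linear functional
\<open>u \<mapsto> \<Sum>w\<leftarrow>shuffle_list u v. x_regularize f w\<close> kills all shuffles with \<open>x\<close> by associativity, which is what
\<open>shuffle_list_reduce\<close> asks for.\<close>

lemma x_regularize_shuffle_list:
  assumes f: "\<And>u v. (\<Sum>w\<leftarrow>shuffle_list (u @ [LY]) (v @ [LY]). f w) = 0"
    and "u \<noteq> []" "v \<noteq> []"
  shows "(\<Sum>w\<leftarrow>shuffle_list u v. x_regularize f w) = 0"
proof -
  have x: "(\<Sum>w\<leftarrow>shuffle_list [LX] u. \<Sum>z\<leftarrow>shuffle_list w v. x_regularize f z) = 0" for u v
    unfolding shuffle_list_assoc by (simp add: x_regularize_shuffle_list_x)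
  have t0: "\<exists>p. u = p @ [LY]" if "trailing_x u = 0" "u \<noteq> []" for u
    using that by (cases u rule: word_cases) auto
  have 1: "(\<Sum>w\<leftarrow>shuffle_list (p @ [LY]) v. x_regularize f w) = 0" if "v \<noteq> []" for p v
    using that
  proof (induction "trailing_x v" arbitrary: v)
    case 0
    then obtain q where q: "v = q @ [LY]" using t0[of v] by auto
    have "(\<Sum>w\<leftarrow>shuffle_list (p @ [LY]) v. x_regularize f w) = (\<Sum>w\<leftarrow>shuffle_list (p @ [LY]) v. f w)"
    proof (intro arg_cong[where f = sum_list] map_cong refl)
      fix w assume "w \<in> set (shuffle_list (p @ [LY]) v)"
      then have "w \<noteq> []" "last w = LY"
        using in_shuffle_list_last[of w "p @ [LY]" v LY] in_shuffle_list_length[of w "p @ [LY]" v] by (auto simp: q)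
      then show "x_regularize f w = f w" by (metis append_butlast_last_id x_regularize_H1)
    qed
    then show ?case using f q by simp
  next
    case (Suc m)
    have c: "(\<Sum>w\<leftarrow>shuffle_list (p @ [LY]) v. x_regularize f w) = (\<Sum>w\<leftarrow>shuffle_list v (p @ [LY]). x_regularize f w)" for v
      by (rule shuffle_list_comm)
    show ?case
    proof (rule shuffle_list_reduce[where G = "\<lambda>v. \<Sum>w\<leftarrow>shuffle_list (p @ [LY]) v. x_regularize f w" and m = m])
      show "(\<Sum>w\<leftarrow>shuffle_list [LX] v. \<Sum>z\<leftarrow>shuffle_list (p @ [LY]) w. x_regularize f z) = 0" for v
        using x[where u = v and v = "p @ [LY]"] by (simp only: c)
    qed (use Suc in auto)
  qed
  show ?thesis using assms(2,3)
  proof (induction "trailing_x u" arbitrary: u)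
    case 0
    then obtain p where "u = p @ [LY]" using t0[of u] by auto
    then show ?case using 1 0 by simp
  next
    case (Suc m)
    show ?case
    proof (rule shuffle_list_reduce[where G = "\<lambda>u. \<Sum>w\<leftarrow>shuffle_list u v. x_regularize f w" and m = m])
      show "(\<Sum>w\<leftarrow>shuffle_list [LX] u. \<Sum>z\<leftarrow>shuffle_list w v. x_regularize f z) = 0" for u using x .
    qed (use Suc in auto)
  qed
qed

section \<open>Reversal and cyclic symmetry\<close>

text \<open>Ree's identity modulo shuffles. Shuffling \<open>a # A\<close> with \<open>c # B\<close> gives the words starting with \<open>a\<close> and those starting with \<open>c\<close>;
as they sum to zero, letters can be moved one at a time from the left of \<open>c\<close> to its right, each with a sign.\<close>

lemma antipode_split:
  fixes F :: "'a list \<Rightarrow> real"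
  assumes S: "\<And>u v. u \<noteq> [] \<Longrightarrow> v \<noteq> [] \<Longrightarrow> (\<Sum>w\<leftarrow>shuffle_list u v. F w) = 0"
  shows "F (rev A @ c # B) = (-1) ^ length A * (\<Sum>w\<leftarrow>shuffle_list A B. F (c # w))"
proof (induction A arbitrary: c B)
  case Nil
  show ?case by simp
next
  case (Cons a A)
  have "(\<Sum>w\<leftarrow>shuffle_list A (c # B). F (a # w)) + (\<Sum>w\<leftarrow>shuffle_list (a # A) B. F (c # w)) = 0"
    using S[of "a # A" "c # B"] by (simp add: o_def)
  then show ?case using Cons[of a "c # B"] by (simp add: eq_neg_iff_add_eq_0 flip: distrib_left)
qed

lemma antipode:
  fixes F :: "'a list \<Rightarrow> real"
  assumes S: "\<And>u v. u \<noteq> [] \<Longrightarrow> v \<noteq> [] \<Longrightarrow> (\<Sum>w\<leftarrow>shuffle_list u v. F w) = 0"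
    and "w \<noteq> []"
  shows "F w = (-1) ^ (length w - 1) * F (rev w)"
proof -
  from assms(2) obtain u a where w: "w = u @ [a]" by (metis rev_exhaust)
  show ?thesis using antipode_split[OF S, of "rev u" a "[]"] by (simp add: w)
qed

text \<open>The words that arise from a word by inserting \<open>x\<^sup>c y\<close> directly behind one of its letters \<open>y\<close>.\<close>

fun insert_block_later :: "nat \<Rightarrow> letter list \<Rightarrow> letter list list" where
  "insert_block_later c [] = []"
| "insert_block_later c (LX # W) = map ((#) LX) (insert_block_later c W)"
| "insert_block_later c (LY # W) = map ((#) LY) ((replicate c LX @ LY # W) # insert_block_later c W)"

lemma insert_block_later_snoc:
  "insert_block_later c (W @ [a]) = map (\<lambda>w. w @ [a]) (insert_block_later c W) @ (if a = LY then [W @ LY # replicate c LX @ [LY]] else [])"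
  by (induction c W rule: insert_block_later.induct) (cases a; simp)+

text \<open>Inserting \<open>x\<^sup>c y\<close> behind a letter \<open>y\<close> is the same as inserting \<open>y x\<^sup>c\<close> before it.\<close>

lemma insert_block_later_rev:
  fixes F :: "letter list \<Rightarrow> real"
  shows "(\<Sum>w\<leftarrow>insert_block_later c (rev W). F w) = (\<Sum>w\<leftarrow>insert_block_later c W. F (rev w))"
  by (induction c W arbitrary: F rule: insert_block_later.induct) (simp_all add: insert_block_later_snoc o_def)

text \<open>Shuffling \<open>x\<close> into a word that contains an inserted block either hits the old letters or the new block, and in
the latter case lengthens the block in \<open>c + 1\<close> ways.\<close>

lemma insert_block_later_shuffle_list_x:
  fixes F :: "letter list \<Rightarrow> real"
  shows "(\<Sum>w\<leftarrow>shuffle_list [LX] W. \<Sum>z\<leftarrow>insert_block_later c w. F z) + (real c + 1) * (\<Sum>z\<leftarrow>insert_block_later (Suc c) W. F z)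
    = (\<Sum>z\<leftarrow>insert_block_later c W. \<Sum>w\<leftarrow>shuffle_list [LX] z. F w)"
proof (induction c W arbitrary: F rule: insert_block_later.induct)
  case (2 c W)
  then show ?case using "2"[of "\<lambda>w. F (LX # w)"] by (simp add: o_def sum_list_addf)
next
  case (3 c W)
  then show ?case using "3"[of "\<lambda>w. F (LY # w)"]
    by (simp add: o_def sum_list_addf shuffle_list_single_append shuffle_list_single_replicate algebra_simps)
qed simp

text \<open>The words that arise by inserting a new block \<open>x\<^sup>c y\<close> before any block of \<open>x\<^sup>b\<^sup>0 y \<dots> y x\<^sup>b\<^sup>n\<close>. For words ending in \<open>y\<close> this
inserts the entry \<open>c + 1\<close> into the index of the word.\<close>

definition insert_block :: "nat \<Rightarrow> letter list \<Rightarrow> letter list list" where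
  "insert_block c W = (replicate c LX @ LY # W) # insert_block_later c W"

lemma insert_block_shuffle_list_x:
  fixes F :: "letter list \<Rightarrow> real"
  shows "(\<Sum>w\<leftarrow>shuffle_list [LX] W. \<Sum>z\<leftarrow>insert_block c w. F z) + (real c + 1) * (\<Sum>z\<leftarrow>insert_block (Suc c) W. F z)
    = (\<Sum>z\<leftarrow>insert_block c W. \<Sum>w\<leftarrow>shuffle_list [LX] z. F w)"
  using insert_block_later_shuffle_list_x[where c=c and W=W and F=F]
  by (simp add: insert_block_def sum_list_addf shuffle_list_single_append shuffle_list_single_replicate algebra_simps)

text \<open>The relation is lifted from words ending in \<open>y\<close> to all words by induction on the number of trailing letters \<open>x\<close>,
simultaneously for all block lengths: by \<open>insert_block_shuffle_list_x\<close>, the insertions into \<open>x sh W\<close> are a multiple of those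
of a longer block into \<open>W\<close>.\<close>

lemma insert_block_zero:
  fixes F :: "letter list \<Rightarrow> real"
  assumes x: "\<And>u. u \<noteq> [] \<Longrightarrow> (\<Sum>w\<leftarrow>shuffle_list [LX] u. F w) = 0"
    and H: "\<And>c W. W = [] \<or> last W = LY \<Longrightarrow> (\<Sum>w\<leftarrow>insert_block c W. F w) = 0"
  shows "(\<Sum>w\<leftarrow>insert_block c W. F w) = 0"
proof (induction "trailing_x W" arbitrary: c W)
  case 0
  then have "W = [] \<or> last W = LY" by (cases W rule: word_cases) auto
  then show ?case by (rule H)
next
  case (Suc m)
  have nonempty: "z \<noteq> []" if "z \<in> set (insert_block c W)" for z c W
  proof -
    have "z \<in> set (insert_block_later c W) \<Longrightarrow> z \<noteq> []" by (induction c W rule: insert_block_later.induct) auto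
    then show ?thesis using that by (auto simp: insert_block_def)
  qed
  have tx: "(\<Sum>w\<leftarrow>shuffle_list [LX] W. \<Sum>z\<leftarrow>insert_block c w. F z) = - (real c + 1) * (\<Sum>z\<leftarrow>insert_block (Suc c) W. F z)" for c W
  proof -
    have "(\<Sum>z\<leftarrow>insert_block c W. \<Sum>w\<leftarrow>shuffle_list [LX] z. F w) = (\<Sum>z\<leftarrow>insert_block c W. 0)"
      by (intro arg_cong[where f = sum_list] map_cong refl x nonempty)
    then show ?thesis using insert_block_shuffle_list_x[of F c W] by (simp add: algebra_simps)
  qed
  show ?case
  proof (cases W rule: word_cases)
    case (X k)
    then have k: "k = Suc m" using Suc by simp
    have "(\<Sum>z\<leftarrow>insert_block (Suc c) (replicate m LX). F z) = 0" by (rule Suc) simp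
    then show ?thesis using tx[of c "replicate m LX"] by (simp add: shuffle_list_single_replicate X k)
  next
    case (Y p k)
    then have k: "k = Suc m" using Suc by simp
    have 1: "(\<Sum>z\<leftarrow>insert_block (Suc c) (p @ LY # replicate m LX). F z) = 0" by (rule Suc) simp
    have 2: "(\<Sum>z\<leftarrow>insert_block c (q @ LY # replicate m LX). F z) = 0" for q by (rule Suc) simp
    show ?thesis using tx[of c "p @ LY # replicate m LX"] 1 2
      by (simp add: shuffle_list_single_append shuffle_list_single_replicate Y k)
  qed
qed

text \<open>Applying the insertion relation to \<open>rev W\<close> and reversing all words gives a second relation for \<open>W\<close>. Both contain
the sum over \<open>insert_block_later c W\<close>, and their difference leaves one term on each side.\<close>

lemma rotate_block:
  fixes F :: "letter list \<Rightarrow> real"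
  assumes S: "\<And>u v. u \<noteq> [] \<Longrightarrow> v \<noteq> [] \<Longrightarrow> (\<Sum>w\<leftarrow>shuffle_list u v. F w) = 0"
    and H: "\<And>c W. W = [] \<or> last W = LY \<Longrightarrow> (\<Sum>w\<leftarrow>insert_block c W. F w) = 0"
  shows "F (replicate c LX @ LY # W) = F (W @ LY # replicate c LX)"
proof -
  have len: "length w = length W + c + 1" if "w \<in> set (insert_block_later c W)" for w c W
    using that by (induction c W arbitrary: w rule: insert_block_later.induct) auto
  have 0: "F (replicate c LX @ LY # W) + (\<Sum>w\<leftarrow>insert_block_later c W. F w) = 0" for W
    using insert_block_zero[of F, OF S H] by (simp add: insert_block_def)
  \<comment> \<open>All words that occur have length \<open>length W + c + 1\<close>, so reversal contributes the same sign to each of them.\<close>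
  let ?s = "(-1) ^ (length W + c) :: real"
  have "0 = ?s * (F (replicate c LX @ LY # rev W) + (\<Sum>w\<leftarrow>insert_block_later c (rev W). F w))"
    by (simp add: 0)
  also have "\<dots> = ?s * F (replicate c LX @ LY # rev W) + (\<Sum>w\<leftarrow>insert_block_later c W. ?s * F (rev w))"
    by (simp add: insert_block_later_rev distrib_left sum_list_const_mult)
  also have "?s * F (replicate c LX @ LY # rev W) = F (W @ LY # replicate c LX)"
    using antipode[OF S, of "W @ LY # replicate c LX"] by simp
  also have "(\<Sum>w\<leftarrow>insert_block_later c W. ?s * F (rev w)) = (\<Sum>w\<leftarrow>insert_block_later c W. F w)"
  proof (intro arg_cong[where f = sum_list] map_cong refl)
    fix w assume "w \<in> set (insert_block_later c W)"
    then have "length w = length W + c + 1" by (rule len)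
    then show "?s * F (rev w) = F w" using antipode[OF S, of w] by (cases w) auto
  qed
  finally show ?thesis using 0[of W] by simp
qed

text \<open>The word \<open>x\<^sup>b\<^sup>0 y x\<^sup>b\<^sup>1 y \<dots> y x\<^sup>b\<^sup>n\<close>, in which rotation and reversal of words are rotation and reversal of the list of blocks.\<close>

fun block_word :: "nat list \<Rightarrow> letter list" where
  "block_word [] = []"
| "block_word [b] = replicate b LX"
| "block_word (b # bs) = replicate b LX @ LY # block_word bs"

lemma block_word_Cons: "bs \<noteq> [] \<Longrightarrow> block_word (b # bs) = replicate b LX @ LY # block_word bs"
  by (cases bs) auto

lemma block_word_append: "us \<noteq> [] \<Longrightarrow> vs \<noteq> [] \<Longrightarrow> block_word (us @ vs) = block_word us @ LY # block_word vs"
  by (induction us rule: block_word.induct) (auto simp: block_word_Cons)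

lemma rev_block_word: "rev (block_word bs) = block_word (rev bs)"
proof (induction bs rule: block_word.induct)
  case (3 b v va)
  then show ?case using block_word_append[of "rev va @ [v]" "[b]"] by simp
qed simp_all

definition zword :: "nat list \<Rightarrow> letter list" where
  "zword ks = concat (map (\<lambda>k. replicate (k - 1) LX @ [LY]) ks)"

lemma zword_simps [simp]:
  "zword [] = []" "zword (k # ks) = replicate (k - 1) LX @ LY # zword ks"
  by (simp_all add: zword_def)

lemma zword_eq_block_word: "zword ks = block_word (map (\<lambda>k. k - 1) ks @ [0])"
  by (induction ks) (auto simp: block_word_Cons)

lemma rotate_blocks:
  fixes F :: "letter list \<Rightarrow> real"
  assumes R: "\<And>c W. F (replicate c LX @ LY # W) = F (W @ LY # replicate c LX)"
  shows "F (block_word (us @ vs)) = F (block_word (vs @ us))"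
proof (induction us arbitrary: vs)
  case (Cons c us)
  show ?case
  proof (cases "us @ vs = []")
    case False
    have "F (block_word ((c # us) @ vs)) = F (block_word (us @ vs @ [c]))"
      using R[of c "block_word (us @ vs)"] False block_word_append[OF False, of "[c]"] by (simp add: block_word_Cons)
    also have "\<dots> = F (block_word ((vs @ [c]) @ us))" using Cons[of "vs @ [c]"] by simp
    finally show ?thesis by simp
  qed auto
qed simp

lemma swap_around_one:
  fixes F :: "letter list \<Rightarrow> real"
  assumes R: "\<And>c W. F (replicate c LX @ LY # W) = F (W @ LY # replicate c LX)"
  shows "F (zword (ks @ 1 # ls)) = F (zword (ls @ 1 # ks))"
  using rotate_blocks[of F "map (\<lambda>k. k - 1) ks @ [0]" "map (\<lambda>k. k - 1) ls @ [0]", OF R]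
  by (simp add: zword_eq_block_word)

text \<open>With \<open>k\<close> and \<open>l\<close> standing for the entries lowered by 1, reversal takes the blocks \<open>(k, 0, l, 0)\<close> to \<open>(0, rev l, 0, rev k)\<close>, which rotate to \<open>(rev k, 0, rev l, 0)\<close>.\<close>

lemma reverse_around_one:
  fixes F :: "letter list \<Rightarrow> real"
  assumes S: "\<And>u v. u \<noteq> [] \<Longrightarrow> v \<noteq> [] \<Longrightarrow> (\<Sum>w\<leftarrow>shuffle_list u v. F w) = 0"
    and R: "\<And>c W. F (replicate c LX @ LY # W) = F (W @ LY # replicate c LX)"
  shows "F (zword (ks @ 1 # ls))
    = (-1) ^ (length (zword (ks @ 1 # ls)) - 1) * F (zword (rev ks @ 1 # rev ls))"
proof -
  define k l where "k = map (\<lambda>k. k - 1) ks" and "l = map (\<lambda>k. k - 1) ls"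
  have "F (rev (zword (ks @ 1 # ls))) = F (block_word ((0 # rev l) @ (0 # rev k)))"
    by (simp add: zword_eq_block_word rev_block_word k_def l_def)
  also have "\<dots> = F (block_word ([0] @ (rev k @ 0 # rev l)))" using rotate_blocks[of F, OF R, of "0 # rev l" "0 # rev k"] by simp
  also have "\<dots> = F (block_word ((rev k @ 0 # rev l) @ [0]))" by (rule rotate_blocks[of F, OF R])
  also have "\<dots> = F (zword (rev ks @ 1 # rev ls))" by (simp add: zword_eq_block_word k_def l_def rev_map)
  finally have 1: "F (rev (zword (ks @ 1 # ls))) = F (zword (rev ks @ 1 # rev ls))" .
  have "zword (ks @ 1 # ls) \<noteq> []" by (simp add: zword_def)
  from antipode[of F, OF S this] 1 show ?thesis by simp
qed

section \<open>Truncated multiple harmonic sums\<close>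

fun stuffle :: "nat list \<Rightarrow> nat list \<Rightarrow> nat list list" where
  "stuffle [] v = [v]"
| "stuffle u [] = [u]"
| "stuffle (k # u) (l # v) = map ((#) k) (stuffle u (l # v)) @ map ((#) l) (stuffle (k # u) v)
     @ map ((#) (k + l)) (stuffle u v)"

lemma stuffle_Nil_right [simp]: "stuffle u [] = [u]"
  by (cases u) simp_all

text \<open>The truncation at \<open>M\<close> of the series of the multiple zeta value; the summation index is shifted, so that \<open>Suc m\<close> is the largest
summation variable and the inner sum runs up to \<open>m\<close>.\<close>

fun mhs :: "nat list \<Rightarrow> nat \<Rightarrow> real" where
  "mhs [] M = 1"
| "mhs (k # ks) M = (\<Sum>m<M. mhs ks m / real (Suc m) ^ k)"

declare mhs.simps(2) [simp del]

lemma mhs_0 [simp]: "mhs (k # ks) 0 = 0"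
  by (simp add: mhs.simps)

lemma mhs_Suc: "mhs (k # ks) (Suc M) = mhs (k # ks) M + mhs ks M / real (Suc M) ^ k"
  by (simp add: mhs.simps)

text \<open>Induction on \<open>M\<close>: the three groups of the harmonic product are the three mixed terms in the increment of a product.\<close>

lemma mhs_stuffle: "mhs u M * mhs v M = (\<Sum>w\<leftarrow>stuffle u v. mhs w M)"
proof (induction u v arbitrary: M rule: stuffle.induct)
  case (3 k u l v)
  show ?case
  proof (induction M)
    case 0
    show ?case by (simp add: o_def)
  next
    case (Suc M)
    let ?q = "real (Suc M)"
    have "mhs (k # u) (Suc M) * mhs (l # v) (Suc M) =
        mhs (k # u) M * mhs (l # v) M + mhs u M * mhs (l # v) M / ?q ^ k
        + mhs (k # u) M * mhs v M / ?q ^ l + mhs u M * mhs v M / ?q ^ (k + l)"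
      by (simp add: mhs_Suc field_simps power_add del: of_nat_Suc)
    also have "\<dots> = (\<Sum>w\<leftarrow>stuffle (k # u) (l # v). mhs w M)
        + (\<Sum>w\<leftarrow>stuffle u (l # v). mhs w M) / ?q ^ k
        + (\<Sum>w\<leftarrow>stuffle (k # u) v. mhs w M) / ?q ^ l + (\<Sum>w\<leftarrow>stuffle u v. mhs w M) / ?q ^ (k + l)"
      unfolding Suc 3 ..
    also have "\<dots> = (\<Sum>w\<leftarrow>stuffle (k # u) (l # v). mhs w (Suc M))"
      by (simp add: mhs_Suc o_def sum_list_addf divide_inverse sum_list_mult_const del: of_nat_Suc)
    finally show ?case .
  qed
qed simp_all

lemma mhs_nonneg [simp]: "0 \<le> mhs ks M"
  by (induction ks arbitrary: M) (auto simp: mhs.simps intro!: sum_nonneg)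

lemma mhs_mono: "M \<le> N \<Longrightarrow> mhs ks M \<le> mhs ks N"
  by (cases ks) (auto simp: mhs.simps intro!: sum_mono2)

abbreviation harmonic_number :: "nat \<Rightarrow> real" where "harmonic_number \<equiv> mhs [1]"

lemma mhs_le_harmonic_number_power:
  assumes "\<forall>k\<in>set ks. 1 \<le> k"
  shows "mhs ks M \<le> harmonic_number M ^ length ks"
  using assms
proof (induction ks arbitrary: M)
  case (Cons k ks)
  have "mhs (k # ks) M \<le> (\<Sum>m<M. harmonic_number M ^ length ks * (1 / real (Suc m)))"
    unfolding mhs.simps(2)[of k ks]
  proof (rule sum_mono)
    fix m assume m: "m \<in> {..<M}"
    have "mhs ks m \<le> mhs ks M" using m by (intro mhs_mono) auto
    also have "\<dots> \<le> harmonic_number M ^ length ks" using Cons by simp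
    finally have 1: "mhs ks m \<le> harmonic_number M ^ length ks" .
    have "real (Suc m) ^ 1 \<le> real (Suc m) ^ k" using Cons.prems by (intro power_increasing) auto
    then have "1 / real (Suc m) ^ k \<le> 1 / real (Suc m)" by (intro divide_left_mono) auto
    then have "mhs ks m * (1 / real (Suc m) ^ k) \<le> harmonic_number M ^ length ks * (1 / real (Suc m))"
      using 1 by (intro mult_mono) auto
    then show "mhs ks m / real (Suc m) ^ k \<le> harmonic_number M ^ length ks * (1 / real (Suc m))" by simp
  qed
  also have "\<dots> = harmonic_number M ^ length (k # ks)"
    unfolding sum_distrib_left[symmetric] by (simp add: mhs.simps)
  finally show ?case .
qed simp

text \<open>Write \<open>1 / m\<close> as \<open>m\<^sup>q\<close> times a term of a convergent series and bound the first factor by its largest value.\<close>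

lemma harmonic_number_le_powr:
  assumes q: "0 < q"
  obtains C where "0 \<le> C" "\<And>M. harmonic_number M \<le> C * real (Suc M) powr q"
proof -
  have "summable (\<lambda>n. of_nat n powr (-1 - q) :: real)" using q by (subst summable_real_powr_iff) simp
  then have s: "summable (\<lambda>n. real (Suc n) powr (-1 - q))" by (subst summable_Suc_iff)
  define C where "C = suminf (\<lambda>n. real (Suc n) powr (-1 - q))"
  show ?thesis
  proof
    show "0 \<le> C" unfolding C_def by (intro suminf_nonneg s) simp
    fix M
    have "harmonic_number M = (\<Sum>m<M. real (Suc m) powr (-1 - q) * real (Suc m) powr q)"
      by (simp add: mhs.simps powr_minus_divide flip: powr_add)
    also have "\<dots> \<le> (\<Sum>m<M. real (Suc m) powr (-1 - q) * real (Suc M) powr q)"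
      using q by (intro sum_mono mult_left_mono powr_mono2) auto
    also have "\<dots> = (\<Sum>m<M. real (Suc m) powr (-1 - q)) * real (Suc M) powr q"
      by (simp add: sum_distrib_right)
    also have "\<dots> \<le> C * real (Suc M) powr q"
      unfolding C_def by (intro mult_right_mono sum_le_suminf s) auto
    finally show "harmonic_number M \<le> C * real (Suc M) powr q" .
  qed
qed

lemma summable_harmonic_number_power: "summable (\<lambda>m. harmonic_number m ^ p * real (Suc m) powr (-3 / 2))"
proof -
  \<comment> \<open>The exponent is small enough that the \<open>p\<close>-th power of the bound grows at most like \<open>m\<close> to the power 1/4.\<close>
  define q where "q = 1 / (4 * (real p + 1))"
  have q: "0 < q" "q * real p \<le> 1 / 4" by (simp_all add: q_def field_simps)
  obtain C where C: "0 \<le> C" "\<And>M. harmonic_number M \<le> C * real (Suc M) powr q"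
    using harmonic_number_le_powr[OF q(1)] by blast
  have "summable (\<lambda>n. of_nat n powr (-5 / 4) :: real)" by (subst summable_real_powr_iff) simp
  then have "summable (\<lambda>n. real (Suc n) powr (-5 / 4))" by (subst summable_Suc_iff)
  then have "summable (\<lambda>n. C ^ p * real (Suc n) powr (-5 / 4))" by (rule summable_mult)
  then show ?thesis
  proof (rule summable_comparison_test'[where N = 0])
    fix m :: nat
    have "harmonic_number m ^ p \<le> (C * real (Suc m) powr q) ^ p" by (intro power_mono C) simp
    also have "\<dots> = C ^ p * real (Suc m) powr (q * real p)"
      by (simp add: power_mult_distrib powr_power mult.commute)
    also have "\<dots> \<le> C ^ p * real (Suc m) powr (1 / 4)"
      using q C by (intro mult_left_mono powr_mono) auto
    finally have "harmonic_number m ^ p * real (Suc m) powr (-3 / 2)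
        \<le> C ^ p * real (Suc m) powr (1 / 4) * real (Suc m) powr (-3 / 2)"
      by (intro mult_right_mono) auto
    also have "\<dots> = C ^ p * real (Suc m) powr (-5 / 4)" by (simp add: mult.assoc flip: powr_add)
    finally show "norm (harmonic_number m ^ p * real (Suc m) powr (-3 / 2)) \<le> C ^ p * real (Suc m) powr (-5 / 4)"
      by simp
  qed
qed

lemma inverse_power_le_powr:
  assumes "2 \<le> k" shows "1 / real (Suc m) ^ k \<le> real (Suc m) powr (-3 / 2)"
proof -
  have "1 / real (Suc m) ^ k = real (Suc m) powr (- real k)" by (simp add: powr_minus_divide powr_realpow)
  also have "\<dots> \<le> real (Suc m) powr (-3 / 2)" using assms by (intro powr_mono) auto
  finally show ?thesis .
qed

lemma mhs_admissible_summable: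
  assumes "\<forall>k\<in>set ks. 1 \<le> k" "2 \<le> k"
  shows "summable (\<lambda>m. mhs ks m / real (Suc m) ^ k * harmonic_number m ^ p)"
proof (rule summable_comparison_test'[OF summable_harmonic_number_power[of "length ks + p"], where N = 0])
  fix m :: nat
  have "mhs ks m * (1 / real (Suc m) ^ k) \<le> harmonic_number m ^ length ks * real (Suc m) powr (-3 / 2)"
    using mhs_le_harmonic_number_power[OF assms(1)] inverse_power_le_powr[OF assms(2)]
    by (intro mult_mono) auto
  then have "mhs ks m * (1 / real (Suc m) ^ k) * harmonic_number m ^ p
      \<le> harmonic_number m ^ length ks * real (Suc m) powr (-3 / 2) * harmonic_number m ^ p"
    by (intro mult_right_mono) auto
  then show "norm (mhs ks m / real (Suc m) ^ k * harmonic_number m ^ p)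
      \<le> harmonic_number m ^ (length ks + p) * real (Suc m) powr (-3 / 2)"
    by (simp add: power_add mult_ac abs_mult)
qed

section \<open>Multiple zeta values as limits\<close>

text \<open>The summation range of the series for depth \<open>n\<close>, cut off at \<open>M\<close>; the truncated sums are the sums over these finite sets.\<close>

definition dec_tuples :: "nat \<Rightarrow> nat \<Rightarrow> nat list set" where
  "dec_tuples n M = {ms. length ms = n \<and> sorted_wrt (>) ms \<and> (\<forall>m\<in>set ms. 0 < m \<and> m \<le> M)}"

definition mzv_term :: "nat list \<Rightarrow> nat list \<Rightarrow> real" where
  "mzv_term ks ms = 1 / (\<Prod>i<length ks. real (ms ! i) ^ (ks ! i))"

lemma mzv_term_Cons: "mzv_term (k # ks) (m # ms) = mzv_term ks ms / real m ^ k"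
  by (simp add: mzv_term_def prod.lessThan_Suc_shift del: prod.lessThan_Suc)

lemma mzv_term_nonneg: "0 \<le> mzv_term ks ms"
  by (simp add: mzv_term_def prod_nonneg)

lemma dec_tuples_0: "dec_tuples 0 M = {[]}"
  by (auto simp: dec_tuples_def)

lemma dec_tuples_Suc: "dec_tuples (Suc n) M = (\<lambda>(m, ms). Suc m # ms) ` (SIGMA m:{..<M}. dec_tuples n m)"
proof (intro set_eqI iffI)
  fix ms assume "ms \<in> dec_tuples (Suc n) M"
  then obtain m ms' where "ms = m # ms'" "length ms' = n" "sorted_wrt (>) ms'" "\<forall>m'\<in>set ms'. m' < m \<and> 0 < m'"
      "0 < m" "m \<le> M"
    by (auto simp: dec_tuples_def length_Suc_conv)
  then show "ms \<in> (\<lambda>(m, ms). Suc m # ms) ` (SIGMA m:{..<M}. dec_tuples n m)"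
    by (intro image_eqI[of _ _ "(m - 1, ms')"]) (auto simp: dec_tuples_def)
qed (fastforce simp: dec_tuples_def)

lemma dec_tuples_mono: "M \<le> N \<Longrightarrow> dec_tuples n M \<subseteq> dec_tuples n N"
  by (fastforce simp: dec_tuples_def)

lemma finite_dec_tuples: "finite (dec_tuples n M)"
  by (induction n arbitrary: M) (auto simp: dec_tuples_0 dec_tuples_Suc)

lemma sum_mzv_term: "(\<Sum>ms\<in>dec_tuples (length ks) M. mzv_term ks ms) = mhs ks M"
proof (induction ks arbitrary: M)
  case (Cons k ks)
  have "(\<Sum>ms\<in>dec_tuples (length (k # ks)) M. mzv_term (k # ks) ms)
      = (\<Sum>(m, ms)\<in>(SIGMA m:{..<M}. dec_tuples (length ks) m). mzv_term (k # ks) (Suc m # ms))"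
    unfolding length_Cons dec_tuples_Suc
    by (subst sum.reindex) (auto simp: inj_on_def case_prod_beta)
  also have "\<dots> = (\<Sum>m<M. \<Sum>ms\<in>dec_tuples (length ks) m. mzv_term (k # ks) (Suc m # ms))"
    by (rule sum.Sigma[symmetric]) (auto simp: finite_dec_tuples)
  also have "\<dots> = mhs (k # ks) M"
    by (simp add: mzv_term_Cons Cons mhs.simps flip: sum_divide_distrib del: of_nat_Suc)
  finally show ?case .
qed (simp add: dec_tuples_0 mzv_term_def)

text \<open>The terms are nonnegative and the sets \<open>dec_tuples\<close> exhaust the summation range, so bounded truncations converge to the
unordered sum.\<close>

lemma mhs_tendsto_mzv:
  assumes bound: "\<And>M. mhs ks M \<le> B"
  shows "mhs ks \<longlonglongrightarrow> mzv ks"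
proof -
  define A where "A = {ms :: nat list. length ms = length ks \<and> sorted_wrt (>) ms \<and> (\<forall>m\<in>set ms. 0 < m)}"
  have sub: "dec_tuples (length ks) M \<subseteq> A" for M by (auto simp: dec_tuples_def A_def)
  have fin: "\<exists>M. F \<subseteq> dec_tuples (length ks) M" if "finite F" "F \<subseteq> A" for F
  proof -
    have "finite (\<Union>(set ` F))" using that by auto
    then obtain M where "\<forall>m\<in>\<Union>(set ` F). m \<le> M" using finite_nat_set_iff_bounded_le by blast
    then show ?thesis using that by (intro exI[of _ M]) (auto simp: dec_tuples_def A_def)
  qed
  have le: "sum (mzv_term ks) F \<le> B" if F: "finite F" "F \<subseteq> A" for F
  proof -
    obtain M where "F \<subseteq> dec_tuples (length ks) M" using fin[OF F] by blast
    then have "sum (mzv_term ks) F \<le> mhs ks M"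
      unfolding sum_mzv_term[symmetric] by (intro sum_mono2 finite_dec_tuples mzv_term_nonneg)
    then show ?thesis using bound[of M] by simp
  qed
  have "mzv_term ks summable_on A"
    by (rule nonneg_bdd_above_summable_on) (auto simp: mzv_term_nonneg intro!: bdd_aboveI[of _ B] le)
  then have hs: "(mzv_term ks has_sum mzv ks) A"
    unfolding mzv_def A_def[symmetric] mzv_term_def by (simp add: has_sum_infsum)
  then have "(sum (mzv_term ks) \<longlongrightarrow> mzv ks) (finite_subsets_at_top A)" by (simp add: has_sum_def)
  moreover have "filterlim (dec_tuples (length ks)) (finite_subsets_at_top A) sequentially"
    unfolding filterlim_finite_subsets_at_top
  proof (intro allI impI)
    fix F assume "finite F \<and> F \<subseteq> A"
    then obtain M where "F \<subseteq> dec_tuples (length ks) M" using fin by blast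
    then show "\<forall>\<^sub>F N in sequentially. finite (dec_tuples (length ks) N) \<and> F \<subseteq> dec_tuples (length ks) N \<and>
        dec_tuples (length ks) N \<subseteq> A"
      by (intro eventually_sequentiallyI[of M]) (use sub finite_dec_tuples dec_tuples_mono in blast)
  qed
  ultimately have "(\<lambda>M. sum (mzv_term ks) (dec_tuples (length ks) M)) \<longlonglongrightarrow> mzv ks"
    by (rule filterlim_compose)
  then show ?thesis by (simp add: sum_mzv_term)
qed

lemma mzv_Nil: "mzv [] = 1"
proof -
  have "mhs [] = (\<lambda>_. 1)" by (rule ext) simp
  then have "(\<lambda>_. 1) \<longlonglongrightarrow> mzv []" using mhs_tendsto_mzv[of "[]" 1] by simp
  then show ?thesis by (rule LIMSEQ_unique[OF _ tendsto_const])
qed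

lemma mzv_sums:
  assumes "\<forall>k\<in>set ks. 1 \<le> k" "2 \<le> k"
  shows "(\<lambda>m. mhs ks m / real (Suc m) ^ k) sums mzv (k # ks)"
proof -
  have s: "summable (\<lambda>m. mhs ks m / real (Suc m) ^ k)" using mhs_admissible_summable[OF assms, of 0] by simp
  have "mhs (k # ks) \<longlonglongrightarrow> mzv (k # ks)"
  proof (rule mhs_tendsto_mzv)
    show "mhs (k # ks) M \<le> suminf (\<lambda>m. mhs ks m / real (Suc m) ^ k)" for M
      unfolding mhs.simps by (intro sum_le_suminf s) (auto simp del: of_nat_Suc)
  qed
  then show ?thesis unfolding sums_def mhs.simps(2)[symmetric] .
qed

section \<open>Functions asymptotic to polynomials\<close>

text \<open>Errors that stay small after multiplication with any power of the scale \<open>h\<close>. Convergence to zero alone would not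
survive the product with an unbounded polynomial in \<open>h\<close>.\<close>

definition negligible :: "'x filter \<Rightarrow> ('x \<Rightarrow> real) \<Rightarrow> ('x \<Rightarrow> real) \<Rightarrow> bool" where
  "negligible F h r \<longleftrightarrow> (\<forall>J. ((\<lambda>x. r x * h x ^ J) \<longlongrightarrow> 0) F)"

definition poly_asymp :: "'x filter \<Rightarrow> ('x \<Rightarrow> real) \<Rightarrow> ('x \<Rightarrow> real) \<Rightarrow> real poly \<Rightarrow> bool" where
  "poly_asymp F h f P \<longleftrightarrow> negligible F h (\<lambda>x. f x - poly P (h x))"

lemma negligible_add: "negligible F h r \<Longrightarrow> negligible F h s \<Longrightarrow> negligible F h (\<lambda>x. r x + s x)"
  unfolding negligible_def distrib_right by (auto intro: tendsto_add_zero)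

lemma negligible_cmult: "negligible F h r \<Longrightarrow> negligible F h (\<lambda>x. c * r x)"
  unfolding negligible_def using tendsto_mult_right_zero[of _ F c] by (simp add: mult.assoc)

lemma negligible_zero: "negligible F h (\<lambda>x. 0)"
  by (simp add: negligible_def)

lemma negligible_times_scale: "negligible F h r \<Longrightarrow> negligible F h (\<lambda>x. r x * h x)"
  unfolding negligible_def
proof
  fix J assume "\<forall>J. ((\<lambda>x. r x * h x ^ J) \<longlongrightarrow> 0) F"
  then have "((\<lambda>x. r x * h x ^ Suc J) \<longlongrightarrow> 0) F" by blast
  then show "((\<lambda>x. r x * h x * h x ^ J) \<longlongrightarrow> 0) F" by (simp add: mult.assoc)
qed

lemma negligible_times_poly: "negligible F h r \<Longrightarrow> negligible F h (\<lambda>x. r x * poly P (h x))"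
proof (induction P arbitrary: r)
  case (pCons a P)
  have "negligible F h (\<lambda>x. a * r x + (r x * h x) * poly P (h x))"
    by (intro negligible_add negligible_cmult pCons negligible_times_scale)
  then show ?case by (simp add: algebra_simps)
qed (simp add: negligible_zero)

lemma negligible_mult: "negligible F h r \<Longrightarrow> negligible F h s \<Longrightarrow> negligible F h (\<lambda>x. r x * s x)"
  unfolding negligible_def
proof
  fix J assume "\<forall>J. ((\<lambda>x. r x * h x ^ J) \<longlongrightarrow> 0) F" "\<forall>J. ((\<lambda>x. s x * h x ^ J) \<longlongrightarrow> 0) F"
  then have "((\<lambda>x. (r x * h x ^ 0) * (s x * h x ^ J)) \<longlongrightarrow> 0) F" using tendsto_mult_zero by blast
  then show "((\<lambda>x. r x * s x * h x ^ J) \<longlongrightarrow> 0) F" by (simp add: mult.assoc)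
qed

lemma negligible_tendsto: "negligible F h r \<Longrightarrow> (r \<longlongrightarrow> 0) F"
  unfolding negligible_def by (drule spec[of _ 0]) simp

lemma poly_asymp_add: "poly_asymp F h f P \<Longrightarrow> poly_asymp F h g Q \<Longrightarrow> poly_asymp F h (\<lambda>x. f x + g x) (P + Q)"
  unfolding poly_asymp_def using negligible_add[of F h "\<lambda>x. f x - poly P (h x)" "\<lambda>x. g x - poly Q (h x)"]
  by (simp add: algebra_simps)

lemma poly_asymp_cmult: "poly_asymp F h f P \<Longrightarrow> poly_asymp F h (\<lambda>x. c * f x) (smult c P)"
  unfolding poly_asymp_def using negligible_cmult[of F h "\<lambda>x. f x - poly P (h x)" c]
  by (simp add: algebra_simps)

lemma poly_asymp_diff: "poly_asymp F h f P \<Longrightarrow> poly_asymp F h g Q \<Longrightarrow> poly_asymp F h (\<lambda>x. f x - g x) (P - Q)"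
  using poly_asymp_add[OF _ poly_asymp_cmult[of F h g Q "-1"], of f P] by simp

lemma poly_asymp_const: "poly_asymp F h (\<lambda>x. c) [:c:]"
  by (simp add: poly_asymp_def negligible_zero)

lemma poly_asymp_scale: "poly_asymp F h h [:0, 1:]"
  by (simp add: poly_asymp_def negligible_zero)

text \<open>Expanding the product, each error term is multiplied by an error or by a polynomial in the scale.\<close>

lemma poly_asymp_mult:
  assumes "poly_asymp F h f P" "poly_asymp F h g Q" shows "poly_asymp F h (\<lambda>x. f x * g x) (P * Q)"
proof -
  let ?r = "\<lambda>x. f x - poly P (h x)" and ?s = "\<lambda>x. g x - poly Q (h x)"
  have "negligible F h (\<lambda>x. ?r x * ?s x + (?r x * poly Q (h x) + ?s x * poly P (h x)))"
    using assms unfolding poly_asymp_def by (intro negligible_add negligible_mult negligible_times_poly)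
  then show ?thesis by (simp add: poly_asymp_def algebra_simps)
qed

lemma poly_asymp_sum_list:
  "(\<And>v. v \<in> set T \<Longrightarrow> poly_asymp F h (f v) (P v)) \<Longrightarrow> poly_asymp F h (\<lambda>x. \<Sum>v\<leftarrow>T. f v x) (\<Sum>v\<leftarrow>T. P v)"
  by (induction T) (use poly_asymp_const[of F h 0] in \<open>auto intro!: poly_asymp_add\<close>)

lemma poly_asymp_sum:
  "finite A \<Longrightarrow> (\<And>v. v \<in> A \<Longrightarrow> poly_asymp F h (f v) (P v)) \<Longrightarrow> poly_asymp F h (\<lambda>x. \<Sum>v\<in>A. f v x) (\<Sum>v\<in>A. P v)"
  by (induction A rule: finite_induct) (use poly_asymp_const[of F h 0] in \<open>auto intro!: poly_asymp_add\<close>)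

lemma poly_tendsto_zero:
  assumes "F \<noteq> bot" "filterlim h at_top F" "((\<lambda>x. poly P (h x)) \<longlongrightarrow> 0) F"
  shows "P = (0 :: real poly)"
proof (cases "degree P = 0")
  case True
  then obtain c where "P = [:c:]" by (rule degree_eq_zeroE)
  then show ?thesis using assms tendsto_const_iff[of F c 0] by simp
next
  case False
  then have "filterlim (poly P) at_infinity at_infinity" by (intro filterlim_poly_at_infinity) simp
  then have "filterlim (\<lambda>x. poly P (h x)) at_infinity F"
    using filterlim_at_top_imp_at_infinity[OF assms(2)] by (rule filterlim_compose)
  then show ?thesis using not_tendsto_and_filterlim_at_infinity[OF assms(1,3)] by blast
qed

lemma poly_asymp_unique:
  assumes "F \<noteq> bot" "filterlim h at_top F" "poly_asymp F h f P" "poly_asymp F h f Q"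
  shows "P = Q"
proof -
  have "poly_asymp F h (\<lambda>x. 0) (P - Q)" using poly_asymp_diff[OF assms(3,4)] by simp
  then have "((\<lambda>x. 0 - poly (P - Q) (h x)) \<longlongrightarrow> 0) F" unfolding poly_asymp_def by (rule negligible_tendsto)
  from tendsto_minus[OF this] have "((\<lambda>x. poly (P - Q) (h x)) \<longlongrightarrow> 0) F" by (simp del: poly_diff)
  then have "P - Q = 0" by (rule poly_tendsto_zero[OF assms(1,2)])
  then show ?thesis by simp
qed

section \<open>Induction on the number of leading letters\<close>

definition leading :: "'a \<Rightarrow> 'a list \<Rightarrow> nat" where
  "leading a w = length (takeWhile (\<lambda>b. b = a) w)"

lemma leading_simps [simp]: "leading a [] = 0" "leading a (b # w) = (if b = a then Suc (leading a w) else 0)"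
  by (simp_all add: leading_def)

lemma sum_list_split:
  fixes f :: "'a \<Rightarrow> 'b::comm_semiring_1"
  assumes "mset L = replicate_mset n x + mset T"
  shows "(\<Sum>w\<leftarrow>L. f w) = of_nat n * f x + (\<Sum>w\<leftarrow>T. f w)"
proof -
  have "(\<Sum>w\<leftarrow>L. f w) = sum_mset (image_mset f (mset L))" by (simp flip: sum_mset_sum_list)
  also have "\<dots> = of_nat n * f x + sum_mset (image_mset f (mset T))"
    unfolding assms by simp
  finally show ?thesis by (simp flip: sum_mset_sum_list)
qed

text \<open>Inserting a letter \<open>a\<close> into the initial run of \<open>a\<close> gives \<open>a # v\<close> each time; every later insertion keeps the run.\<close>

lemma shuffle_list_leading:
  "\<exists>T. mset (shuffle_list [a] v) = replicate_mset (Suc (leading a v)) (a # v) + mset T \<and> (\<forall>w\<in>set T. leading a w \<le> leading a v)"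
proof (induction v)
  case (Cons b v)
  then obtain T where T: "mset (shuffle_list [a] v) = replicate_mset (Suc (leading a v)) (a # v) + mset T"
      "\<forall>w\<in>set T. leading a w \<le> leading a v" by blast
  show ?case
  proof (cases "b = a")
    case True
    then show ?thesis using T by (intro exI[of _ "map ((#) a) T"]) auto
  next
    case False
    then show ?thesis by (intro exI[of _ "map ((#) b) (shuffle_list [a] v)"]) auto
  qed
qed (auto intro: exI[of _ "[]"])

lemma stuffle_leading:
  assumes "\<forall>k\<in>set v. 1 \<le> k"
  shows "\<exists>T. mset (stuffle [1] v) = replicate_mset (Suc (leading 1 v)) (1 # v) + mset T \<and>
    (\<forall>w\<in>set T. leading 1 w \<le> leading 1 v)"
  using assms
proof (induction v)
  case (Cons b v)
  then obtain T where T: "mset (stuffle [1] v) = replicate_mset (Suc (leading 1 v)) (1 # v) + mset T"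
      "\<forall>w\<in>set T. leading 1 w \<le> leading 1 v" by auto
  show ?case
  proof (cases "b = 1")
    case True
    then show ?thesis using T by (intro exI[of _ "map ((#) 1) T @ [2 # v]"]) auto
  next
    case False
    then show ?thesis using Cons.prems
      by (intro exI[of _ "map ((#) b) (stuffle [1] v) @ [(1 + b) # v]"]) auto
  qed
qed (auto intro: exI[of _ "[]"])

lemma in_stuffle_pos:
  "w \<in> set (stuffle u v) \<Longrightarrow> \<forall>k\<in>set u. 1 \<le> k \<Longrightarrow> \<forall>k\<in>set v. 1 \<le> k \<Longrightarrow> \<forall>k\<in>set w. 1 \<le> k"
  by (induction u v arbitrary: w rule: stuffle.induct) fastforce+

lemma in_stuffle_sum: "w \<in> set (stuffle u v) \<Longrightarrow> sum_list w = sum_list u + sum_list v"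
  by (induction u v arbitrary: w rule: stuffle.induct) fastforce+

text \<open>The regularization recursion. Multiplying \<open>v\<close> by the letter \<open>a\<close> yields a positive multiple of \<open>a # v\<close> and elements with
fewer leading letters \<open>a\<close> than \<open>a # v\<close>, so statements about \<open>a # v\<close> follow from those about \<open>v\<close> and these elements.
It is used for indices with leading entries 1 and for words with leading letters \<open>y\<close>.\<close>

lemma leading_induct:
  assumes v: "v \<in> W"
    and base: "\<And>v. v \<in> W \<Longrightarrow> leading a v = 0 \<Longrightarrow> Q v"
    and step: "\<And>v T. a # v \<in> W \<Longrightarrow> v \<in> W \<Longrightarrow> mset (S v) = replicate_mset (Suc (leading a v)) (a # v) + mset T
        \<Longrightarrow> Q v \<Longrightarrow> (\<And>w. w \<in> set T \<Longrightarrow> Q w) \<Longrightarrow> set T \<subseteq> W \<Longrightarrow> set T \<subseteq> set (S v) \<Longrightarrow> Q (a # v)"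
    and tl: "\<And>v. a # v \<in> W \<Longrightarrow> v \<in> W"
    and S: "\<And>v. v \<in> W \<Longrightarrow> a # v \<in> W \<Longrightarrow> set (S v) \<subseteq> W"
    and split: "\<And>v. v \<in> W \<Longrightarrow> \<exists>T. mset (S v) = replicate_mset (Suc (leading a v)) (a # v) + mset T \<and>
        (\<forall>w\<in>set T. leading a w \<le> leading a v)"
  shows "Q v"
  using v
proof (induction "leading a v" arbitrary: v rule: less_induct)
  case less
  show ?case
  proof (cases "leading a v = 0")
    case True
    then show ?thesis using less base by blast
  next
    case False
    then obtain u where u: "v = a # u" by (cases v) (auto split: if_splits)
    have W: "u \<in> W" using tl less.prems u by blast
    obtain T where T: "mset (S u) = replicate_mset (Suc (leading a u)) (a # u) + mset T"
        "\<forall>w\<in>set T. leading a w \<le> leading a u" using split[OF W] by blast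
    have sub: "set T \<subseteq> set (S u)" using arg_cong[OF T(1), of set_mset] by auto
    then have TW: "set T \<subseteq> W" using S W less.prems u by blast
    show ?thesis unfolding u
    proof (rule step)
      show "Q u" using less(1)[OF _ W] by (simp add: u)
      show "Q w" if "w \<in> set T" for w using less(1)[of w] T(2) TW that by (auto simp: u less_Suc_eq_le)
    qed (use less.prems u W T sub TW in auto)
  qed
qed

definition H1_word :: "letter list \<Rightarrow> bool" where
  "H1_word w \<longleftrightarrow> w = [] \<or> last w = LY"

lemma in_shuffle_list_H1_word: "w \<in> set (shuffle_list u v) \<Longrightarrow> H1_word u \<Longrightarrow> H1_word v \<Longrightarrow> H1_word w"
  unfolding H1_word_def by (rule in_shuffle_list_last)

lemma H1_word_Cons: "H1_word (a # w) \<Longrightarrow> H1_word w"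
  by (auto simp: H1_word_def split: if_splits)

lemma H1_word_zword [simp]: "H1_word (zword ks)"
  by (induction ks) (auto simp: H1_word_def)

lemma zword_z_index: "H1_word w \<Longrightarrow> zword (z_index w) = w"
  using concat_z_index_aux[of w 0] by (cases "w = []") (auto simp: H1_word_def zword_def z_index_def)

lemma z_index_zword: "\<forall>k\<in>set ks. 1 \<le> k \<Longrightarrow> z_index (zword ks) = ks"
  unfolding zword_def by (rule z_index_concat)

lemma H1_word_cases [consumes 1]:
  assumes "H1_word w" obtains ks where "w = zword ks" "\<forall>k\<in>set ks. 1 \<le> k"
  using zword_z_index[OF assms] z_index_pos by metis

lemma leading_zword:
  assumes "\<forall>k\<in>set ks. 1 \<le> k" "leading LY (zword ks) = 0" "ks \<noteq> []"
  obtains k ks' where "ks = k # ks'" "2 \<le> k" "\<forall>k\<in>set ks'. 1 \<le> k"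
proof -
  from assms(3) obtain k ks' where ks: "ks = k # ks'" by (cases ks) auto
  then have "k \<noteq> 1" using assms(2) by auto
  moreover have "1 \<le> k" using assms(1) ks by simp
  ultimately have "2 \<le> k" by simp
  then show ?thesis using that ks assms(1) by simp
qed

section \<open>Harmonic regularization by truncated sums\<close>

lemma harmonic_number_at_top: "filterlim harmonic_number at_top sequentially"
proof -
  have "\<not> summable (\<lambda>n. inverse (real n))"
    using not_summable_harmonic[where 'a = real] by (simp add: inverse_eq_divide)
  then have ns: "\<not> summable (\<lambda>m. 1 / real (Suc m))"
    using summable_Suc_iff[of "\<lambda>n. inverse (real n)"] by (simp add: inverse_eq_divide)
  show ?thesis
    unfolding filterlim_at_top
  proof
    fix Z
    have "\<exists>M. Z \<le> harmonic_number M"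
    proof (rule ccontr)
      assume "\<not> ?thesis"
      then have "(\<Sum>m<M. 1 / real (Suc m)) \<le> Z" for M by (auto simp: mhs.simps not_le less_imp_le)
      then have "summable (\<lambda>m. 1 / real (Suc m))" by (intro summableI_nonneg_bounded[of _ Z]) auto
      then show False using ns by blast
    qed
    then obtain M where "Z \<le> harmonic_number M" by blast
    then show "\<forall>\<^sub>F M in sequentially. Z \<le> harmonic_number M"
      by (intro eventually_sequentiallyI[of M]) (meson mhs_mono order_trans)
  qed
qed

text \<open>The error is a tail of the series. Harmonic numbers increase, so a power of \<open>harmonic_number M\<close> may be moved into the tail,
which is then the tail of another convergent series.\<close>

lemma poly_asymp_mhs_admissible:
  assumes "\<forall>k\<in>set ks. 1 \<le> k" "2 \<le> k"
  shows "poly_asymp sequentially harmonic_number (mhs (k # ks)) [:mzv (k # ks):]"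
  unfolding poly_asymp_def negligible_def
proof
  fix J
  let ?g = "\<lambda>m. mhs ks m / real (Suc m) ^ k * harmonic_number m ^ J"
  have s: "summable ?g" by (rule mhs_admissible_summable[OF assms])
  have s0: "summable (\<lambda>m. mhs ks m / real (Suc m) ^ k)" using mhs_admissible_summable[OF assms, of 0] by simp
  have lim: "(\<lambda>M. suminf (\<lambda>m. ?g (m + M))) \<longlonglongrightarrow> 0" by (rule suminf_exist_split2[OF s])
  have eq: "mzv (k # ks) - mhs (k # ks) M = suminf (\<lambda>m. mhs ks (m + M) / real (Suc (m + M)) ^ k)" for M
    using suminf_split_initial_segment[OF s0, of M] mzv_sums[OF assms]
    by (simp add: sums_iff mhs.simps)
  have bound: "norm ((mhs (k # ks) M - mzv (k # ks)) * harmonic_number M ^ J) \<le> suminf (\<lambda>m. ?g (m + M))" for M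
  proof -
    have s1: "summable (\<lambda>m. mhs ks (m + M) / real (Suc (m + M)) ^ k)"
      using s0 by (subst summable_iff_shift)
    have "suminf (\<lambda>m. mhs ks (m + M) / real (Suc (m + M)) ^ k) * harmonic_number M ^ J
        = suminf (\<lambda>m. mhs ks (m + M) / real (Suc (m + M)) ^ k * harmonic_number M ^ J)"
      by (rule suminf_mult2[OF s1])
    also have "\<dots> \<le> suminf (\<lambda>m. ?g (m + M))"
    proof (rule suminf_le)
      show "mhs ks (m + M) / real (Suc (m + M)) ^ k * harmonic_number M ^ J \<le> ?g (m + M)" for m
        by (intro mult_left_mono power_mono mhs_mono) auto
      show "summable (\<lambda>m. mhs ks (m + M) / real (Suc (m + M)) ^ k * harmonic_number M ^ J)"
        by (rule summable_mult2[OF s1])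
      show "summable (\<lambda>m. ?g (m + M))" using s by (subst summable_iff_shift)
    qed
    finally have "(mzv (k # ks) - mhs (k # ks) M) * harmonic_number M ^ J \<le> suminf (\<lambda>m. ?g (m + M))"
      by (simp only: eq)
    moreover have "0 \<le> mzv (k # ks) - mhs (k # ks) M" unfolding eq by (intro suminf_nonneg s1) auto
    moreover have "norm ((mhs (k # ks) M - mzv (k # ks)) * harmonic_number M ^ J)
        = (mzv (k # ks) - mhs (k # ks) M) * harmonic_number M ^ J"
      using calculation(2) by (simp add: abs_mult)
    ultimately show ?thesis by simp
  qed
  show "(\<lambda>M. (mhs (k # ks) M - poly [:mzv (k # ks):] (harmonic_number M)) * harmonic_number M ^ J) \<longlonglongrightarrow> 0"
    by (rule Lim_null_comparison[OF _ lim]) (use bound in auto)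
qed

definition positive_index :: "nat list \<Rightarrow> bool" where "positive_index ks \<longleftrightarrow> (\<forall>k\<in>set ks. 1 \<le> k)"

lemma positive_index_simps [simp]: "positive_index []" "positive_index (k # ks) \<longleftrightarrow> 1 \<le> k \<and> positive_index ks" "positive_index (us @ vs) \<longleftrightarrow> positive_index us \<and> positive_index vs"
  by (auto simp: positive_index_def)

lemma in_stuffle_positive_index: "w \<in> set (stuffle u v) \<Longrightarrow> positive_index u \<Longrightarrow> positive_index v \<Longrightarrow> positive_index w"
  unfolding positive_index_def by (rule in_stuffle_pos)

lemma leading_1_zero:
  assumes "positive_index ks" "leading 1 ks = 0" "ks \<noteq> []"
  obtains k ks' where "ks = k # ks'" "2 \<le> k" "positive_index ks'"
  using assms by (cases ks) (auto simp: positive_index_def split: if_splits)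

lemma positive_index_induct [consumes 1, case_names base step]:
  assumes "positive_index v" and "\<And>v. positive_index v \<Longrightarrow> leading 1 v = 0 \<Longrightarrow> Q v"
    and "\<And>v T. positive_index v \<Longrightarrow>
        mset (stuffle [1] v) = replicate_mset (Suc (leading 1 v)) (1 # v) + mset T \<Longrightarrow>
        Q v \<Longrightarrow> (\<And>w. w \<in> set T \<Longrightarrow> Q w) \<Longrightarrow> (\<And>w. w \<in> set T \<Longrightarrow> positive_index w) \<Longrightarrow>
        set T \<subseteq> set (stuffle [1] v) \<Longrightarrow> Q (1 # v)"
  shows "Q v"
proof (rule leading_induct[where W = "Collect positive_index" and a = 1 and S = "stuffle [1]" and Q = Q])
  show "\<exists>T. mset (stuffle [1] v) = replicate_mset (Suc (leading 1 v)) (1 # v) + mset T \<and>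
    (\<forall>w\<in>set T. leading 1 w \<le> leading 1 v)" if "v \<in> Collect positive_index" for v
    using that stuffle_leading[of v] by (simp add: positive_index_def)
  show "set (stuffle [1] v) \<subseteq> Collect positive_index" if "v \<in> Collect positive_index" for v
    using that in_stuffle_positive_index[of _ "[1]" v] by auto
  show "Q (1 # v)"
    if "v \<in> Collect positive_index" "mset (stuffle [1] v) = replicate_mset (Suc (leading 1 v)) (1 # v) + mset T"
      "Q v" "\<And>w. w \<in> set T \<Longrightarrow> Q w" "set T \<subseteq> Collect positive_index" "set T \<subseteq> set (stuffle [1] v)" for v T
    by (rule assms(3)[of v T]) (use that in auto)
qed (use assms(1,2) in auto)

lemma H1_word_induct [consumes 1, case_names base step]:
  assumes "H1_word v" and "\<And>v. H1_word v \<Longrightarrow> leading LY v = 0 \<Longrightarrow> Q v"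
    and "\<And>v T. H1_word v \<Longrightarrow>
        mset (shuffle_list [LY] v) = replicate_mset (Suc (leading LY v)) (LY # v) + mset T \<Longrightarrow>
        Q v \<Longrightarrow> (\<And>w. w \<in> set T \<Longrightarrow> Q w) \<Longrightarrow> (\<And>w. w \<in> set T \<Longrightarrow> H1_word w) \<Longrightarrow>
        set T \<subseteq> set (shuffle_list [LY] v) \<Longrightarrow> Q (LY # v)"
  shows "Q v"
proof (rule leading_induct[where W = "Collect H1_word" and a = LY and S = "shuffle_list [LY]" and Q = Q])
  show "set (shuffle_list [LY] v) \<subseteq> Collect H1_word" if "v \<in> Collect H1_word" for v
    using that in_shuffle_list_H1_word[of _ "[LY]" v] by (auto simp: H1_word_def)
  show "Q (LY # v)"
    if "v \<in> Collect H1_word" "mset (shuffle_list [LY] v) = replicate_mset (Suc (leading LY v)) (LY # v) + mset T"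
      "Q v" "\<And>w. w \<in> set T \<Longrightarrow> Q w" "set T \<subseteq> Collect H1_word" "set T \<subseteq> set (shuffle_list [LY] v)" for v T
    by (rule assms(3)[of v T]) (use that in auto)
qed (use assms(1,2) H1_word_Cons shuffle_list_leading in auto)

lemma poly_asymp_cong:
  assumes "\<forall>\<^sub>F x in F. f x = g x" "poly_asymp F h f P" shows "poly_asymp F h g P"
  unfolding poly_asymp_def negligible_def
proof
  fix J
  have "((\<lambda>x. (f x - poly P (h x)) * h x ^ J) \<longlongrightarrow> 0) F" using assms(2) by (simp add: poly_asymp_def negligible_def)
  then show "((\<lambda>x. (g x - poly P (h x)) * h x ^ J) \<longlongrightarrow> 0) F"
    by (rule Lim_transform_eventually) (use assms(1) in eventually_elim, simp)
qed

text \<open>The expansion for \<open>a\<close> is obtained by solving the product relation for the term with the most leading letters.\<close>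

lemma poly_asymp_step:
  assumes h: "eventually (\<lambda>x. h x * g v x = (\<Sum>w\<leftarrow>L. g w x)) F"
    and L: "mset L = replicate_mset (Suc n) a + mset T"
    and P: "poly_asymp F h (g v) (P v)" "\<And>w. w \<in> set T \<Longrightarrow> poly_asymp F h (g w) (P w)"
  shows "poly_asymp F h (g a) (smult (1 / real (Suc n)) ([:0, 1:] * P v - (\<Sum>w\<leftarrow>T. P w)))"
proof -
  have ev: "\<forall>\<^sub>F x in F. 1 / real (Suc n) * (h x * g v x - (\<Sum>w\<leftarrow>T. g w x)) = g a x"
    using h
  proof eventually_elim
    case (elim x)
    show ?case unfolding elim sum_list_split[OF L, of "\<lambda>w. g w x"] by (simp add: field_simps)
  qed
  have "poly_asymp F h (\<lambda>x. 1 / real (Suc n) * (h x * g v x - (\<Sum>w\<leftarrow>T. g w x)))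
      (smult (1 / real (Suc n)) ([:0, 1:] * P v - (\<Sum>w\<leftarrow>T. P w)))"
    by (intro poly_asymp_cmult poly_asymp_diff poly_asymp_mult poly_asymp_scale poly_asymp_sum_list P)
  then show ?thesis by (rule poly_asymp_cong[OF ev])
qed

text \<open>The polynomial \<open>Z\<^sup>*\<close> of the index, characterized by the truncated sums.\<close>

definition harmonic_poly :: "nat list \<Rightarrow> real poly" where
  "harmonic_poly ks = (THE P. poly_asymp sequentially harmonic_number (mhs ks) P)"

lemma harmonic_poly_eqI: "poly_asymp sequentially harmonic_number (mhs ks) P \<Longrightarrow> harmonic_poly ks = P"
  unfolding harmonic_poly_def
  by (rule the_equality) (auto intro: poly_asymp_unique[OF _ harmonic_number_at_top])

lemma poly_asymp_harmonic_poly: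
  assumes "positive_index ks" shows "poly_asymp sequentially harmonic_number (mhs ks) (harmonic_poly ks)"
proof -
  have "\<exists>P. poly_asymp sequentially harmonic_number (mhs ks) P"
    using assms
  proof (induction ks rule: positive_index_induct)
    case (base v)
    show ?case
    proof (cases "v = []")
      case True
      have "mhs [] = (\<lambda>_. 1)" by (rule ext) simp
      then show ?thesis using poly_asymp_const[of sequentially harmonic_number 1] True by auto
    next
      case False
      then show ?thesis using poly_asymp_mhs_admissible leading_1_zero[OF base False] unfolding positive_index_def by metis
    qed
  next
    case (step v T)
    have "\<forall>w\<in>set (v # T). \<exists>P. poly_asymp sequentially harmonic_number (mhs w) P" using step by simp
    then obtain P where P: "\<And>w. w \<in> set (v # T) \<Longrightarrow> poly_asymp sequentially harmonic_number (mhs w) (P w)" by metis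
    show ?case using poly_asymp_step[where g = mhs, OF always_eventually[OF allI[OF mhs_stuffle]] step(2), where P = P and F = sequentially] P by auto
  qed
  then show ?thesis using harmonic_poly_eqI by auto
qed

lemma harmonic_poly_admissible: "positive_index ks \<Longrightarrow> 2 \<le> k \<Longrightarrow> harmonic_poly (k # ks) = [:mzv (k # ks):]"
  by (rule harmonic_poly_eqI[OF poly_asymp_mhs_admissible]) (auto simp: positive_index_def)

lemma harmonic_poly_Nil: "harmonic_poly [] = 1"
proof -
  have "mhs [] = (\<lambda>_. 1)" by (rule ext) simp
  then show ?thesis using poly_asymp_const[of sequentially harmonic_number 1] by (intro harmonic_poly_eqI) (simp add: one_pCons)
qed

lemma harmonic_poly_1: "harmonic_poly [1] = [:0, 1:]"
  by (rule harmonic_poly_eqI[OF poly_asymp_scale])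

lemma harmonic_poly_stuffle:
  assumes "positive_index u" "positive_index v"
  shows "harmonic_poly u * harmonic_poly v = (\<Sum>w\<leftarrow>stuffle u v. harmonic_poly w)"
proof (rule poly_asymp_unique[OF _ harmonic_number_at_top])
  show "poly_asymp sequentially harmonic_number (\<lambda>M. mhs u M * mhs v M) (harmonic_poly u * harmonic_poly v)"
    by (intro poly_asymp_mult poly_asymp_harmonic_poly assms)
  show "poly_asymp sequentially harmonic_number (\<lambda>M. mhs u M * mhs v M) (\<Sum>w\<leftarrow>stuffle u v. harmonic_poly w)"
    unfolding mhs_stuffle using assms by (intro poly_asymp_sum_list poly_asymp_harmonic_poly) (auto intro: in_stuffle_positive_index)
qed simp

lemma harmonic_poly_step:
  assumes "positive_index v" "mset (stuffle [1] v) = replicate_mset (Suc n) (1 # v) + mset T"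
    "\<And>w. w \<in> set T \<Longrightarrow> positive_index w"
  shows "harmonic_poly (1 # v) = smult (1 / real (Suc n)) ([:0, 1:] * harmonic_poly v - (\<Sum>w\<leftarrow>T. harmonic_poly w))"
  using assms poly_asymp_harmonic_poly by (intro harmonic_poly_eqI poly_asymp_step[where g = mhs, OF always_eventually[OF allI[OF mhs_stuffle]] assms(2)]) auto

section \<open>Multiple polylogarithms and the shuffle product\<close>

text \<open>Power series coefficients of the multiple polylogarithm of a word: a letter \<open>x\<close> integrates against \<open>dt / t\<close>, a letter \<open>y\<close> against
\<open>dt / (1 - t)\<close>. The division \<open>0 / 0 = 0\<close> makes the constant term vanish.\<close>

fun Li_coeff :: "letter list \<Rightarrow> nat \<Rightarrow> real" where
  "Li_coeff [] m = (if m = 0 then 1 else 0)"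
| "Li_coeff (LX # w) m = Li_coeff w m / real m"
| "Li_coeff (LY # w) m = (\<Sum>j<m. Li_coeff w j) / real m"

lemma Li_coeff_nonneg [simp]: "0 \<le> Li_coeff w m"
  by (induction w m rule: Li_coeff.induct) (auto intro!: sum_nonneg divide_nonneg_nonneg)

lemma Li_coeff_le_1: "Li_coeff w m \<le> 1"
proof (induction w m rule: Li_coeff.induct)
  case (2 w m)
  then show ?case by (cases m) (auto simp: divide_le_eq)
next
  case (3 w m)
  have "(\<Sum>j<m. Li_coeff w j) \<le> (\<Sum>j<m. 1)" using 3 by (intro sum_mono) auto
  then show ?case by (cases m) (auto simp: divide_le_eq)
qed simp

lemma Li_coeff_0: "w \<noteq> [] \<Longrightarrow> Li_coeff w 0 = 0"
  by (cases w; cases "hd w") auto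

lemma Li_coeff_replicate: "Li_coeff (replicate n LX @ w) m = Li_coeff w m / real m ^ n"
  by (induction n) (simp_all add: field_simps)

lemma sum_Li_coeff_zword: "positive_index ks \<Longrightarrow> (\<Sum>j\<le>M. Li_coeff (zword ks) j) = mhs ks M"
  and Li_coeff_zword_Suc: "positive_index (k # ks) \<Longrightarrow> Li_coeff (zword (k # ks)) (Suc m) = mhs ks m / real (Suc m) ^ k"
proof -
  have c: "Li_coeff (zword (k # ks)) (Suc m) = mhs ks m / real (Suc m) ^ k"
    if "\<And>M. (\<Sum>j\<le>M. Li_coeff (zword ks) j) = mhs ks M" "1 \<le> k" for k ks m
    using that by (cases k) (simp_all add: Li_coeff_replicate lessThan_Suc_atMost mult.commute)
  have s: "(\<Sum>j\<le>M. Li_coeff (zword ks) j) = mhs ks M" if "positive_index ks" for ks M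
    using that
  proof (induction ks arbitrary: M)
    case Nil
    then show ?case by simp
  next
    case (Cons k ks)
    have "(\<Sum>j\<le>M. Li_coeff (zword (k # ks)) j) = (\<Sum>j<M. Li_coeff (zword (k # ks)) (Suc j))"
      by (subst sum.atMost_shift) (simp only: Li_coeff_0 zword_simps append_is_Nil_conv list.simps simp_thms add_0)
    also have "\<dots> = mhs (k # ks) M"
      unfolding mhs.simps using Cons by (intro sum.cong refl c) auto
    finally show ?case .
  qed
  show "positive_index ks \<Longrightarrow> (\<Sum>j\<le>M. Li_coeff (zword ks) j) = mhs ks M" by (rule s)
  show "positive_index (k # ks) \<Longrightarrow> Li_coeff (zword (k # ks)) (Suc m) = mhs ks m / real (Suc m) ^ k" using c s by simp
qed

definition Li_fps :: "letter list \<Rightarrow> real fps" where "Li_fps w = Abs_fps (Li_coeff w)"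

text \<open>The densities \<open>1 / t\<close> and \<open>1 / (1 - t)\<close> of the two differential forms, multiplied by \<open>t (1 - t)\<close> to clear
denominators.\<close>

fun kernel_factor :: "letter \<Rightarrow> real fps" where
  "kernel_factor LX = 1 - fps_X"
| "kernel_factor LY = fps_X"

lemma Li_fps_deriv:
  assumes "H1_word (a # w)"
  shows "fps_X * (1 - fps_X) * fps_deriv (Li_fps (a # w)) = kernel_factor a * Li_fps w"
proof (cases a)
  case LX
  then have "w \<noteq> []" using assms by (auto simp: H1_word_def)
  have "fps_X * fps_deriv (Li_fps (LX # w)) = Li_fps w"
  proof (rule fps_ext)
    fix n show "fps_nth (fps_X * fps_deriv (Li_fps (LX # w))) n = fps_nth (Li_fps w) n"
      by (cases n) (use Li_coeff_0[OF \<open>w \<noteq> []\<close>] in \<open>simp_all add: Li_fps_def\<close>)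
  qed
  then show ?thesis using LX by (simp add: mult.commute mult.left_commute)
next
  case LY
  have "(1 - fps_X) * fps_deriv (Li_fps (LY # w)) = Li_fps w"
  proof (rule fps_ext)
    fix n show "fps_nth ((1 - fps_X) * fps_deriv (Li_fps (LY # w))) n = fps_nth (Li_fps w) n"
      by (cases n) (simp_all add: Li_fps_def left_diff_distrib)
  qed
  then show ?thesis using LY by (simp add: mult.assoc)
qed

text \<open>The product rule is the shuffle recursion. Both sides have the same derivative by induction, and vanishing constant
terms.\<close>

lemma Li_fps_shuffle_list:
  assumes "H1_word u" "H1_word v"
  shows "Li_fps u * Li_fps v = (\<Sum>w\<leftarrow>shuffle_list u v. Li_fps w)"
  using assms
proof (induction u v rule: shuffle_list.induct)
  case (1 v)
  have "Li_fps [] = 1" by (rule fps_ext) (simp add: Li_fps_def)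
  then show ?case by simp
next
  case (2 a u)
  have "Li_fps [] = 1" by (rule fps_ext) (simp add: Li_fps_def)
  then show ?case by simp
next
  case (3 a u b v)
  \<comment> \<open>The common derivation \<open>t (1 - t) d/dt\<close> for both letters.\<close>
  let ?D = "\<lambda>f :: real fps. fps_X * (1 - fps_X) * fps_deriv f"
  have H: "H1_word u" "H1_word v" using 3 H1_word_Cons by blast+
  have D_sum: "?D (\<Sum>w\<leftarrow>T. Li_fps (c # w)) = kernel_factor c * (\<Sum>w\<leftarrow>T. Li_fps w)" if "\<forall>w\<in>set T. H1_word (c # w)" for c T
    using that by (induction T) (simp_all add: distrib_left Li_fps_deriv)
  have in1: "\<forall>w\<in>set (shuffle_list u (b # v)). H1_word (a # w)" "\<forall>w\<in>set (shuffle_list (a # u) v). H1_word (b # w)"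
    using in_shuffle_list_H1_word[of _ "a # u" "b # v"] 3 by auto
  have "?D (Li_fps (a # u) * Li_fps (b # v)) = ?D (Li_fps (a # u)) * Li_fps (b # v) + Li_fps (a # u) * ?D (Li_fps (b # v))"
    by (simp add: algebra_simps)
  also have "\<dots> = kernel_factor a * (Li_fps u * Li_fps (b # v)) + kernel_factor b * (Li_fps (a # u) * Li_fps v)"
    unfolding Li_fps_deriv[OF 3(3)] Li_fps_deriv[OF 3(4)] by (simp only: mult_ac)
  also have "\<dots> = ?D (\<Sum>w\<leftarrow>shuffle_list (a # u) (b # v). Li_fps w)"
    using 3 H by (simp add: o_def distrib_left D_sum in1)
  finally have "fps_deriv (Li_fps (a # u) * Li_fps (b # v)) = fps_deriv (\<Sum>w\<leftarrow>shuffle_list (a # u) (b # v). Li_fps w)"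
  proof -
    have "fps_nth (1 - fps_X :: real fps) 0 \<noteq> fps_nth 0 0" by simp
    then have "(1 - fps_X :: real fps) \<noteq> 0" by metis
    moreover assume "?D (Li_fps (a # u) * Li_fps (b # v)) = ?D (\<Sum>w\<leftarrow>shuffle_list (a # u) (b # v). Li_fps w)"
    ultimately show ?thesis by (simp only: mult_cancel_left) simp
  qed
  moreover have "fps_nth (\<Sum>w\<leftarrow>T. Li_fps (c # w)) 0 = 0" for c T
    by (induction T) (simp_all add: Li_fps_def Li_coeff_0)
  then have "fps_nth (Li_fps (a # u) * Li_fps (b # v)) 0 = fps_nth (\<Sum>w\<leftarrow>shuffle_list (a # u) (b # v). Li_fps w) 0"
    by (simp add: Li_fps_def Li_coeff_0 o_def)
  ultimately show ?case by (simp only: fps_deriv_eq_iff) simp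
qed

definition Li :: "letter list \<Rightarrow> real \<Rightarrow> real" where
  "Li w t = suminf (\<lambda>m. Li_coeff w m * t ^ m)"

lemma summable_Li_coeff: "0 \<le> t \<Longrightarrow> t < 1 \<Longrightarrow> summable (\<lambda>m. Li_coeff w m * t ^ m)"
proof (rule summable_comparison_test'[OF summable_geometric[of t], where N = 0])
  fix m assume t: "0 \<le> t" "t < 1"
  then have "Li_coeff w m * t ^ m \<le> 1 * t ^ m" by (intro mult_right_mono Li_coeff_le_1) auto
  then show "norm (Li_coeff w m * t ^ m) \<le> t ^ m" using t by (simp add: abs_mult)
qed simp

lemma Li_sums: "0 \<le> t \<Longrightarrow> t < 1 \<Longrightarrow> (\<lambda>m. Li_coeff w m * t ^ m) sums Li w t"
  unfolding Li_def by (rule summable_sums[OF summable_Li_coeff])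

lemma sums_sum_list:
  fixes f :: "'a \<Rightarrow> nat \<Rightarrow> real"
  shows "(\<And>w. w \<in> set T \<Longrightarrow> f w sums s w) \<Longrightarrow> (\<lambda>n. \<Sum>w\<leftarrow>T. f w n) sums (\<Sum>w\<leftarrow>T. s w)"
  by (induction T) (auto intro: sums_add)

lemma fps_nth_sum_list: "fps_nth (\<Sum>w\<leftarrow>T. f w) n = (\<Sum>w\<leftarrow>T. fps_nth (f w) n)"
  by (induction T) simp_all

text \<open>The Cauchy product turns the identity of formal power series into one of functions on the unit interval.\<close>

lemma Li_shuffle_list:
  assumes t: "0 \<le> t" "t < 1" and "H1_word u" "H1_word v"
  shows "Li u t * Li v t = (\<Sum>w\<leftarrow>shuffle_list u v. Li w t)"
proof (rule sums_unique2)
  have n: "norm (Li_coeff w m * t ^ m) = Li_coeff w m * t ^ m" for w m using t by (simp add: abs_mult)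
  have "(\<lambda>k. \<Sum>i\<le>k. Li_coeff u i * t ^ i * (Li_coeff v (k - i) * t ^ (k - i))) sums (Li u t * Li v t)"
    unfolding Li_def by (rule Cauchy_product_sums) (simp_all only: n summable_Li_coeff[OF t])
  moreover have "(\<Sum>i\<le>k. Li_coeff u i * t ^ i * (Li_coeff v (k - i) * t ^ (k - i))) = (\<Sum>w\<leftarrow>shuffle_list u v. Li_coeff w k) * t ^ k" for k
  proof -
    have "(\<Sum>i\<le>k. Li_coeff u i * t ^ i * (Li_coeff v (k - i) * t ^ (k - i))) = (\<Sum>i\<le>k. Li_coeff u i * Li_coeff v (k - i)) * t ^ k"
      unfolding sum_distrib_right
    proof (intro sum.cong refl)
      fix i assume "i \<in> {..k}"
      then have "t ^ k = t ^ i * t ^ (k - i)" by (simp flip: power_add)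
      then show "Li_coeff u i * t ^ i * (Li_coeff v (k - i) * t ^ (k - i)) = Li_coeff u i * Li_coeff v (k - i) * t ^ k" by simp
    qed
    also have "(\<Sum>i\<le>k. Li_coeff u i * Li_coeff v (k - i)) = fps_nth (Li_fps u * Li_fps v) k"
      by (simp add: Li_fps_def fps_mult_nth atLeast0AtMost)
    also have "\<dots> = (\<Sum>w\<leftarrow>shuffle_list u v. Li_coeff w k)" unfolding Li_fps_shuffle_list[OF assms(3,4)] fps_nth_sum_list
      by (simp add: Li_fps_def)
    finally show ?thesis .
  qed
  ultimately show "(\<lambda>k. (\<Sum>w\<leftarrow>shuffle_list u v. Li_coeff w k) * t ^ k) sums (Li u t * Li v t)" by simp
  show "(\<lambda>k. (\<Sum>w\<leftarrow>shuffle_list u v. Li_coeff w k) * t ^ k) sums (\<Sum>w\<leftarrow>shuffle_list u v. Li w t)"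
    unfolding sum_list_mult_const[symmetric] by (intro sums_sum_list Li_sums t)
qed

lemma Li_Nil: "Li [] t = 1"
proof -
  have "(\<lambda>m. Li_coeff [] m * t ^ m) = (\<lambda>m. if m = 0 then t ^ m else 0)" by auto
  then show ?thesis using sums_unique[OF sums_single[of 0 "\<lambda>m. t ^ m"]] by (simp add: Li_def)
qed

lemma Li_LY: "0 \<le> t \<Longrightarrow> t < 1 \<Longrightarrow> Li [LY] t = - ln (1 - t)"
proof -
  assume t: "0 \<le> t" "t < 1"
  have "(\<lambda>n. - (- (t ^ n) / real n)) sums (- ln (1 + (- t)))"
    using ln_series'[of "-t"] t by (intro sums_minus) simp
  moreover have "Li_coeff [LY] n = 1 / real n" for n by (cases n) simp_all
  then have "(\<lambda>n. Li_coeff [LY] n * t ^ n) = (\<lambda>n. - (- (t ^ n) / real n))" by (simp only:) simp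
  ultimately show ?thesis using sums_unique2[OF Li_sums[OF t, of "[LY]"]] by simp
qed

section \<open>Shuffle regularization by polylogarithms near 1\<close>

abbreviation Li_y :: "real \<Rightarrow> real" where "Li_y \<equiv> Li [LY]"

lemma eventually_unit: "\<forall>\<^sub>F t in at_left (1 :: real). 0 \<le> t \<and> t < 1"
  using eventually_at_left_real[of 0 1] by (auto elim: eventually_mono)

lemma Li_y_at_top: "filterlim Li_y at_top (at_left 1)"
proof -
  have "filterlim (\<lambda>t::real. 1 - t) (at_right 0) (at_left 1)"
    unfolding filterlim_at by (auto intro!: tendsto_eq_intros simp: eventually_at_filter)
  then have "filterlim (\<lambda>t::real. ln (1 - t)) at_bot (at_left 1)"
    by (rule filterlim_compose[OF ln_at_0])
  then have "filterlim (\<lambda>t::real. - ln (1 - t)) at_top (at_left 1)"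
    by (simp add: filterlim_uminus_at_bot)
  then show ?thesis
    by (rule filterlim_cong[THEN iffD1, OF refl refl, rotated])
       (use eventually_unit in eventually_elim, simp add: Li_LY)
qed

lemma sqrt_one_minus: "0 \<le> t \<Longrightarrow> t < 1 \<Longrightarrow> sqrt (1 - t) = exp (- Li_y t / 2)"
  by (simp add: Li_LY flip: ln_sqrt)

text \<open>The left-hand side is at most 1 and, by Bernoulli's inequality, at most \<open>n (1 - t)\<close>; hence it is at most the geometric mean.\<close>

lemma one_minus_power_le: "0 \<le> t \<Longrightarrow> t \<le> 1 \<Longrightarrow> 1 - t ^ n \<le> sqrt (real n) * sqrt (1 - (t :: real))"
proof -
  assume t: "0 \<le> t" "t \<le> 1"
  have p: "0 \<le> t ^ n" "t ^ n \<le> 1" using t by (auto simp: power_le_one)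
  then have "(1 - t ^ n)\<^sup>2 \<le> 1 - t ^ n" by (simp add: power2_eq_square mult_left_le)
  also have "\<dots> \<le> real n * (1 - t)"
    using Bernoulli_inequality[of "t - 1" n] t by (simp add: algebra_simps)
  finally show ?thesis by (simp add: real_le_rsqrt flip: real_sqrt_mult)
qed

lemma Li_coeff_sqrt_summable:
  assumes "positive_index ks" "2 \<le> k"
  shows "summable (\<lambda>m. mhs ks m / real (Suc m) ^ k * sqrt (real (Suc m)))"
proof (rule summable_comparison_test'[OF summable_harmonic_number_power[of "length ks"], where N = 0])
  fix m :: nat
  have "1 / real (Suc m) ^ k = real (Suc m) powr (- real k)" by (simp add: powr_minus_divide powr_realpow)
  also have "\<dots> \<le> real (Suc m) powr (-2)" using assms by (intro powr_mono) auto
  finally have "1 / real (Suc m) ^ k * sqrt (real (Suc m)) \<le> real (Suc m) powr (-2) * real (Suc m) powr (1 / 2)"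
    unfolding powr_half_sqrt[OF of_nat_0_le_iff] by (rule mult_right_mono) simp
  also have "\<dots> = real (Suc m) powr (-3 / 2)" by (simp flip: powr_add)
  finally have 1: "1 / real (Suc m) ^ k * sqrt (real (Suc m)) \<le> real (Suc m) powr (-3 / 2)" .
  have "mhs ks m * (1 / real (Suc m) ^ k * sqrt (real (Suc m))) \<le> harmonic_number m ^ length ks * real (Suc m) powr (-3 / 2)"
    using assms(1) by (intro mult_mono 1 mhs_le_harmonic_number_power) (auto simp: positive_index_def)
  then show "norm (mhs ks m / real (Suc m) ^ k * sqrt (real (Suc m))) \<le> harmonic_number m ^ length ks * real (Suc m) powr (-3 / 2)"
    by (simp add: abs_mult)
qed

text \<open>The error is at most \<open>K sqrt (1 - t)\<close>, by \<open>one_minus_power_le\<close> and the convergence of the series weighted with square roots.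
In terms of the scale \<open>Li_y\<close> the factor \<open>sqrt (1 - t)\<close> is \<open>exp (- Li_y / 2)\<close>, which beats every power.\<close>

lemma poly_asymp_Li_admissible:
  assumes "positive_index ks" "2 \<le> k"
  shows "poly_asymp (at_left 1) Li_y (Li (zword (k # ks))) [:mzv (k # ks):]"
  unfolding poly_asymp_def negligible_def
proof
  fix J
  define c where "c = (\<lambda>m. mhs ks m / real (Suc m) ^ k)"
  have c0: "0 \<le> c m" for m by (simp add: c_def)
  have cs: "c sums mzv (k # ks)" unfolding c_def by (rule mzv_sums) (use assms in \<open>auto simp: positive_index_def\<close>)
  have csq: "summable (\<lambda>m. c m * sqrt (real (Suc m)))" unfolding c_def by (rule Li_coeff_sqrt_summable[OF assms])
  define K where "K = suminf (\<lambda>m. c m * sqrt (real (Suc m)))"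
  have bound: "norm (Li (zword (k # ks)) t - mzv (k # ks)) \<le> K * sqrt (1 - t)" if t: "0 \<le> t" "t < 1" for t
  proof -
    have "(\<lambda>m. Li_coeff (zword (k # ks)) (Suc m) * t ^ Suc m) sums Li (zword (k # ks)) t"
      using Li_sums[OF t, of "zword (k # ks)"] Li_coeff_0[of "zword (k # ks)"] by (subst sums_Suc_iff) simp
    moreover have "Li_coeff (zword (k # ks)) (Suc m) = c m" for m
      unfolding c_def using assms by (intro Li_coeff_zword_Suc) simp
    ultimately have "(\<lambda>m. c m * t ^ Suc m) sums Li (zword (k # ks)) t" by (simp only:)
    from sums_diff[OF cs this] have s: "(\<lambda>m. c m * (1 - t ^ Suc m)) sums (mzv (k # ks) - Li (zword (k # ks)) t)"
      by (simp add: algebra_simps)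
    have "mzv (k # ks) - Li (zword (k # ks)) t \<le> K * sqrt (1 - t)"
    proof (rule sums_le[OF _ s])
      show "(\<lambda>m. c m * sqrt (real (Suc m)) * sqrt (1 - t)) sums (K * sqrt (1 - t))"
        unfolding K_def by (intro sums_mult2 summable_sums csq)
      show "c m * (1 - t ^ Suc m) \<le> c m * sqrt (real (Suc m)) * sqrt (1 - t)" for m
        unfolding mult.assoc using t by (intro mult_left_mono one_minus_power_le c0) auto
    qed
    moreover have "0 \<le> mzv (k # ks) - Li (zword (k # ks)) t"
    proof (rule sums_le[OF _ sums_zero s])
      show "0 \<le> c m * (1 - t ^ Suc m)" for m
        using c0[of m] power_le_one[of t "Suc m"] t by (intro mult_nonneg_nonneg) auto
    qed
    ultimately show ?thesis by simp
  qed
  have "filterlim (\<lambda>t. Li_y t * (1 / 2)) at_top (at_left 1)"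
    by (rule filterlim_at_top_mult_tendsto_pos[OF tendsto_const _ Li_y_at_top]) simp
  then have "((\<lambda>t. (Li_y t * (1 / 2)) ^ J / exp (Li_y t * (1 / 2))) \<longlongrightarrow> 0) (at_left 1)"
    by (rule filterlim_compose[OF tendsto_power_div_exp_0])
  then have lim: "((\<lambda>t. K * 2 ^ J * ((Li_y t * (1 / 2)) ^ J / exp (Li_y t * (1 / 2)))) \<longlongrightarrow> 0) (at_left 1)"
    by (rule tendsto_mult_right_zero)
  show "((\<lambda>t. (Li (zword (k # ks)) t - poly [:mzv (k # ks):] (Li_y t)) * Li_y t ^ J) \<longlongrightarrow> 0) (at_left 1)"
  proof (rule Lim_null_comparison[OF _ lim], use eventually_unit in eventually_elim)
    case (elim t)
    then have L0: "0 \<le> Li_y t" by (simp add: Li_LY)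
    have "norm ((Li (zword (k # ks)) t - mzv (k # ks)) * Li_y t ^ J) \<le> K * sqrt (1 - t) * Li_y t ^ J"
      using mult_right_mono[OF bound[of t], of "Li_y t ^ J"] elim L0 by (simp add: abs_mult)
    also have "\<dots> = K * 2 ^ J * ((Li_y t * (1 / 2)) ^ J / exp (Li_y t * (1 / 2)))"
      using elim by (simp add: sqrt_one_minus exp_minus field_simps)
    finally show ?case by simp
  qed
qed

lemma Li_y_times_Li: "H1_word v \<Longrightarrow> \<forall>\<^sub>F t in at_left 1. Li_y t * Li v t = (\<Sum>w\<leftarrow>shuffle_list [LY] v. Li w t)"
  using eventually_unit by eventually_elim (intro Li_shuffle_list; simp add: H1_word_def)

text \<open>The polynomial \<open>Z\<^sup>s\<^sup>h\<close> of the word, characterized by the polylogarithm near 1.\<close>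

definition shuffle_poly :: "letter list \<Rightarrow> real poly" where
  "shuffle_poly w = (THE P. poly_asymp (at_left 1) Li_y (Li w) P)"

lemma shuffle_poly_eqI: "poly_asymp (at_left 1) Li_y (Li w) P \<Longrightarrow> shuffle_poly w = P"
  unfolding shuffle_poly_def
  by (rule the_equality) (auto intro: poly_asymp_unique[OF _ Li_y_at_top])

lemma poly_asymp_shuffle_poly:
  assumes "H1_word w" shows "poly_asymp (at_left 1) Li_y (Li w) (shuffle_poly w)"
proof -
  have "\<exists>P. poly_asymp (at_left 1) Li_y (Li w) P"
    using assms
  proof (induction w rule: H1_word_induct)
    case (base v)
    obtain ks where ks: "v = zword ks" "positive_index ks" using H1_word_cases[OF base(1)] by (auto simp: positive_index_def)
    show ?case
    proof (cases "ks = []")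
      case True
      have "Li [] = (\<lambda>_. 1)" by (rule ext) (rule Li_Nil)
      then show ?thesis using poly_asymp_const[of "at_left 1" Li_y 1] True ks by auto
    next
      case False
      then show ?thesis using leading_zword[of ks] ks base(2) poly_asymp_Li_admissible unfolding positive_index_def by metis
    qed
  next
    case (step v T)
    have "\<forall>w\<in>set (v # T). \<exists>P. poly_asymp (at_left 1) Li_y (Li w) P" using step by simp
    then obtain P where P: "\<And>w. w \<in> set (v # T) \<Longrightarrow> poly_asymp (at_left 1) Li_y (Li w) (P w)" by metis
    show ?case using poly_asymp_step[OF Li_y_times_Li[OF step(1)] step(2), where P = P] P by auto
  qed
  then show ?thesis using shuffle_poly_eqI by auto
qed

lemma shuffle_poly_admissible: "positive_index ks \<Longrightarrow> 2 \<le> k \<Longrightarrow> shuffle_poly (zword (k # ks)) = [:mzv (k # ks):]"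
  by (rule shuffle_poly_eqI[OF poly_asymp_Li_admissible])

lemma shuffle_poly_Nil: "shuffle_poly [] = 1"
proof -
  have "Li [] = (\<lambda>_. 1)" by (rule ext) (rule Li_Nil)
  then show ?thesis using poly_asymp_const[of "at_left 1" Li_y 1] by (intro shuffle_poly_eqI) (simp add: one_pCons)
qed

lemma shuffle_poly_LY: "shuffle_poly [LY] = [:0, 1:]"
  by (rule shuffle_poly_eqI[OF poly_asymp_scale])

lemma shuffle_poly_shuffle_list:
  assumes "H1_word u" "H1_word v"
  shows "shuffle_poly u * shuffle_poly v = (\<Sum>w\<leftarrow>shuffle_list u v. shuffle_poly w)"
proof (rule poly_asymp_unique[OF _ Li_y_at_top])
  show "poly_asymp (at_left 1) Li_y (\<lambda>M. Li u M * Li v M) (shuffle_poly u * shuffle_poly v)"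
    by (intro poly_asymp_mult poly_asymp_shuffle_poly assms)
  show "poly_asymp (at_left 1) Li_y (\<lambda>t. Li u t * Li v t) (\<Sum>w\<leftarrow>shuffle_list u v. shuffle_poly w)"
  proof (rule poly_asymp_cong)
    show "poly_asymp (at_left 1) Li_y (\<lambda>t. \<Sum>w\<leftarrow>shuffle_list u v. Li w t) (\<Sum>w\<leftarrow>shuffle_list u v. shuffle_poly w)"
      using assms by (intro poly_asymp_sum_list poly_asymp_shuffle_poly) (auto intro: in_shuffle_list_H1_word)
    show "\<forall>\<^sub>F t in at_left 1. (\<Sum>w\<leftarrow>shuffle_list u v. Li w t) = Li u t * Li v t"
      using eventually_unit by eventually_elim (simp add: Li_shuffle_list assms)
  qed
qed simp

lemma shuffle_poly_step:
  assumes "H1_word v" "mset (shuffle_list [LY] v) = replicate_mset (Suc n) (LY # v) + mset T"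
    "\<And>w. w \<in> set T \<Longrightarrow> H1_word w"
  shows "shuffle_poly (LY # v) = smult (1 / real (Suc n)) ([:0, 1:] * shuffle_poly v - (\<Sum>w\<leftarrow>T. shuffle_poly w))"
  using assms poly_asymp_shuffle_poly by (intro shuffle_poly_eqI poly_asymp_step[OF Li_y_times_Li assms(2)]) auto

section \<open>Comparison of the two regularizations\<close>

text \<open>The truncated sums are the partial sums of the coefficients of \<open>Li\<close>, so their generating function arises by multiplication with
the geometric series.\<close>

lemma Li_zword_mhs:
  assumes "positive_index ks" "0 \<le> t" "t < 1"
  shows "(\<lambda>M. mhs ks M * t ^ M) sums (Li (zword ks) t / (1 - t))"
proof -
  have n: "norm (Li_coeff w m * t ^ m) = Li_coeff w m * t ^ m" for w m using assms by (simp add: abs_mult)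
  have n': "norm (t ^ m) = t ^ m" for m using assms by simp
  have "(\<lambda>M. \<Sum>i\<le>M. Li_coeff (zword ks) i * t ^ i * t ^ (M - i)) sums (Li (zword ks) t * suminf (\<lambda>m. t ^ m))"
    unfolding Li_def using assms
    by (intro Cauchy_product_sums) (simp_all only: n n' summable_Li_coeff, simp_all add: summable_geometric)
  moreover have "(\<Sum>i\<le>M. Li_coeff (zword ks) i * t ^ i * t ^ (M - i)) = mhs ks M * t ^ M" for M
    unfolding sum_Li_coeff_zword[OF assms(1), symmetric] sum_distrib_right
    by (intro sum.cong refl) (simp add: mult.assoc flip: power_add)
  ultimately show ?thesis using assms by (simp add: suminf_geometric)
qed

text \<open>An Abelian theorem: the weights \<open>(1 - t) t\<^sup>M\<close> have total mass 1 and escape to infinity as \<open>t\<close> tends to 1.\<close>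

lemma abel_null:
  fixes d :: "nat \<Rightarrow> real"
  assumes d: "d \<longlonglongrightarrow> 0" and s: "\<And>t. 0 \<le> t \<Longrightarrow> t < 1 \<Longrightarrow> (\<lambda>M. d M * t ^ M) sums (S t / (1 - t))"
  shows "(S \<longlongrightarrow> 0) (at_left 1)"
proof (rule tendstoI)
  fix e :: real assume e: "0 < e"
  obtain N where N: "\<And>M. N \<le> M \<Longrightarrow> norm (d M) < e / 2"
    using LIMSEQ_D[OF d, of "e / 2"] e by auto
  define B where "B = (\<Sum>M<N. norm (d M))"
  have bound: "norm (S t) \<le> (1 - t) * B + e / 2" if t: "0 \<le> t" "t < 1" for t
  proof -
    have "(\<lambda>M. if M \<in> {..<N} then norm (d M) else 0) sums B" unfolding B_def by (rule sums_If_finite_set) simp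
    moreover have "(\<lambda>M. e / 2 * t ^ M) sums (e / 2 * (1 / (1 - t)))"
      using t by (intro sums_mult geometric_sums) simp
    ultimately have s2: "(\<lambda>M. (if M \<in> {..<N} then norm (d M) else 0) + e / 2 * t ^ M) sums (B + e / 2 * (1 / (1 - t)))"
      by (rule sums_add)
    have le: "norm (d M * t ^ M) \<le> (if M \<in> {..<N} then norm (d M) else 0) + e / 2 * t ^ M" for M
    proof (cases "M < N")
      case True
      have "norm (d M * t ^ M) \<le> norm (d M) * 1"
        unfolding norm_mult using t by (intro mult_left_mono) (auto simp: power_le_one)
      then show ?thesis using True e t by (simp add: add_increasing2)
    next
      case False
      have "norm (d M * t ^ M) \<le> e / 2 * t ^ M"
        unfolding norm_mult using t N[of M] False by (intro mult_mono) auto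
      then show ?thesis using False by simp
    qed
    have "S t / (1 - t) \<le> B + e / 2 * (1 / (1 - t))"
      by (rule sums_le[OF _ s[OF t] s2]) (use le in \<open>simp add: abs_le_iff\<close>)
    moreover have "- (S t / (1 - t)) \<le> B + e / 2 * (1 / (1 - t))"
      by (rule sums_le[OF _ sums_minus[OF s[OF t]] s2]) (use le in \<open>simp add: abs_le_iff\<close>)
    ultimately have "\<bar>S t / (1 - t)\<bar> \<le> B + e / 2 * (1 / (1 - t))" by (intro abs_leI)
    then have "\<bar>S t / (1 - t)\<bar> * (1 - t) \<le> (B + e / 2 * (1 / (1 - t))) * (1 - t)"
      using t by (intro mult_right_mono) auto
    moreover have "\<bar>S t / (1 - t)\<bar> * (1 - t) = \<bar>S t\<bar>" using t by (simp add: abs_divide)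
    moreover have "(B + e / 2 * (1 / (1 - t))) * (1 - t) = (1 - t) * B + e / 2"
    proof -
      have "1 - t \<noteq> 0" using t by simp
      then have "e / 2 * (1 / (1 - t)) * (1 - t) = e / 2" by (simp only: mult.assoc nonzero_eq_divide_eq[symmetric]) simp
      then show ?thesis unfolding distrib_right by (simp only: mult.commute)
    qed
    ultimately show ?thesis by simp
  qed
  have "((\<lambda>t. (1 - t) * B + e / 2) \<longlongrightarrow> (1 - 1) * B + e / 2) (at_left 1)" by (intro tendsto_intros)
  then have "\<forall>\<^sub>F t in at_left 1. (1 - t) * B + e / 2 < e"
    by (rule order_tendstoD(2)) (use e in simp)
  then show "\<forall>\<^sub>F t in at_left 1. dist (S t) 0 < e"
    using eventually_unit by eventually_elim (use bound in \<open>simp add: dist_norm, force\<close>)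
qed

text \<open>The indices in the \<open>i\<close>-th harmonic power of \<open>y\<close>.\<close>

fun harmonic_power_words :: "nat \<Rightarrow> nat list list" where
  "harmonic_power_words 0 = [[]]"
| "harmonic_power_words (Suc i) = concat (map (stuffle [1]) (harmonic_power_words i))"

lemma harmonic_power_words_pos: "v \<in> set (harmonic_power_words i) \<Longrightarrow> positive_index v"
  by (induction i arbitrary: v) (auto dest: in_stuffle_positive_index[of _ "[Suc 0]", simplified])

lemma harmonic_power_words_sum: "v \<in> set (harmonic_power_words i) \<Longrightarrow> sum_list v = i"
  by (induction i arbitrary: v) (auto dest!: in_stuffle_sum)

lemma sum_list_concat_map: "(\<Sum>x\<leftarrow>concat (map g L). f x) = (\<Sum>y\<leftarrow>L. \<Sum>x\<leftarrow>g y. f x)"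
  by (induction L) simp_all

lemma mhs_harmonic_power_words: "harmonic_number M ^ i = (\<Sum>v\<leftarrow>harmonic_power_words i. mhs v M)"
proof (induction i)
  case (Suc i)
  show ?case
    by (simp only: power_Suc Suc harmonic_power_words.simps sum_list_concat_map mhs_stuffle[symmetric] sum_list_const_mult)
qed simp

text \<open>The asymptotic polynomial, near 1, of \<open>1 - t\<close> times the generating function of the \<open>i\<close>-th powers of the harmonic numbers.\<close>

definition scale_change :: "nat \<Rightarrow> real poly" where
  "scale_change i = (\<Sum>v\<leftarrow>harmonic_power_words i. shuffle_poly (zword v))"

text \<open>The truncated sums differ from their polynomial in the harmonic number by a null sequence, which by \<open>abel_null\<close> does not contribute
to \<open>Li\<close> near 1. Each power of the harmonic number is a sum of truncated sums and contributes \<open>scale_change i\<close>.\<close>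

lemma shuffle_poly_eq_harmonic_poly:
  assumes "positive_index ks"
  shows "shuffle_poly (zword ks) = (\<Sum>i\<le>degree (harmonic_poly ks). smult (coeff (harmonic_poly ks) i) (scale_change i))"
    (is "_ = ?R")
proof -
  let ?P = "harmonic_poly ks" and ?n = "degree (harmonic_poly ks)"
  \<comment> \<open>Up to the factor \<open>1 - t\<close>, the generating function of the errors \<open>mhs ks M - poly ?P (harmonic_number M)\<close>.\<close>
  let ?D = "\<lambda>t. Li (zword ks) t - (\<Sum>i\<le>?n. coeff ?P i * (\<Sum>v\<leftarrow>harmonic_power_words i. Li (zword v) t))"
  have "poly_asymp (at_left 1) Li_y ?D (shuffle_poly (zword ks) - ?R)"
    unfolding scale_change_def using harmonic_power_words_pos
    by (intro poly_asymp_diff poly_asymp_sum poly_asymp_cmult poly_asymp_sum_list poly_asymp_shuffle_poly) auto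
  then have 1: "((\<lambda>t. ?D t - poly (shuffle_poly (zword ks) - ?R) (Li_y t)) \<longlongrightarrow> 0) (at_left 1)"
    unfolding poly_asymp_def by (rule negligible_tendsto)
  have 2: "(?D \<longlongrightarrow> 0) (at_left 1)"
  proof (rule abel_null)
    show "(\<lambda>M. mhs ks M - poly ?P (harmonic_number M)) \<longlonglongrightarrow> 0"
      using poly_asymp_harmonic_poly[OF assms] unfolding poly_asymp_def by (rule negligible_tendsto)
    fix t :: real assume t: "0 \<le> t" "t < 1"
    have "(\<lambda>M. mhs ks M * t ^ M - (\<Sum>i\<le>?n. coeff ?P i * (\<Sum>v\<leftarrow>harmonic_power_words i. mhs v M * t ^ M)))
      sums (Li (zword ks) t / (1 - t) - (\<Sum>i\<le>?n. coeff ?P i * (\<Sum>v\<leftarrow>harmonic_power_words i. Li (zword v) t / (1 - t))))"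
      using t assms harmonic_power_words_pos
      by (intro sums_diff sums_sum sums_mult sums_sum_list Li_zword_mhs) auto
    moreover have "mhs ks M * t ^ M - (\<Sum>i\<le>?n. coeff ?P i * (\<Sum>v\<leftarrow>harmonic_power_words i. mhs v M * t ^ M))
       = (mhs ks M - poly ?P (harmonic_number M)) * t ^ M" for M
      unfolding poly_altdef mhs_harmonic_power_words by (simp add: sum_list_mult_const left_diff_distrib sum_distrib_right mult.assoc)
    moreover have "Li (zword ks) t / (1 - t) - (\<Sum>i\<le>?n. coeff ?P i * (\<Sum>v\<leftarrow>harmonic_power_words i. Li (zword v) t / (1 - t)))
       = ?D t / (1 - t)"
      by (simp add: divide_inverse sum_list_mult_const left_diff_distrib sum_distrib_right mult.assoc)
    ultimately show "(\<lambda>M. (mhs ks M - poly ?P (harmonic_number M)) * t ^ M) sums (?D t / (1 - t))" by simp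
  qed
  have "((\<lambda>t. poly (shuffle_poly (zword ks) - ?R) (Li_y t)) \<longlongrightarrow> 0) (at_left 1)"
    using tendsto_diff[OF 2 1] by simp
  then have "shuffle_poly (zword ks) - ?R = 0" by (rule poly_tendsto_zero[rotated 2]) (simp_all add: Li_y_at_top)
  then show ?thesis by simp
qed

section \<open>Linear extension from words\<close>

definition word_linear :: "(letter list \<Rightarrow> real poly) \<Rightarrow> ncpoly \<Rightarrow> real poly" where
  "word_linear g p = (\<Sum>w\<in>Poly_Mapping.keys p. smult (of_rat (Poly_Mapping.lookup p w)) (g w))"

lemma word_linear_superset:
  assumes "finite A" "Poly_Mapping.keys p \<subseteq> A"
  shows "word_linear g p = (\<Sum>w\<in>A. smult (of_rat (Poly_Mapping.lookup p w)) (g w))"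
  unfolding word_linear_def using assms by (intro sum.mono_neutral_left) (auto simp: in_keys_iff)

lemma word_linear_add: "word_linear g (p + q) = word_linear g p + word_linear g q"
proof -
  let ?A = "Poly_Mapping.keys p \<union> Poly_Mapping.keys q"
  have "word_linear g (p + q) = (\<Sum>w\<in>?A. smult (of_rat (Poly_Mapping.lookup (p + q) w)) (g w))"
    by (rule word_linear_superset) (auto dest: subsetD[OF Poly_Mapping.keys_add])
  also have "\<dots> = word_linear g p + word_linear g q"
    by (simp add: lookup_add of_rat_add smult_add_left sum.distrib word_linear_superset[of ?A])
  finally show ?thesis .
qed

lemma word_linear_0: "word_linear g 0 = 0"
  by (simp add: word_linear_def)

lemma word_linear_single: "word_linear g (Poly_Mapping.single w c) = smult (of_rat c) (g w)"
  by (simp add: word_linear_def)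

lemma word_linear_sum: "word_linear g (sum f A) = (\<Sum>a\<in>A. word_linear g (f a))"
  by (induction A rule: infinite_finite_induct) (simp_all add: word_linear_0 word_linear_add)

lemma ncpoly_expand: "p = (\<Sum>w\<in>Poly_Mapping.keys p. Poly_Mapping.single w (Poly_Mapping.lookup p w))"
proof (rule poly_mapping_eqI)
  fix k
  show "Poly_Mapping.lookup p k
      = Poly_Mapping.lookup (\<Sum>w\<in>Poly_Mapping.keys p. Poly_Mapping.single w (Poly_Mapping.lookup p w)) k"
    by (simp add: lookup_sum lookup_single when_def in_keys_iff)
qed

lemma single_mult_expand:
  fixes p :: ncpoly
  shows "Poly_Mapping.single u c * p
    = (\<Sum>w\<in>Poly_Mapping.keys p. Poly_Mapping.single (u @ w) (c * Poly_Mapping.lookup p w))"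
  by (subst ncpoly_expand[of p]) (simp add: sum_distrib_left mult_single plus_list_def)

lemma word_linear_word_mult: "word_linear g (nc_word u * p) = word_linear (\<lambda>w. g (u @ w)) p"
  by (simp add: single_mult_expand word_linear_sum word_linear_single) (simp add: word_linear_def)

lemma smult_sum_right: "smult c (sum f A) = (\<Sum>a\<in>A. smult c (f a))"
  by (induction A rule: infinite_finite_induct) (simp_all add: smult_add_right)

lemma word_linear_const_mult: "word_linear g (nc_const c * p) = smult (of_rat c) (word_linear g p)"
  by (simp add: single_mult_expand word_linear_sum word_linear_single zero_list_def)
     (simp add: word_linear_def of_rat_mult smult_sum_right)

lemma word_linear_bilinear_ext:
  assumes "\<And>u v. u \<in> Poly_Mapping.keys p \<Longrightarrow> v \<in> Poly_Mapping.keys q \<Longrightarrow> word_linear g (f u v) = g u * g v"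
  shows "word_linear g (bilinear_ext f p q) = word_linear g p * word_linear g q"
proof -
  have "word_linear g (bilinear_ext f p q) = (\<Sum>u\<in>Poly_Mapping.keys p. \<Sum>v\<in>Poly_Mapping.keys q.
      smult (of_rat (Poly_Mapping.lookup p u)) (g u) * smult (of_rat (Poly_Mapping.lookup q v)) (g v))"
    unfolding bilinear_ext_def word_linear_sum word_linear_const_mult
    by (intro sum.cong refl) (simp add: assms of_rat_mult mult.commute)
  then show ?thesis by (simp add: word_linear_def sum_product)
qed

lemma word_linear_shuffle_word: "word_linear g (shuffle_word u v) = (\<Sum>w\<leftarrow>shuffle_list u v. g w)"
  by (induction u v arbitrary: g rule: shuffle_list.induct) (simp_all add: word_linear_single word_linear_add word_linear_word_mult o_def)

lemma nc_zs_zword: "nc_zs ks = nc_word (zword ks)"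
  by (simp add: nc_zs_eq_word zword_def)

lemma word_linear_harmonic_index: "word_linear g (harmonic_index u v) = (\<Sum>w\<leftarrow>stuffle u v. g (zword w))"
  by (induction u v arbitrary: g rule: stuffle.induct)
     (simp_all add: word_linear_single word_linear_add word_linear_word_mult o_def nc_zs_zword nc_z_eq_word)

lemma keys_word_mult: "Poly_Mapping.keys (nc_word u * p) \<subseteq> (@) u ` Poly_Mapping.keys p"
  using Poly_Mapping.keys_mult[of "nc_word u" p] by (auto simp: plus_list_def)

lemma keys_add_subset: "Poly_Mapping.keys p \<subseteq> A \<Longrightarrow> Poly_Mapping.keys q \<subseteq> A \<Longrightarrow> Poly_Mapping.keys (p + q) \<subseteq> A"
  using Poly_Mapping.keys_add[of p q] by blast

lemma keys_add_Un: "Poly_Mapping.keys p \<subseteq> A \<Longrightarrow> Poly_Mapping.keys q \<subseteq> B \<Longrightarrow> Poly_Mapping.keys (p + q) \<subseteq> A \<union> B"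
  using Poly_Mapping.keys_add[of p q] by blast

lemma keys_shuffle_word: "Poly_Mapping.keys (shuffle_word u v) \<subseteq> set (shuffle_list u v)"
proof (induction u v rule: shuffle_list.induct)
  case (3 a u b v)
  have *: "Poly_Mapping.keys (nc_word [c] * p) \<subseteq> (#) c ` A" if "Poly_Mapping.keys p \<subseteq> A" for c p A
    using keys_word_mult[of "[c]" p] image_mono[OF that, of "(#) c"] by simp
  show ?case
    using keys_add_Un[OF *[OF "3"(1), of a] *[OF "3"(2), of b]] by simp
qed auto

lemma keys_harmonic_index: "Poly_Mapping.keys (harmonic_index u v) \<subseteq> zword ` set (stuffle u v)"
proof (induction u v rule: stuffle.induct)
  case (3 k u l v)
  have *: "Poly_Mapping.keys (nc_z m * p) \<subseteq> zword ` (#) m ` A" if "Poly_Mapping.keys p \<subseteq> zword ` A" for m p A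
  proof -
    have "Poly_Mapping.keys (nc_z m * p) \<subseteq> (@) (replicate (m - 1) LX @ [LY]) ` Poly_Mapping.keys p"
      unfolding nc_z_eq_word by (rule keys_word_mult)
    also have "\<dots> \<subseteq> (@) (replicate (m - 1) LX @ [LY]) ` zword ` A" using that by (rule image_mono)
    also have "\<dots> = zword ` (#) m ` A" by (simp add: image_image)
    finally show ?thesis .
  qed
  show ?case
    using keys_add_Un[OF keys_add_Un[OF *[OF "3"(1), of k] *[OF "3"(2), of l]] *[OF "3"(3), of "k + l"]]
    by (simp only: harmonic_index.simps stuffle.simps set_append set_map image_Un Un_assoc)
qed (auto simp: nc_zs_zword)

text \<open>This turns membership in \<open>H1\<close> into a condition on single words.\<close>

lemma H1_iff: "p \<in> H1 \<longleftrightarrow> (\<forall>w\<in>Poly_Mapping.keys p. H1_word w)"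
proof
  assume "p \<in> H1"
  then obtain c q where p: "p = nc_const c + q * nc_y" by (auto simp: H1_def)
  have "Poly_Mapping.keys p \<subseteq> Collect H1_word" unfolding p
    using Poly_Mapping.keys_mult[of q nc_y]
    by (intro keys_add_subset) (auto simp: H1_word_def nc_y_def plus_list_def zero_list_def split: if_splits)
  then show "\<forall>w\<in>Poly_Mapping.keys p. H1_word w" by auto
next
  assume H: "\<forall>w\<in>Poly_Mapping.keys p. H1_word w"
  have "(\<Sum>w\<in>A. Poly_Mapping.single w (Poly_Mapping.lookup p w)) \<in> H1" if "finite A" "\<forall>w\<in>A. H1_word w" for A
    using that
  proof (induction A rule: finite_induct)
    case empty
    have "(0 :: ncpoly) = nc_const 0 + 0 * nc_y" by simp
    then show ?case unfolding H1_def sum.empty by blast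
  next
    case (insert w A)
    then obtain c q where q: "(\<Sum>w\<in>A. Poly_Mapping.single w (Poly_Mapping.lookup p w)) = nc_const c + q * nc_y"
      by (auto simp: H1_def)
    let ?s = "Poly_Mapping.single w (Poly_Mapping.lookup p w)"
    have "\<exists>c' q'. ?s = nc_const c' + q' * nc_y"
    proof (cases "w = []")
      case True
      then show ?thesis by (intro exI[of _ "Poly_Mapping.lookup p w"] exI[of _ 0]) (simp add: zero_list_def)
    next
      case False
      then have "w = butlast w @ [LY]" using insert by (auto simp: H1_word_def) (metis append_butlast_last_id)
      then have "?s = nc_const 0 + Poly_Mapping.single (butlast w) (Poly_Mapping.lookup p w) * nc_y"
        by (simp add: nc_y_def mult_single plus_list_def)
      then show ?thesis by blast
    qed
    then obtain c' q' where "?s = nc_const c' + q' * nc_y" by blast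
    then have "(\<Sum>w\<in>insert w A. Poly_Mapping.single w (Poly_Mapping.lookup p w))
        = nc_const (c' + c) + (q' + q) * nc_y"
      using insert q by (simp add: single_add algebra_simps)
    then show ?case unfolding H1_def by blast
  qed
  from this[of "Poly_Mapping.keys p"] show "p \<in> H1" using H ncpoly_expand[of p] by simp
qed

lemma nc_word_in_H1 [simp]: "nc_word w \<in> H1 \<longleftrightarrow> H1_word w"
  by (simp add: H1_iff)

lemma H1_add: "p \<in> H1 \<Longrightarrow> q \<in> H1 \<Longrightarrow> p + q \<in> H1"
  using keys_add_subset[of p "Collect H1_word" q] by (auto simp: H1_iff)

lemma H1_const_mult: "p \<in> H1 \<Longrightarrow> nc_const c * p \<in> H1"
  using Poly_Mapping.keys_mult[of "nc_const c" p] by (fastforce simp: H1_iff zero_list_def plus_list_def split: if_splits)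

lemma H1_zero: "0 \<in> H1" by (simp add: H1_iff)

lemma H1_sum: "(\<And>a. a \<in> A \<Longrightarrow> f a \<in> H1) \<Longrightarrow> sum f A \<in> H1"
  by (induction A rule: infinite_finite_induct) (auto intro: H1_add H1_zero)

lemma H0_keys:
  assumes "p \<in> H0" "w \<in> Poly_Mapping.keys p"
  shows "H1_word w \<and> leading LY w = 0"
proof -
  obtain c q where p: "p = nc_const c + nc_x * q * nc_y" using assms by (auto simp: H0_def)
  have "Poly_Mapping.keys p \<subseteq> {w. H1_word w \<and> leading LY w = 0}" unfolding p
  proof (rule keys_add_subset)
    show "Poly_Mapping.keys (nc_const c) \<subseteq> {w. H1_word w \<and> leading LY w = 0}"
      by (auto simp: H1_word_def zero_list_def)
    show "Poly_Mapping.keys (nc_x * q * nc_y) \<subseteq> {w. H1_word w \<and> leading LY w = 0}"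
      using Poly_Mapping.keys_mult[of "nc_x * q" nc_y] keys_word_mult[of "[LX]" q]
      by (fastforce simp: H1_word_def nc_y_def nc_x_def plus_list_def)
  qed
  then show ?thesis using assms(2) by auto
qed

lemma word_in_H0:
  assumes "H1_word w" "leading LY w = 0"
  shows "nc_word w \<in> H0"
proof (cases "w = []")
  case True
  have "nc_word [] = nc_const 1 + nc_x * 0 * nc_y" by (simp add: zero_list_def)
  then show ?thesis using True unfolding H0_def by blast
next
  case False
  then obtain v where v: "w = LX # v" using assms(2) by (cases w; cases "hd w") auto
  then have "v \<noteq> []" "last v = LY" using assms(1) by (auto simp: H1_word_def split: if_splits)
  then have "w = [LX] @ butlast v @ [LY]" using v by (simp, metis append_butlast_last_id)
  then have "nc_word w = nc_const 0 + nc_x * nc_word (butlast v) * nc_y"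
    by (simp add: nc_x_def nc_y_def nc_word_mult)
  then show ?thesis unfolding H0_def by blast
qed

section \<open>The regularization homomorphisms\<close>

text \<open>A function \<open>g\<close> on words that satisfies the conditions word by word extends linearly to a homomorphism. A second homomorphism
agrees with it on words by induction on the number of leading letters \<open>y\<close>: \<open>split\<close> expresses \<open>LY # v\<close> by the product of \<open>y\<close> and \<open>v\<close>
and by words with fewer leading letters \<open>y\<close>, down to words in \<open>H0\<close>.\<close>

lemma reg_hom_eq_word_linear:
  fixes g :: "letter list \<Rightarrow> real poly" and f :: "letter list \<Rightarrow> letter list \<Rightarrow> ncpoly"
  assumes one: "g [] = 1" and y: "g [LY] = [:0, 1:]"
    and mult: "\<And>u v. H1_word u \<Longrightarrow> H1_word v \<Longrightarrow> word_linear g (f u v) = g u * g v"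
    and closed: "\<And>u v. H1_word u \<Longrightarrow> H1_word v \<Longrightarrow> f u v \<in> H1"
    and adm: "\<And>w. H1_word w \<Longrightarrow> leading LY w = 0 \<Longrightarrow> g w = [:mzv (z_index w):]"
    and split: "\<And>v. H1_word v \<Longrightarrow> \<exists>n T. (\<forall>g'. word_linear g' (f [LY] v) = of_nat (Suc n) * g' (LY # v) + (\<Sum>w\<leftarrow>T. g' w)) \<and>
        (\<forall>w\<in>set T. H1_word w \<and> leading LY w \<le> leading LY v)"
    and p: "p \<in> H1"
  shows "reg_hom (bilinear_ext f) p = word_linear g p"
proof -
  let ?\<phi> = "restrict (word_linear g) H1"
  let ?C = "\<lambda>\<phi>. alg_hom_H1 (bilinear_ext f) \<phi> \<and> (\<forall>p\<in>H0. \<phi> p = [:Z_eval p:]) \<and> \<phi> nc_y = [:0, 1:]"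
  have H0H1: "p \<in> H1" if "p \<in> H0" for p using H0_keys[OF that] by (simp add: H1_iff)
  have prod_H1: "bilinear_ext f p q \<in> H1" if "p \<in> H1" "q \<in> H1" for p q
    unfolding bilinear_ext_def using that
    by (intro H1_sum H1_const_mult closed) (auto simp: H1_iff)
  have C: "?C ?\<phi>"
  proof (intro conjI ballI)
    show "alg_hom_H1 (bilinear_ext f) ?\<phi>"
      unfolding alg_hom_H1_def
    proof (intro conjI allI ballI)
      show "?\<phi> 1 = 1" by (simp add: one_eq_nc_word H1_word_def word_linear_single one)
      show "?\<phi> (bilinear_ext f p q) = ?\<phi> p * ?\<phi> q" if "p \<in> H1" "q \<in> H1" for p q
        using that prod_H1[OF that] by (simp add: H1_iff[of p] H1_iff[of q] word_linear_bilinear_ext mult)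
    qed (auto simp: word_linear_const_mult H1_const_mult word_linear_add H1_add)
    show "?\<phi> nc_y = [:0, 1:]" by (simp add: nc_y_def H1_word_def word_linear_single y)
    fix p assume p: "p \<in> H0"
    have "word_linear g p = (\<Sum>w\<in>Poly_Mapping.keys p. [:of_rat (Poly_Mapping.lookup p w) * mzv (z_index w):])"
      unfolding word_linear_def using H0_keys[OF p] by (intro sum.cong) (auto simp: adm)
    also have "\<dots> = [:Z_eval p:]"
    proof -
      have "(\<Sum>w\<in>A. [:h w:]) = [:\<Sum>w\<in>A. h w:]" for A and h :: "letter list \<Rightarrow> real"
        by (induction A rule: infinite_finite_induct) simp_all
      then show ?thesis by (simp add: Z_eval_def)
    qed
    finally show "?\<phi> p = [:Z_eval p:]" using H0H1[OF p] by simp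
  qed
  have unique: "\<phi> = ?\<phi>" if \<phi>: "?C \<phi>" for \<phi>
  proof -
    have add: "\<phi> (p + q) = \<phi> p + \<phi> q" if "p \<in> H1" "q \<in> H1" for p q
      using \<phi> that by (simp add: alg_hom_H1_def)
    have scale: "\<phi> (nc_const c * p) = smult (of_rat c) (\<phi> p)" if "p \<in> H1" for c p
      using \<phi> that by (simp add: alg_hom_H1_def)
    have prod: "\<phi> (bilinear_ext f p q) = \<phi> p * \<phi> q" if "p \<in> H1" "q \<in> H1" for p q
      using \<phi> that by (simp add: alg_hom_H1_def)
    have zero: "\<phi> 0 = 0" using scale[OF H1_zero, of 0] by simp
    have single: "\<phi> (Poly_Mapping.single w c) = smult (of_rat c) (\<phi> (nc_word w))" if "H1_word w" for w c
      using scale[of "nc_word w" c] that by (simp add: mult_single)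
    have "\<phi> (\<Sum>w\<in>A. Poly_Mapping.single w (c w)) = (\<Sum>w\<in>A. smult (of_rat (c w)) (\<phi> (nc_word w)))"
      if "finite A" "\<forall>w\<in>A. H1_word w" for A and c :: "letter list \<Rightarrow> rat"
      using that
    proof (induction A rule: finite_induct)
      case (insert w A)
      have "(\<Sum>w\<in>A. Poly_Mapping.single w (c w)) \<in> H1"
        by (rule H1_sum) (use insert in \<open>auto simp: H1_iff split: if_splits\<close>)
      moreover have "Poly_Mapping.single w (c w) \<in> H1" using insert by (simp add: H1_iff)
      ultimately show ?case using insert by (simp add: add single[of w "c w"])
    qed (simp add: zero)
    then have word_linear: "\<phi> p = word_linear (\<lambda>w. \<phi> (nc_word w)) p" if "p \<in> H1" for p
      using that ncpoly_expand[of p] unfolding word_linear_def by (metis (no_types) H1_iff finite_keys)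
    have word: "\<phi> (nc_word w) = g w" if "H1_word w" for w
      using that
    proof (induction "leading LY w" arbitrary: w rule: less_induct)
      case less
      show ?case
      proof (cases "leading LY w = 0")
        case True
        then show ?thesis using \<phi> word_in_H0[OF less(2) True] adm[OF less(2) True] by (simp add: Z_eval_def)
      next
        case False
        then obtain v where w: "w = LY # v" by (cases w) (auto split: if_splits)
        have v: "H1_word v" using less w H1_word_Cons by blast
        obtain n T where T: "\<And>g'. word_linear g' (f [LY] v) = of_nat (Suc n) * g' (LY # v) + (\<Sum>w\<leftarrow>T. g' w)"
            "\<And>w. w \<in> set T \<Longrightarrow> H1_word w \<and> leading LY w \<le> leading LY v" using split[OF v] by blast
        have y1: "H1_word [LY]" by (simp add: H1_word_def)
        have gv: "\<phi> (nc_word v) = g v" using less(1)[OF _ v] w by simp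
        have "\<phi> (f [LY] v) = \<phi> (bilinear_ext f nc_y (nc_word v))"
          by (simp add: bilinear_ext_def nc_y_def)
        also have "\<dots> = g [LY] * g v" using prod[of nc_y "nc_word v"] \<phi> v y1 gv y by (simp add: nc_y_def)
        also have "\<dots> = word_linear g (f [LY] v)" using mult[OF y1 v] by simp
        finally have "word_linear (\<lambda>w. \<phi> (nc_word w)) (f [LY] v) = word_linear g (f [LY] v)"
          using word_linear[OF closed[OF y1 v]] by simp
        moreover have "(\<Sum>w\<leftarrow>T. \<phi> (nc_word w)) = (\<Sum>w\<leftarrow>T. g w)"
          by (intro arg_cong[where f = sum_list] map_cong refl less(1)) (use T(2) w in \<open>auto simp: less_Suc_eq_le\<close>)
        ultimately have "of_nat (Suc n) * \<phi> (nc_word w) = of_nat (Suc n) * g w"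
          unfolding T(1) w by simp
        then show ?thesis by (simp del: of_nat_Suc)
      qed
    qed
    show ?thesis
    proof
      fix p show "\<phi> p = ?\<phi> p"
      proof (cases "p \<in> H1")
        case True
        then show ?thesis using word_linear[OF True] unfolding word_linear_def by (auto simp: H1_iff word intro!: sum.cong)
      next
        case False
        then show ?thesis using \<phi> by (auto simp: alg_hom_H1_def extensional_def)
      qed
    qed
  qed
  have "reg_hom (bilinear_ext f) = ?\<phi>"
    unfolding reg_hom_def by (rule the_equality[where P = ?C], rule C, rule unique)
  then show ?thesis using p by simp
qed

lemma z_index_admissible:
  assumes "H1_word w" "leading LY w = 0" "w \<noteq> []"
  obtains k ks where "w = zword (k # ks)" "z_index w = k # ks" "2 \<le> k" "positive_index ks"
proof -
  have "zword (z_index w) = w" by (rule zword_z_index[OF assms(1)])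
  moreover from this have "z_index w \<noteq> []" using assms(3) by auto
  ultimately obtain k ks where "z_index w = k # ks" "2 \<le> k" "\<forall>k\<in>set ks. 1 \<le> k"
    using leading_zword[OF z_index_pos, of w] assms(2) by metis
  then show ?thesis using that \<open>zword (z_index w) = w\<close> by (auto simp: positive_index_def)
qed

lemma z_index_Nil [simp]: "z_index [] = []" by (simp add: z_index_def)

lemma zeta_shuffle_eq:
  shows "zeta_shuffle ks = poly (shuffle_poly (zword ks)) 0"
proof -
  have "reg_hom (bilinear_ext shuffle_word) (nc_zs ks) = word_linear shuffle_poly (nc_zs ks)"
  proof (rule reg_hom_eq_word_linear)
    show "word_linear shuffle_poly (shuffle_word u v) = shuffle_poly u * shuffle_poly v" if "H1_word u" "H1_word v" for u v
      using that by (simp add: word_linear_shuffle_word shuffle_poly_shuffle_list)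
    show "shuffle_word u v \<in> H1" if "H1_word u" "H1_word v" for u v
      using keys_shuffle_word[of u v] in_shuffle_list_H1_word[of _ u v] that by (auto simp: H1_iff)
    show "shuffle_poly w = [:mzv (z_index w):]" if "H1_word w" "leading LY w = 0" for w
    proof (cases "w = []")
      case False
      then show ?thesis using z_index_admissible[OF that False] shuffle_poly_admissible by metis
    qed (simp add: shuffle_poly_Nil mzv_Nil one_pCons)
    show "\<exists>n T. (\<forall>g'. word_linear g' (shuffle_word [LY] v) = of_nat (Suc n) * g' (LY # v) + (\<Sum>w\<leftarrow>T. g' w)) \<and>
        (\<forall>w\<in>set T. H1_word w \<and> leading LY w \<le> leading LY v)" if v: "H1_word v" for v
    proof -
      obtain T where T: "mset (shuffle_list [LY] v) = replicate_mset (Suc (leading LY v)) (LY # v) + mset T"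
          "\<forall>w\<in>set T. leading LY w \<le> leading LY v" using shuffle_list_leading[of LY v] by blast
      have "set T \<subseteq> set (shuffle_list [LY] v)" using arg_cong[OF T(1), of set_mset] by auto
      then have "\<forall>w\<in>set T. H1_word w" using in_shuffle_list_H1_word[of _ "[LY]" v] v by (auto simp: H1_word_def)
      then show ?thesis using T(2) unfolding word_linear_shuffle_word sum_list_split[OF T(1)] by blast
    qed
  qed (simp_all add: shuffle_poly_Nil shuffle_poly_LY nc_zs_zword)
  then show ?thesis by (simp add: zeta_shuffle_def shuffle_def nc_zs_zword word_linear_single)
qed

lemma leading_LY_zword: "positive_index ks \<Longrightarrow> leading LY (zword ks) = leading 1 ks"
proof (induction ks)
  case (Cons k ks)
  then show ?case by (cases "k - 1") auto
qed simp

lemma zeta_harmonic_eq: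
  assumes "positive_index ks"
  shows "zeta_harmonic ks = poly (harmonic_poly ks) 0"
proof -
  have zp: "positive_index (z_index w)" for w using z_index_pos by (simp add: positive_index_def)
  have zz: "z_index (zword ks) = ks" if "positive_index ks" for ks using that z_index_zword by (simp add: positive_index_def)
  have z1: "z_index [LY] = [1]" by (simp add: z_index_def)
  let ?g = "\<lambda>w. harmonic_poly (z_index w)"
  let ?f = "\<lambda>u v. harmonic_index (z_index u) (z_index v)"
  have "reg_hom (bilinear_ext ?f) (nc_zs ks) = word_linear ?g (nc_zs ks)"
  proof (rule reg_hom_eq_word_linear)
    show "word_linear ?g (?f u v) = ?g u * ?g v" for u v
    proof -
      have "word_linear ?g (?f u v) = (\<Sum>w\<leftarrow>stuffle (z_index u) (z_index v). harmonic_poly w)"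
        unfolding word_linear_harmonic_index
        by (intro arg_cong[where f = sum_list] map_cong refl) (simp add: zz in_stuffle_positive_index[OF _ zp zp])
      then show ?thesis by (simp add: harmonic_poly_stuffle zp)
    qed
    show "?f u v \<in> H1" for u v
      using keys_harmonic_index[of "z_index u" "z_index v"] by (auto simp: H1_iff)
    show "?g w = [:mzv (z_index w):]" if "H1_word w" "leading LY w = 0" for w
    proof (cases "w = []")
      case False
      then show ?thesis using z_index_admissible[OF that False] harmonic_poly_admissible by metis
    qed (simp add: harmonic_poly_Nil mzv_Nil one_pCons)
    show "\<exists>n T. (\<forall>g'. word_linear g' (?f [LY] v) = of_nat (Suc n) * g' (LY # v) + (\<Sum>w\<leftarrow>T. g' w)) \<and>
        (\<forall>w\<in>set T. H1_word w \<and> leading LY w \<le> leading LY v)" if v: "H1_word v" for v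
    proof -
      let ?v = "z_index v"
      obtain T where T: "mset (stuffle [1] ?v) = replicate_mset (Suc (leading 1 ?v)) (1 # ?v) + mset T"
          "\<forall>w\<in>set T. leading 1 w \<le> leading 1 ?v" using stuffle_leading[OF z_index_pos] by blast
      have "set T \<subseteq> set (stuffle [1] ?v)" using arg_cong[OF T(1), of set_mset] by auto
      then have "\<forall>w\<in>set T. positive_index w" using in_stuffle_positive_index[of _ "[1]" ?v] zp by auto
      moreover have "leading LY v = leading 1 ?v" using leading_LY_zword[OF zp, of v] zword_z_index[OF v] by simp
      ultimately have 1: "\<forall>w\<in>set (map zword T). H1_word w \<and> leading LY w \<le> leading LY v"
        using T(2) by (auto simp: leading_LY_zword)
      have 2: "word_linear g' (?f [LY] v) = of_nat (Suc (leading 1 ?v)) * g' (LY # v) + (\<Sum>w\<leftarrow>map zword T. g' w)" for g'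
        unfolding word_linear_harmonic_index z1 sum_list_split[OF T(1)] by (simp add: zword_z_index[OF v] o_def)
      show ?thesis using 1 2 by blast
    qed
  qed (simp_all add: harmonic_poly_Nil harmonic_poly_1 z1 nc_zs_zword del: One_nat_def)
  then show ?thesis by (simp add: zeta_harmonic_def harmonic_def nc_zs_zword word_linear_single zz assms)
qed

section \<open>Rational spans of multiple zeta values\<close>

abbreviation rscale :: "rat \<Rightarrow> real \<Rightarrow> real" where "rscale q r \<equiv> of_rat q * r"

interpretation Q: vector_space rscale by (rule vector_space_rat_real)
interpretation QQ: vector_space_pair rscale rscale by unfold_locales

text \<open>Extend a basis of \<open>M\<close> together with \<open>a\<close> and prescribe the values on it.\<close>

lemma separating_functional:
  assumes "Q.subspace M" "a \<notin> M"
  obtains \<phi> :: "real \<Rightarrow> real" where "\<And>x y. \<phi> (x + y) = \<phi> x + \<phi> y" "\<And>x. x \<in> M \<Longrightarrow> \<phi> x = 0" "\<phi> a \<noteq> 0"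
proof -
  obtain B where B: "B \<subseteq> M" "Q.independent B" "M \<subseteq> Q.span B" by (rule Q.basis_exists) blast
  have "Q.span B \<subseteq> M" using B(1) assms(1) by (rule Q.span_minimal)
  then have a: "a \<notin> Q.span B" using assms(2) by blast
  then have "Q.independent (insert a B)" using B(2) by (simp add: Q.independent_insert)
  then obtain \<phi> where \<phi>: "Vector_Spaces.linear rscale rscale \<phi>" "\<forall>x\<in>insert a B. \<phi> x = (if x = a then 1 else 0)"
    using QQ.linear_independent_extend[of "insert a B" "\<lambda>x. if x = a then 1 else 0"] by blast
  have a': "a \<notin> B" using a Q.span_base by blast
  interpret \<phi>: Vector_Spaces.linear rscale rscale \<phi> by (rule \<phi>(1))
  show ?thesis
  proof
    show "\<phi> (x + y) = \<phi> x + \<phi> y" for x y by (rule \<phi>.add)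
    show "\<phi> a \<noteq> 0" using \<phi>(2) by simp
    show "\<phi> x = 0" if "x \<in> M" for x
      using \<phi>.eq_0_on_span[of B x] \<phi>(2) a' B(3) that by (metis insertCI subsetD)
  qed
qed

lemma in_subspaceI:
  assumes "Q.subspace M"
    and "\<And>\<phi> :: real \<Rightarrow> real. (\<And>x y. \<phi> (x + y) = \<phi> x + \<phi> y) \<Longrightarrow> (\<And>x. x \<in> M \<Longrightarrow> \<phi> x = 0) \<Longrightarrow> \<phi> a = 0"
  shows "a \<in> M"
  using separating_functional[OF assms(1), of a] assms(2) by metis

lemma subspace_rat_span [simp]: "Q.subspace (rat_span S)"
  by (simp add: rat_span_def)

lemma subspace_mzv_space [simp]: "Q.subspace (mzv_space l d)"
  by (simp add: mzv_space_def)

lemma subspace_mzv_prod_space [simp]: "Q.subspace (mzv_prod_space l)"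
  by (simp add: mzv_prod_space_def)

lemma subspace_scale_nat: "Q.subspace V \<Longrightarrow> x \<in> V \<Longrightarrow> 1 / real n * x \<in> V"
  using Q.subspace_scale[of V x "1 / of_nat n"] by (simp add: of_rat_divide)

lemma subspace_sum_list: "Q.subspace V \<Longrightarrow> (\<And>w. w \<in> set T \<Longrightarrow> f w \<in> V) \<Longrightarrow> (\<Sum>w\<leftarrow>T. f w) \<in> V"
  by (induction T) (auto intro: Q.subspace_add Q.subspace_0)

lemma coeff_sum_list: "coeff (\<Sum>w\<leftarrow>T. f w) i = (\<Sum>w\<leftarrow>T. coeff (f w) i)"
  by (induction T) simp_all

lemma length_zword: "positive_index ks \<Longrightarrow> length (zword ks) = sum_list ks"
  by (induction ks) auto

lemma count_zword: "count (mset (zword ks)) LY = length ks"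
  by (induction ks) auto

lemma mzv_in_mzv_space: "positive_index ks \<Longrightarrow> 2 \<le> k \<Longrightarrow> mzv (k # ks) \<in> mzv_space (k + sum_list ks) (Suc (length ks))"
  unfolding mzv_space_def rat_span_def
  by (rule Q.span_base) (auto simp: admissible_def positive_index_def intro!: exI[of _ "k # ks"])

text \<open>The shuffle product preserves length and number of letters \<open>y\<close>, so shuffle regularization never leaves weight and depth.
The summand \<open>T\<close> times a polynomial in the recursion has no constant term.\<close>

lemma shuffle_const_in_mzv_space:
  assumes "H1_word w" "w \<noteq> []"
  shows "coeff (shuffle_poly w) 0 \<in> mzv_space (length w) (count (mset w) LY)"
  using assms
proof (induction w rule: H1_word_induct)
  case (base v)
  obtain k ks where v: "v = zword (k # ks)" "2 \<le> k" "positive_index ks"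
    using z_index_admissible[OF base(1,2,3)] by metis
  have "coeff (shuffle_poly v) 0 = mzv (k # ks)" unfolding v(1) by (simp only: shuffle_poly_admissible[OF v(3,2)]) simp
  moreover have "positive_index (k # ks)" using v by simp
  ultimately show ?case using mzv_in_mzv_space[OF v(3,2)]
    unfolding v(1) by (simp only: length_zword count_zword) simp
next
  case (step v T)
  let ?V = "mzv_space (length (LY # v)) (count (mset (LY # v)) LY)"
  have "coeff (shuffle_poly w) 0 \<in> ?V" if "w \<in> set T" for w
  proof -
    have m: "mset w = mset (LY # v)" using in_shuffle_list_mset[of w "[LY]" v] step.hyps(4) that by auto
    then have l: "length w = length (LY # v)" by (metis size_mset)
    have "w \<noteq> []" using m by auto
    from step.IH(2)[OF that this] show ?thesis unfolding l m .
  qed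
  then have "1 / real (Suc (leading LY v)) * (\<Sum>w\<leftarrow>T. coeff (shuffle_poly w) 0) \<in> ?V"
    by (intro subspace_scale_nat subspace_sum_list) auto
  then have "- (1 / real (Suc (leading LY v)) * (\<Sum>w\<leftarrow>T. coeff (shuffle_poly w) 0)) \<in> ?V"
    by (intro Q.subspace_neg) auto
  moreover have "coeff (shuffle_poly (LY # v)) 0 = - (1 / real (Suc (leading LY v)) * (\<Sum>w\<leftarrow>T. coeff (shuffle_poly w) 0))"
    using arg_cong[OF shuffle_poly_step[OF step.hyps(1,2,3)], of "\<lambda>p. coeff p 0"] by (simp add: coeff_sum_list)
  ultimately show ?case by simp
qed

text \<open>Weights are integers, so that coefficients of excessive degree lie in a space of negative weight, which is zero.\<close>

definition weight_space :: "int \<Rightarrow> real set" where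
  "weight_space z = rat_span {mzv ks | ks. (ks = [] \<or> admissible ks) \<and> int (sum_list ks) = z}"

lemma subspace_weight_space [simp]: "Q.subspace (weight_space z)"
  by (simp add: weight_space_def)

lemma mzv_in_weight_space: "ks = [] \<or> admissible ks \<Longrightarrow> int (sum_list ks) = z \<Longrightarrow> mzv ks \<in> weight_space z"
  unfolding weight_space_def rat_span_def by (rule Q.span_base) blast

lemma mzv_space_subset_weight_space: "mzv_space l d \<subseteq> weight_space (int l)"
  unfolding mzv_space_def weight_space_def rat_span_def by (rule Q.span_mono) blast

lemma weight_space_neg: "z < 0 \<Longrightarrow> x \<in> weight_space z \<Longrightarrow> x = 0"
proof -
  assume z: "z < 0" "x \<in> weight_space z"
  have eq: "{mzv ks | ks. (ks = [] \<or> admissible ks) \<and> int (sum_list ks) = z} = {}" using z(1) by auto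
  show ?thesis using z(2) unfolding weight_space_def rat_span_def eq by simp
qed

lemma weight_space_0:
  assumes "x \<in> weight_space 0" obtains q where "x = of_rat q"
proof -
  have "{mzv ks | ks. (ks = [] \<or> admissible ks) \<and> int (sum_list ks) = 0} \<subseteq> {1}"
    by (auto simp: admissible_def mzv_Nil) (metis list.set_sel(1) not_numeral_le_zero)+
  then have "x \<in> Q.span {1}" using assms unfolding weight_space_def rat_span_def
    using Q.span_mono by blast
  then obtain q where "x = of_rat q * 1" unfolding Q.span_singleton by auto
  then show ?thesis using that by simp
qed

text \<open>The variable \<open>T\<close> has weight 1.\<close>

lemma harmonic_coeff_in_weight_space:
  assumes "positive_index ks"
  shows "coeff (harmonic_poly ks) i \<in> weight_space (int (sum_list ks) - int i)"
  using assms
proof (induction ks arbitrary: i rule: positive_index_induct)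
  case (base v)
  show ?case
  proof (cases "v = []")
    case True
    then show ?thesis using mzv_in_weight_space[of "[]" 0]
      by (cases i) (auto simp: harmonic_poly_Nil mzv_Nil Q.subspace_0)
  next
    case False
    then obtain k ks where v: "v = k # ks" "2 \<le> k" "positive_index ks" using leading_1_zero base by metis
    then have "admissible v" by (auto simp: admissible_def positive_index_def)
    then show ?thesis using mzv_in_weight_space[of v "int (sum_list v)"]
      by (cases i) (auto simp: v(1) harmonic_poly_admissible[OF v(3,2)] Q.subspace_0)
  qed
next
  case (step v T)
  let ?V = "weight_space (int (sum_list (1 # v)) - int i)"
  have "coeff (harmonic_poly w) i \<in> ?V" if "w \<in> set T" for w
    using step.IH(2)[OF that] in_stuffle_sum[of w "[1]" v] step.hyps(4) that by auto
  then have 1: "(\<Sum>w\<leftarrow>T. coeff (harmonic_poly w) i) \<in> ?V" by (intro subspace_sum_list) auto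
  have 2: "coeff ([:0, 1:] * harmonic_poly v) i \<in> ?V"
  proof (cases i)
    case (Suc j)
    then show ?thesis using step.IH(1)[of j] by simp
  qed (simp add: Q.subspace_0)
  have "1 / real (Suc (leading 1 v)) * (coeff ([:0, 1:] * harmonic_poly v) i - (\<Sum>w\<leftarrow>T. coeff (harmonic_poly w) i)) \<in> ?V"
    using 1 2 by (intro subspace_scale_nat Q.subspace_diff) auto
  then show ?case by (simp only: harmonic_poly_step[OF step.hyps(1,2,3)] coeff_smult coeff_diff coeff_sum_list)
qed

text \<open>Positive weight excludes the empty index, so generators multiply to products of two multiple zeta values.\<close>

lemma weight_space_mult:
  assumes "x \<in> weight_space i" "y \<in> weight_space j" "1 \<le> i" "1 \<le> j"
  shows "x * y \<in> mzv_prod_space (nat (i + j))"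
proof -
  let ?V = "mzv_prod_space (nat (i + j))"
  let ?S = "\<lambda>z. {mzv ks | ks. (ks = [] \<or> admissible ks) \<and> int (sum_list ks) = z}"
  have base: "a * b \<in> ?V" if ab: "a \<in> ?S i" "b \<in> ?S j" for a b
  proof -
    obtain ks where ks: "a = mzv ks" "ks = [] \<or> admissible ks" "int (sum_list ks) = i" using ab by auto
    obtain ls where ls: "b = mzv ls" "ls = [] \<or> admissible ls" "int (sum_list ls) = j" using ab by auto
    have "admissible ks" "admissible ls" using ks ls assms by auto
    then show ?thesis unfolding mzv_prod_space_def rat_span_def
      using ks ls by (intro Q.span_base UnI1) (auto intro!: exI[of _ "[ks, ls]"])
  qed
  have 1: "a * y \<in> ?V" if "a \<in> ?S i" for a
    using assms(2) unfolding weight_space_def rat_span_def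
  proof (induction rule: Q.span_induct)
    case base
    show ?case unfolding Q.subspace_def mem_Collect_eq
    proof (intro conjI ballI allI impI; (unfold mem_Collect_eq)?)
      show "a * rscale c x \<in> ?V" if "a * x \<in> ?V" for c x
        using Q.subspace_scale[OF subspace_mzv_prod_space that, of c] by (simp only: mult.left_commute)
    qed (auto simp: Q.subspace_0 distrib_left intro: Q.subspace_add)
  next
    case (step b)
    then show ?case using base that by blast
  qed
  show ?thesis using assms(1) unfolding weight_space_def rat_span_def
  proof (induction rule: Q.span_induct)
    case base
    show ?case unfolding Q.subspace_def mem_Collect_eq
    proof (intro conjI ballI allI impI; (unfold mem_Collect_eq)?)
      show "rscale c x * y \<in> ?V" if "x * y \<in> ?V" for c x
        using Q.subspace_scale[OF subspace_mzv_prod_space that, of c] by (simp only: mult.assoc)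
    qed (auto simp: Q.subspace_0 distrib_right intro: Q.subspace_add)
  next
    case (step b)
    then show ?case using 1 by blast
  qed
qed

section \<open>Newton's identity and products\<close>

text \<open>The harmonic product of one entry \<open>j\<close> with \<open>m + 1\<close> entries 1 either inserts \<open>j\<close> or adds it to one of the entries 1.\<close>

lemma stuffle_ones:
  fixes f :: "nat list \<Rightarrow> 'b::comm_ring_1"
  defines "ins \<equiv> \<lambda>f j m. (\<Sum>p\<le>m. f (replicate p 1 @ j # replicate (m - p) (1::nat)) :: 'b)"
  shows "(\<Sum>w\<leftarrow>stuffle [j] (replicate (Suc m) 1). f w) = ins f j (Suc m) + ins f (Suc j) m"
proof (induction m arbitrary: f)
  case 0
  show ?case by (simp add: ins_def)
next
  case (Suc m)
  have shift: "ins f j (Suc m) = f (j # replicate (Suc m) 1) + ins (\<lambda>w. f (1 # w)) j m" for f j m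
    unfolding ins_def by (subst sum.atMost_Suc_shift) simp
  show ?case
    using Suc[of "\<lambda>w. f (1 # w)"] unfolding shift[of f j "Suc m"] shift[of f "Suc j" m]
    by (simp add: o_def algebra_simps)
qed

definition ones_poly :: "nat \<Rightarrow> real poly" where "ones_poly m = harmonic_poly (replicate m 1)"

lemma positive_index_replicate [simp]: "positive_index (replicate m 1)"
  by (auto simp: positive_index_def)

text \<open>By \<open>stuffle_ones\<close>, the sums over insertions of \<open>j\<close>, \<open>j + 1\<close>, and so on telescope.\<close>

lemma newton_aux:
  assumes "1 \<le> j"
  shows "(\<Sum>p\<le>n. harmonic_poly (replicate p 1 @ j # replicate (n - p) 1))
    = (\<Sum>i\<le>n. (-1) ^ i * (harmonic_poly [j + i] * ones_poly (n - i)))"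
  using assms
proof (induction n arbitrary: j)
  case 0
  show ?case by (simp add: ones_poly_def harmonic_poly_Nil)
next
  case (Suc m)
  have "harmonic_poly [j] * ones_poly (Suc m) = (\<Sum>p\<le>Suc m. harmonic_poly (replicate p 1 @ j # replicate (Suc m - p) 1))
      + (\<Sum>p\<le>m. harmonic_poly (replicate p 1 @ Suc j # replicate (m - p) 1))"
    unfolding ones_poly_def stuffle_ones[symmetric]
    using Suc.prems positive_index_replicate by (intro harmonic_poly_stuffle) auto
  then have "(\<Sum>p\<le>Suc m. harmonic_poly (replicate p 1 @ j # replicate (Suc m - p) 1))
      = harmonic_poly [j] * ones_poly (Suc m) - (\<Sum>i\<le>m. (-1) ^ i * (harmonic_poly [Suc j + i] * ones_poly (m - i)))"
    using Suc.IH[of "Suc j"] by (simp add: algebra_simps)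
  also have "\<dots> = (\<Sum>i\<le>Suc m. (-1) ^ i * (harmonic_poly [j + i] * ones_poly (Suc m - i)))"
    by (subst sum.atMost_Suc_shift) (simp add: sum_negf)
  finally show ?case .
qed

text \<open>Newton's identity between elementary symmetric functions (\<open>ones_poly\<close>) and power sums (single entries) in the variables \<open>1 / m\<close>.\<close>

lemma newton:
  "of_nat (Suc n) * ones_poly (Suc n) = (\<Sum>i\<le>n. (-1) ^ i * (harmonic_poly [Suc i] * ones_poly (n - i)))"
proof -
  have "(\<Sum>p\<le>n. harmonic_poly (replicate p 1 @ 1 # replicate (n - p) 1)) = (\<Sum>p\<le>n. ones_poly (Suc n))"
  proof (intro sum.cong refl)
    fix p assume "p \<in> {..n}"
    then have "replicate p 1 @ 1 # replicate (n - p) 1 = replicate (p + Suc (n - p)) (1 :: nat)"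
      by (simp only: replicate_add replicate_Suc)
    also have "p + Suc (n - p) = Suc n" using \<open>p \<in> {..n}\<close> by simp
    finally show "harmonic_poly (replicate p 1 @ 1 # replicate (n - p) 1) = ones_poly (Suc n)"
      by (simp only: ones_poly_def)
  qed
  then show ?thesis using newton_aux[of 1 n] by simp
qed

lemma harmonic_poly_single: "2 \<le> k \<Longrightarrow> harmonic_poly [k] = [:mzv [k]:]"
  using harmonic_poly_admissible[of "[]" k] by simp

lemma ones_poly_weight: "coeff (ones_poly m) i \<in> weight_space (int m - int i)"
  using harmonic_coeff_in_weight_space[OF positive_index_replicate, of m i] by (simp add: ones_poly_def sum_list_replicate)

lemma newton_coeff:
  "real (Suc n) * coeff (ones_poly (Suc n)) j = (\<Sum>i\<le>n. (-1) ^ i * coeff (harmonic_poly [Suc i] * ones_poly (n - i)) j)"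
proof -
  have "coeff (of_nat (Suc n) * ones_poly (Suc n)) j = real (Suc n) * coeff (ones_poly (Suc n)) j"
    by (simp add: of_nat_poly del: of_nat_Suc)
  moreover have "coeff ((-1) ^ i * p) j = (-1) ^ i * coeff p j" for i and p :: "real poly"
    by (cases "even i") simp_all
  ultimately show ?thesis unfolding newton by (simp add: coeff_sum)
qed

text \<open>The coefficient is \<open>1 / n!\<close>: only the term \<open>i = 0\<close> of Newton's identity reaches the top degree.\<close>

lemma ones_poly_leading: "coeff (ones_poly n) n \<noteq> 0"
proof (induction n)
  case 0
  show ?case by (simp add: ones_poly_def harmonic_poly_Nil)
next
  case (Suc n)
  have "coeff (harmonic_poly [Suc i] * ones_poly (n - i)) (Suc n) = 0" if "i \<in> {..n} - {0}" for i
  proof -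
    have "coeff (ones_poly (n - i)) (Suc n) = 0"
      by (rule weight_space_neg[OF _ ones_poly_weight]) auto
    then show ?thesis using that by (simp add: harmonic_poly_single)
  qed
  then have "real (Suc n) * coeff (ones_poly (Suc n)) (Suc n) = coeff (harmonic_poly [1] * ones_poly n) (Suc n)"
    unfolding newton_coeff by (subst sum.remove[of _ 0]) (auto intro!: sum.neutral)
  also have "\<dots> = coeff (ones_poly n) n" unfolding harmonic_poly_1 by simp
  finally show ?case using Suc by auto
qed

lemma mzv_single_in_prod: "2 \<le> k \<Longrightarrow> mzv [k] \<in> mzv_prod_space k"
  unfolding mzv_prod_space_def rat_span_def by (rule Q.span_base) simp

lemma minus_one_power_mem: "Q.subspace V \<Longrightarrow> x \<in> V \<Longrightarrow> (-1) ^ i * x \<in> V"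
  by (cases "even i") (auto intro: Q.subspace_neg)

text \<open>In Newton's identity the term with \<open>i = 0\<close> has no constant term, the last one is a single zeta value and all others are products.\<close>

lemma ones_poly_const: "1 \<le> l \<Longrightarrow> coeff (ones_poly l) 0 \<in> mzv_prod_space l"
proof -
  assume "1 \<le> l"
  then obtain n where l: "l = Suc n" by (cases l) auto
  have "coeff (harmonic_poly [Suc i] * ones_poly (n - i)) 0 \<in> mzv_prod_space (Suc n)" if "i \<le> n" for i
  proof (cases "i = 0")
    case True
    then show ?thesis using harmonic_poly_1 by (simp add: Q.subspace_0)
  next
    case i: False
    then have e: "coeff (harmonic_poly [Suc i] * ones_poly (n - i)) 0 = mzv [Suc i] * coeff (ones_poly (n - i)) 0"
      by (simp add: harmonic_poly_single)
    show ?thesis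
    proof (cases "i = n")
      case True
      then show ?thesis using i mzv_single_in_prod[of "Suc n"] unfolding e
        by (simp add: ones_poly_def harmonic_poly_Nil)
    next
      case False
      have "mzv [Suc i] \<in> weight_space (int (Suc i))"
        using i by (intro mzv_in_weight_space) (auto simp: admissible_def)
      from weight_space_mult[OF this ones_poly_weight[of "n - i" 0]] that False
      have "mzv [Suc i] * coeff (ones_poly (n - i)) 0 \<in> mzv_prod_space (nat (int (Suc i) + (int (n - i) - int 0)))"
        by simp
      also have "int (Suc i) + (int (n - i) - int 0) = int (Suc n)" using that by simp
      finally show ?thesis unfolding e nat_int .
    qed
  qed
  then have "real (Suc n) * coeff (ones_poly (Suc n)) 0 \<in> mzv_prod_space (Suc n)"
    unfolding newton_coeff by (intro Q.subspace_sum minus_one_power_mem) auto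
  from subspace_scale_nat[OF _ this, of "Suc n"] show ?thesis by (simp add: l)
qed

lemma scale_change_0: "scale_change 0 = 1"
  by (simp add: scale_change_def shuffle_poly_Nil)

lemma scale_change_const: "1 \<le> i \<Longrightarrow> coeff (scale_change i) 0 \<in> weight_space (int i)"
  unfolding scale_change_def coeff_sum_list
proof (rule subspace_sum_list)
  fix v assume i: "1 \<le> i" and v: "v \<in> set (harmonic_power_words i)"
  then have v': "positive_index v" "sum_list v = i" by (auto intro: harmonic_power_words_pos harmonic_power_words_sum)
  then have "zword v \<noteq> []" using i by (cases v) auto
  then have "coeff (shuffle_poly (zword v)) 0 \<in> mzv_space i (count (mset (zword v)) LY)"
    using shuffle_const_in_mzv_space[of "zword v"] by (simp add: length_zword v')
  then show "coeff (shuffle_poly (zword v)) 0 \<in> weight_space (int i)"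
    using mzv_space_subset_weight_space by blast
qed simp

lemma shuffle_const_expand:
  assumes "positive_index ks"
  shows "coeff (shuffle_poly (zword ks)) 0 = (\<Sum>i\<le>sum_list ks. coeff (harmonic_poly ks) i * coeff (scale_change i) 0)"
proof -
  have z: "coeff (harmonic_poly ks) i = 0" if "sum_list ks < i" for i
    by (rule weight_space_neg[OF _ harmonic_coeff_in_weight_space[OF assms, of i]]) (use that in simp)
  then have "degree (harmonic_poly ks) \<le> sum_list ks" by (intro degree_le) auto
  then show ?thesis unfolding shuffle_poly_eq_harmonic_poly[OF assms] coeff_sum coeff_smult
    by (intro sum.mono_neutral_left) (auto simp: coeff_eq_0)
qed

text \<open>In the expansion by \<open>scale_change\<close>, the terms strictly between the first and the last are products of two elements of positive weight.\<close>

lemma shuffle_const_middle: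
  assumes "positive_index ks" "sum_list ks = Suc l"
  shows "coeff (shuffle_poly (zword ks)) 0 - coeff (harmonic_poly ks) 0
      - coeff (harmonic_poly ks) (Suc l) * coeff (scale_change (Suc l)) 0 \<in> mzv_prod_space (Suc l)"
proof -
  have "coeff (shuffle_poly (zword ks)) 0 - coeff (harmonic_poly ks) 0
      - coeff (harmonic_poly ks) (Suc l) * coeff (scale_change (Suc l)) 0
      = (\<Sum>i<l. coeff (harmonic_poly ks) (Suc i) * coeff (scale_change (Suc i)) 0)"
    unfolding shuffle_const_expand[OF assms(1)] assms(2)
    by (subst sum.atMost_Suc, subst sum.atMost_shift) (simp add: scale_change_0)
  also have "\<dots> \<in> mzv_prod_space (Suc l)"
  proof (rule Q.subspace_sum)
    fix i assume i: "i \<in> {..<l}"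
    have "coeff (harmonic_poly ks) (Suc i) \<in> weight_space (int (Suc l) - int (Suc i))"
      using harmonic_coeff_in_weight_space[OF assms(1), of "Suc i"] by (simp only: assms(2))
    from weight_space_mult[OF this scale_change_const[of "Suc i"]] i
    show "coeff (harmonic_poly ks) (Suc i) * coeff (scale_change (Suc i)) 0 \<in> mzv_prod_space (Suc l)"
      by (simp add: nat_add_distrib)
  qed simp
  finally show ?thesis .
qed

text \<open>An admissible index has an entry exceeding 1, so its weight exceeds its depth.\<close>

lemma mzv_space_full_depth: "1 \<le> l \<Longrightarrow> mzv_space l l = {0}"
proof -
  assume l: "1 \<le> l"
  have eq: "{mzv ls | ls. admissible ls \<and> sum_list ls = l \<and> length ls = l} = {}"
  proof -
    have "length ls < sum_list ls" if adm: "admissible ls" for ls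
    proof -
      obtain k ks where ls: "ls = k # ks" "2 \<le> k" "\<forall>j\<in>set ks. 1 \<le> j"
        using adm by (cases ls) (auto simp: admissible_def)
      have "length ks \<le> sum_list ks" using ls(3) by (induction ks) auto
      then show ?thesis using ls by simp
    qed
    then show ?thesis by force
  qed
  show ?thesis unfolding mzv_space_def rat_span_def eq by simp
qed

text \<open>Compare the two regularizations of the index with \<open>l + 1\<close> entries 1. Its shuffle constant vanishes and its harmonic constant
is a product, so the remaining extreme term, a nonzero rational multiple of the constant in question, is a product as well.\<close>

lemma scale_change_const_prod: "coeff (scale_change (Suc l)) 0 \<in> mzv_prod_space (Suc l)"
proof -
  let ?ks = "replicate (Suc l) (1 :: nat)" and ?V = "mzv_prod_space (Suc l)"
  let ?c = "coeff (ones_poly (Suc l)) (Suc l)" and ?e = "coeff (scale_change (Suc l)) 0"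
  have p: "positive_index ?ks" by (rule positive_index_replicate)
  have s: "sum_list ?ks = Suc l" by (simp add: sum_list_replicate)
  have "coeff (shuffle_poly (zword ?ks)) 0 \<in> mzv_space (Suc l) (Suc l)"
    using shuffle_const_in_mzv_space[OF H1_word_zword[of ?ks]]
    by (simp only: length_zword[OF p] count_zword s length_replicate) simp
  then have z: "coeff (shuffle_poly (zword ?ks)) 0 = 0" by (simp add: mzv_space_full_depth)
  have "0 - coeff (ones_poly (Suc l)) 0 - ?c * ?e \<in> ?V"
    using shuffle_const_middle[OF p s] unfolding z ones_poly_def[symmetric] .
  then have "(0 - coeff (ones_poly (Suc l)) 0 - ?c * ?e) + coeff (ones_poly (Suc l)) 0 \<in> ?V"
    by (rule Q.subspace_add[rotated]) (simp_all add: ones_poly_const)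
  then have "- (?c * ?e) \<in> ?V" by simp
  from Q.subspace_neg[OF _ this] have ce: "?c * ?e \<in> ?V" by simp
  obtain q where q: "?c = of_rat q" using ones_poly_weight[of "Suc l" "Suc l"] weight_space_0 by auto
  have "of_rat (inverse q) * (?c * ?e) \<in> ?V" using ce by (intro Q.subspace_scale) simp
  moreover have "of_rat (inverse q) * (?c * ?e) = ?e"
    using ones_poly_leading[of "Suc l"] unfolding q by (simp add: of_rat_inverse)
  ultimately show ?thesis by simp
qed

text \<open>Only the extreme term of the expansion remains to be treated. Its coefficient has weight 0 and is rational, and the constant of
\<open>scale_change\<close> is a product by \<open>scale_change_const_prod\<close>.\<close>

lemma harmonic_shuffle_congruent:
  assumes "positive_index ks" "sum_list ks = l" "1 \<le> l"
  shows "coeff (harmonic_poly ks) 0 - coeff (shuffle_poly (zword ks)) 0 \<in> mzv_prod_space l"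
proof -
  obtain l' where l: "l = Suc l'" using assms(3) by (cases l) auto
  let ?c = "coeff (harmonic_poly ks) (Suc l')"
  obtain q where "?c = of_rat q"
    using harmonic_coeff_in_weight_space[OF assms(1), of "Suc l'"] assms(2) l weight_space_0 by auto
  then have "?c * coeff (scale_change (Suc l')) 0 \<in> mzv_prod_space (Suc l')"
    using Q.subspace_scale[OF _ scale_change_const_prod] by simp
  from Q.subspace_add[OF _ shuffle_const_middle[OF assms(1)] this] assms(2) l
  have "coeff (shuffle_poly (zword ks)) 0 - coeff (harmonic_poly ks) 0 \<in> mzv_prod_space l" by simp
  from Q.subspace_neg[OF _ this] show ?thesis by simp
qed

section \<open>The insertion relation\<close>

fun add_to_entry :: "nat \<Rightarrow> nat list \<Rightarrow> nat list list" where
  "add_to_entry k [] = []"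
| "add_to_entry k (b # a) = ((k + b) # a) # map ((#) b) (add_to_entry k a)"

lemma in_add_to_entry:
  "w \<in> set (add_to_entry k a) \<Longrightarrow> positive_index a \<Longrightarrow> positive_index w \<and> length w = length a \<and> sum_list w = k + sum_list a \<and> a \<noteq> []"
  by (induction k a arbitrary: w rule: add_to_entry.induct) auto

lemma insert_block_later_replicate: "insert_block_later c (replicate n LX @ w) = map ((@) (replicate n LX)) (insert_block_later c w)"
  by (induction n) (simp_all add: o_def)

text \<open>The harmonic product with one entry \<open>c + 1\<close> consists of the insertions of this entry and of its additions to an entry, which
have smaller depth.\<close>

lemma stuffle_single_eq_insert_block:
  fixes f :: "letter list \<Rightarrow> real"
  assumes "positive_index a"
  shows "(\<Sum>w\<leftarrow>stuffle [Suc c] a. f (zword w)) = (\<Sum>w\<leftarrow>insert_block c (zword a). f w) + (\<Sum>w\<leftarrow>add_to_entry (Suc c) a. f (zword w))"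
  using assms
proof (induction a arbitrary: f)
  case Nil
  show ?case by (simp add: insert_block_def)
next
  case (Cons b a)
  have "(\<Sum>w\<leftarrow>stuffle [Suc c] a. f (replicate (b - 1) LX @ LY # zword w))
     = (\<Sum>w\<leftarrow>insert_block c (zword a). f (replicate (b - 1) LX @ LY # w))
      + (\<Sum>w\<leftarrow>add_to_entry (Suc c) a. f (replicate (b - 1) LX @ LY # zword w))"
    using Cons.prems by (intro Cons.IH[of "\<lambda>w. f (replicate (b - 1) LX @ LY # w)"]) simp
  then show ?case
    by (simp add: insert_block_def insert_block_later_replicate o_def)
qed

section \<open>Congruences modulo lower depth and products\<close>

definition congruence_space :: "nat \<Rightarrow> nat \<Rightarrow> real set" where
  "congruence_space l n = mzv_space l (n - 1) + mzv_prod_space l"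

lemma congruence_space_eq: "congruence_space l n = {x + y | x y. x \<in> mzv_space l (n - 1) \<and> y \<in> mzv_prod_space l}"
  unfolding congruence_space_def set_plus_def by blast

lemma subspace_congruence_space [simp]: "Q.subspace (congruence_space l n)"
  unfolding congruence_space_eq by (rule Q.subspace_sums) simp_all

lemma mzv_space_subset_congruence_space: "x \<in> mzv_space l (n - 1) \<Longrightarrow> x \<in> congruence_space l n"
  unfolding congruence_space_eq using Q.subspace_0[OF subspace_mzv_prod_space] by force

lemma mzv_prod_space_subset_congruence_space: "x \<in> mzv_prod_space l \<Longrightarrow> x \<in> congruence_space l n"
  unfolding congruence_space_eq using Q.subspace_0[OF subspace_mzv_space] by force

abbreviation shuffle_const :: "letter list \<Rightarrow> real" where "shuffle_const w \<equiv> coeff (shuffle_poly w) 0"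

lemma harmonic_const_mult_in_prod:
  assumes "positive_index u" "positive_index v" "u \<noteq> []" "v \<noteq> []"
  shows "coeff (harmonic_poly u) 0 * coeff (harmonic_poly v) 0 \<in> mzv_prod_space (sum_list u + sum_list v)"
proof -
  have "1 \<le> sum_list u" "1 \<le> sum_list v" using assms by (cases u; cases v; simp)+
  then show ?thesis
    using weight_space_mult[OF harmonic_coeff_in_weight_space[OF assms(1), of 0] harmonic_coeff_in_weight_space[OF assms(2), of 0]]
    by (simp add: nat_add_distrib)
qed

lemma harmonic_single_const: "1 \<le> k \<Longrightarrow> coeff (harmonic_poly [k]) 0 \<in> mzv_prod_space k"
  using harmonic_poly_1 mzv_single_in_prod[of k] harmonic_poly_single[of k]
  by (cases "k = 1") (auto simp: Q.subspace_0)

text \<open>For harmonic values the sum over the harmonic product is a product of two values. Passing to shuffle values costs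
products only, and the additions to an entry have depth \<open>n - 1\<close>.\<close>

lemma depth_one_relation:
  assumes "positive_index a" "l = Suc c + sum_list a" "n = Suc (length a)"
  shows "(\<Sum>w\<leftarrow>insert_block c (zword a). shuffle_const w) \<in> congruence_space l n"
proof -
  have "(\<Sum>w\<leftarrow>stuffle [Suc c] a. coeff (harmonic_poly w) 0) = coeff (harmonic_poly [Suc c]) 0 * coeff (harmonic_poly a) 0"
    using arg_cong[OF harmonic_poly_stuffle[of "[Suc c]" a], of "\<lambda>p. coeff p 0"] assms(1)
    by (simp add: coeff_sum_list coeff_mult_0)
  also have "\<dots> \<in> mzv_prod_space l"
  proof (cases "a = []")
    case True
    then show ?thesis using harmonic_single_const[of "Suc c"] assms by (simp add: harmonic_poly_Nil)
  next
    case False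
    then show ?thesis using harmonic_const_mult_in_prod[of "[Suc c]" a] assms by simp
  qed
  finally have 1: "(\<Sum>w\<leftarrow>stuffle [Suc c] a. coeff (harmonic_poly w) 0) \<in> mzv_prod_space l" .
  have 2: "(\<Sum>w\<leftarrow>stuffle [Suc c] a. coeff (harmonic_poly w) 0 - shuffle_const (zword w)) \<in> mzv_prod_space l"
  proof (rule subspace_sum_list)
    fix w assume w: "w \<in> set (stuffle [Suc c] a)"
    show "coeff (harmonic_poly w) 0 - shuffle_const (zword w) \<in> mzv_prod_space l"
      using in_stuffle_sum[OF w] in_stuffle_positive_index[OF w] assms by (intro harmonic_shuffle_congruent) auto
  qed simp
  have "(\<Sum>w\<leftarrow>stuffle [Suc c] a. shuffle_const (zword w)) \<in> mzv_prod_space l"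
    using Q.subspace_diff[OF _ 1 2] by (simp add: sum_list_subtractf)
  moreover have "(\<Sum>w\<leftarrow>add_to_entry (Suc c) a. shuffle_const (zword w)) \<in> congruence_space l n"
  proof (rule subspace_sum_list)
    fix w assume "w \<in> set (add_to_entry (Suc c) a)"
    then have w: "positive_index w" "length w = n - 1" "sum_list w = l" "a \<noteq> []" using in_add_to_entry[of w] assms by auto
    then have "zword w \<noteq> []" using assms by (cases w) auto
    from shuffle_const_in_mzv_space[OF H1_word_zword this] w
    show "shuffle_const (zword w) \<in> congruence_space l n"
      by (intro mzv_space_subset_congruence_space) (simp add: length_zword count_zword)
  qed simp
  ultimately show ?thesis
    using stuffle_single_eq_insert_block[OF assms(1), of "shuffle_const" c]
    by (metis (no_types, lifting) Q.subspace_diff add_diff_cancel_right' mzv_prod_space_subset_congruence_space subspace_congruence_space)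
qed

lemma shuffle_const_mult_in_prod:
  assumes "H1_word u" "H1_word v" "u \<noteq> []" "v \<noteq> []"
  shows "shuffle_const u * shuffle_const v \<in> mzv_prod_space (length u + length v)"
proof -
  have "shuffle_const u \<in> weight_space (int (length u))" "shuffle_const v \<in> weight_space (int (length v))"
    using shuffle_const_in_mzv_space mzv_space_subset_weight_space assms by blast+
  from weight_space_mult[OF this] show ?thesis using assms by (simp add: nat_add_distrib Suc_le_eq)
qed

lemma insert_block_later_props: "w \<in> set (insert_block_later c W) \<Longrightarrow> length w = length W + c + 1 \<and> count (mset w) LY = Suc (count (mset W) LY)
    \<and> (W = [] \<or> last W = LY \<longrightarrow> w \<noteq> [] \<and> last w = LY)"
  by (induction c W arbitrary: w rule: insert_block_later.induct) (auto split: if_splits)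

text \<open>The value on words of other weight or depth is set to zero, which makes the shuffle and insertion relations hold for all words
and allows the cyclic symmetry to be applied.\<close>

lemma shuffle_congruences:
  fixes \<phi> :: "real \<Rightarrow> real"
  assumes add: "\<And>x y. \<phi> (x + y) = \<phi> x + \<phi> y" and zero: "\<And>x. x \<in> congruence_space l n \<Longrightarrow> \<phi> x = 0"
    and ks: "positive_index ks" "positive_index ls" "l = sum_list ks + 1 + sum_list ls" "n = length ks + 1 + length ls"
  shows "\<phi> (shuffle_const (zword (ks @ 1 # ls))) = \<phi> (shuffle_const (zword (ls @ 1 # ks)))"
    and "\<phi> (shuffle_const (zword (ks @ 1 # ls))) = (-1) ^ (l - 1) * \<phi> (shuffle_const (zword (rev ks @ 1 # rev ls)))"
proof -
  have phi_0: "\<phi> 0 = 0" using add[of 0 0] by simp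
  have phi_sum: "\<phi> (\<Sum>w\<leftarrow>T. f w) = (\<Sum>w\<leftarrow>T. \<phi> (f w))" for T :: "letter list list" and f
    by (induction T) (simp_all add: phi_0 add)
  define f where "f = (\<lambda>w. if length w = l \<and> count (mset w) LY = n then \<phi> (shuffle_const w) else 0)"
  define G where "G = x_regularize f"
  have f_sh: "(\<Sum>w\<leftarrow>shuffle_list (u @ [LY]) (v @ [LY]). f w) = 0" for u v
  proof (cases "length u + length v + 2 = l \<and> count (mset u + mset v) LY + 2 = n")
    case True
    have H: "H1_word (u @ [LY])" "H1_word (v @ [LY])" by (simp_all add: H1_word_def)
    have "f w = \<phi> (shuffle_const w)" if "w \<in> set (shuffle_list (u @ [LY]) (v @ [LY]))" for w
      using in_shuffle_list_length[OF that] in_shuffle_list_mset[OF that] True by (auto simp: f_def)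
    then have "(\<Sum>w\<leftarrow>shuffle_list (u @ [LY]) (v @ [LY]). f w) = (\<Sum>w\<leftarrow>shuffle_list (u @ [LY]) (v @ [LY]). \<phi> (shuffle_const w))"
      by (intro arg_cong[where f = sum_list] map_cong refl)
    also have "\<dots> = \<phi> (shuffle_const (u @ [LY]) * shuffle_const (v @ [LY]))"
      unfolding phi_sum[symmetric] coeff_sum_list[symmetric] shuffle_poly_shuffle_list[OF H, symmetric] by (simp add: coeff_mult_0)
    also have "\<dots> = 0"
      using shuffle_const_mult_in_prod[OF H] True by (intro zero mzv_prod_space_subset_congruence_space) simp
    finally show ?thesis .
  next
    case False
    have "f w = 0" if "w \<in> set (shuffle_list (u @ [LY]) (v @ [LY]))" for w
      using in_shuffle_list_length[OF that] in_shuffle_list_mset[OF that] False by (auto simp: f_def)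
    then have "(\<Sum>w\<leftarrow>shuffle_list (u @ [LY]) (v @ [LY]). f w) = (\<Sum>w\<leftarrow>shuffle_list (u @ [LY]) (v @ [LY]). 0)"
      by (intro arg_cong[where f = sum_list] map_cong refl)
    then show ?thesis by simp
  qed
  have S: "(\<Sum>w\<leftarrow>shuffle_list u v. G w) = 0" if "u \<noteq> []" "v \<noteq> []" for u v
    unfolding G_def by (rule x_regularize_shuffle_list[OF f_sh that])
  have Gf: "G w = f w" if "w \<noteq> []" "last w = LY" for w
    unfolding G_def using that x_regularize_H1[of f "butlast w"] by (metis append_butlast_last_id)
  have H: "(\<Sum>w\<leftarrow>insert_block c W. G w) = 0" if W: "W = [] \<or> last W = LY" for c W
  proof -
    have props: "length w = length W + c + 1 \<and> count (mset w) LY = Suc (count (mset W) LY) \<and> w \<noteq> [] \<and> last w = LY"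
      if "w \<in> set (insert_block c W)" for w
      using that insert_block_later_props[of w c W] W by (auto simp: insert_block_def)
    obtain a where a: "W = zword a" "positive_index a" using W H1_word_cases[of W] by (auto simp: H1_word_def positive_index_def)
    have GG: "(\<Sum>w\<leftarrow>insert_block c W. G w) = (\<Sum>w\<leftarrow>insert_block c W. f w)"
      by (intro arg_cong[where f = sum_list] map_cong refl Gf) (use props in auto)
    show ?thesis
    proof (cases "length W + c + 1 = l \<and> Suc (count (mset W) LY) = n")
      case True
      then have "(\<Sum>w\<leftarrow>insert_block c W. f w) = (\<Sum>w\<leftarrow>insert_block c W. \<phi> (shuffle_const w))"
        by (intro arg_cong[where f = sum_list] map_cong refl) (use props in \<open>auto simp: f_def\<close>)
      also have "\<dots> = \<phi> (\<Sum>w\<leftarrow>insert_block c W. shuffle_const w)" by (simp add: phi_sum)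
      also have "\<dots> = 0" unfolding a(1) using True a
        by (intro zero depth_one_relation) (auto simp: length_zword count_zword)
      finally show ?thesis using GG by simp
    next
      case False
      then have "(\<Sum>w\<leftarrow>insert_block c W. f w) = (\<Sum>w\<leftarrow>insert_block c W. 0)"
        by (intro arg_cong[where f = sum_list] map_cong refl) (use props in \<open>auto simp: f_def\<close>)
      then show ?thesis using GG by simp
    qed
  qed
  have R: "G (replicate c LX @ LY # W) = G (W @ LY # replicate c LX)" for c W
    by (rule rotate_block[OF S H])
  have eval: "G (zword (us @ 1 # vs)) = \<phi> (shuffle_const (zword (us @ 1 # vs)))"
    if "positive_index us" "positive_index vs" "l = sum_list us + 1 + sum_list vs" "n = length us + 1 + length vs" for us vs
  proof -
    have ne: "zword (us @ 1 # vs) \<noteq> []" by (simp add: zword_def)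
    moreover have "last (zword (us @ 1 # vs)) = LY" using H1_word_zword[of "us @ 1 # vs"] ne by (simp add: H1_word_def)
    ultimately show ?thesis using that by (simp add: Gf f_def length_zword count_zword)
  qed
  have len: "length (zword (ks @ 1 # ls)) = l" using ks by (simp add: length_zword)
  show "\<phi> (shuffle_const (zword (ks @ 1 # ls))) = \<phi> (shuffle_const (zword (ls @ 1 # ks)))"
    using swap_around_one[of G ks ls, OF R] eval[of ks ls] eval[of ls ks] ks by simp
  have r: "positive_index (rev ks)" "positive_index (rev ls)" using ks by (simp_all add: positive_index_def)
  show "\<phi> (shuffle_const (zword (ks @ 1 # ls))) = (-1) ^ (l - 1) * \<phi> (shuffle_const (zword (rev ks @ 1 # rev ls)))"
    using reverse_around_one[of G ks ls, OF S R] eval[of ks ls] eval[of "rev ks" "rev ls"] ks r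
    unfolding len by (simp add: sum_list_rev)
qed

theorem theorem1p2:
  fixes n i l :: nat and k_i l_i :: "nat list"
  assumes "1 \<le> n" and "1 \<le> i" and "i \<le> n"
    and "length k_i = i - 1" and "length l_i = n - i"
    and "\<forall>j\<in>set k_i. 1 \<le> j" and "\<forall>j\<in>set l_i. 1 \<le> j"
    and "l = sum_list (k_i @ [1] @ l_i)"
  shows "\<forall>\<zeta>\<in>{zeta_harmonic, zeta_shuffle}.
    cong_modulo (mzv_space l (n - 1) + mzv_prod_space l)
      (\<zeta> (k_i @ [1] @ l_i)) (\<zeta> (l_i @ [1] @ k_i)) \<and>
    cong_modulo (mzv_space l (n - 1) + mzv_prod_space l)
      (\<zeta> (k_i @ [1] @ l_i)) ((-1) ^ (l - 1) * \<zeta> (rev k_i @ [1] @ rev l_i))"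
proof
  fix \<zeta> assume z: "\<zeta> \<in> {zeta_harmonic, zeta_shuffle}"
  have ks: "positive_index k_i" "positive_index l_i" "l = sum_list k_i + 1 + sum_list l_i" "n = length k_i + 1 + length l_i"
    using assms by (auto simp: positive_index_def)
  have r: "positive_index (rev k_i)" "positive_index (rev l_i)" using ks by (simp_all add: positive_index_def)
  have shuf: "zeta_shuffle us = shuffle_const (zword us)" for us
    by (simp add: zeta_shuffle_eq poly_0_coeff_0)
  have to_shuf: "\<zeta> us - shuffle_const (zword us) \<in> congruence_space l n" if us: "positive_index us" "sum_list us = l" for us
  proof -
    have "zeta_harmonic us - shuffle_const (zword us) \<in> congruence_space l n"
      using harmonic_shuffle_congruent[OF us] ks by (simp add: zeta_harmonic_eq us poly_0_coeff_0 mzv_prod_space_subset_congruence_space)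
    then show ?thesis using z by (auto simp: shuf Q.subspace_0)
  qed
  let ?a = "k_i @ 1 # l_i" and ?b = "l_i @ 1 # k_i" and ?c = "rev k_i @ 1 # rev l_i"
  have sums: "positive_index ?a" "sum_list ?a = l" "positive_index ?b" "sum_list ?b = l" "positive_index ?c" "sum_list ?c = l"
    using ks r by (simp_all add: sum_list_rev)
  have "\<zeta> ?a - \<zeta> ?b \<in> congruence_space l n"
  proof (rule in_subspaceI)
    fix \<phi> :: "real \<Rightarrow> real"
    assume phi: "\<And>x y. \<phi> (x + y) = \<phi> x + \<phi> y" "\<And>x. x \<in> congruence_space l n \<Longrightarrow> \<phi> x = 0"
    have d: "\<phi> (x - y) = \<phi> x - \<phi> y" for x y using phi(1)[of "x - y" y] by simp
    show "\<phi> (\<zeta> ?a - \<zeta> ?b) = 0"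
      using phi(2)[OF to_shuf[OF sums(1,2)]] phi(2)[OF to_shuf[OF sums(3,4)]]
        shuffle_congruences(1)[OF phi ks] by (simp add: d)
  qed simp
  moreover have "\<zeta> ?a - (-1) ^ (l - 1) * \<zeta> ?c \<in> congruence_space l n"
  proof (rule in_subspaceI)
    fix \<phi> :: "real \<Rightarrow> real"
    assume phi: "\<And>x y. \<phi> (x + y) = \<phi> x + \<phi> y" "\<And>x. x \<in> congruence_space l n \<Longrightarrow> \<phi> x = 0"
    have d: "\<phi> (x - y) = \<phi> x - \<phi> y" for x y using phi(1)[of "x - y" y] by simp
    have "\<phi> (- x) = - \<phi> x" for x using d[of x x] d[of "x - x" x] by simp
    then have s: "\<phi> ((-1) ^ m * x) = (-1) ^ m * \<phi> x" for m x by (cases "even m") simp_all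
    show "\<phi> (\<zeta> ?a - (-1) ^ (l - 1) * \<zeta> ?c) = 0"
      using phi(2)[OF to_shuf[OF sums(1,2)]] phi(2)[OF to_shuf[OF sums(5,6)]]
        shuffle_congruences(2)[OF phi ks] by (simp add: d s)
  qed simp
  ultimately show "cong_modulo (mzv_space l (n - 1) + mzv_prod_space l)
      (\<zeta> (k_i @ [1] @ l_i)) (\<zeta> (l_i @ [1] @ k_i)) \<and>
    cong_modulo (mzv_space l (n - 1) + mzv_prod_space l)
      (\<zeta> (k_i @ [1] @ l_i)) ((-1) ^ (l - 1) * \<zeta> (rev k_i @ [1] @ rev l_i))"
    by (simp add: cong_modulo_def congruence_space_def)
qed

end
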